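(* Let $\mathcal H=\{(S,\mathcal F,\delta_0),(p,\lambda),(A,\mathcal A,\varrho),(m,\tau)\}$ be a strongly ergodic, regular HMM with limit measure $\pi$, and let $\mathbf P$ be the induced filter kernel on $(K,\mathcal E)$, where $K=\mathcal P_\lambda(S,\mathcal F)$. Suppose also that $\mathcal H$ fulfills Condition E. Then $\mathbf P$ is weakly contracting. If furthermore at least one of the following holds: 1) there exists a measure $\mu\in\mathcal P(K,\mathcal E)$ which is invariant with respect to $\mathbf P$ (that is, $\mu\mathbf P=\mu$); 2) there exists an element $x_0\in K$ such that the sequence $\{\mathbf P^n(x_0,\cdot),\ n=1,2,\dots\}$ is tight; 3) $\mathcal H$ is uniformly ergodic; then $\mathbf P$ is weakly ergodic.
   Context: Every metric space carries its Borel $\sigma$-algebra. $\mathcal P(X,\mathcal X)$ and $\mathcal Q(X,\mathcal X)$ denote the probability measures and the finite nonnegative measures on $(X,\mathcal X)$. For $\mu,\nu\in\mathcal Q(X,\mathcal X)$, $\delta_{TV}(\mu,\nu)=\|\mu-\nu\|=\sup_F(\mu(F)-\nu(F))+\sup_F(\nu(F)-\mu(F))$, and $\|\nu\|=\nu(X)$. For a $\sigma$-finite measure $\lambda$, $\mathcal Q_\lambda$ and $\mathcal P_\lambda$ denote the measures in $\mathcal Q$, $\mathcal P$ having a density with respect to $\lambda$. For a transition probability function (Markov kernel) $Q$ on $(X,\mathcal X)$: $Q^1=Q$, $Q^{n+1}(x,F)=\int Q(x,dx')Q^n(x',F)$, $(\mu Q)(F)=\int Q(x,F)\mu(dx)$;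 $\langle u,\mu\rangle=\int u\,d\mu$. HMM with densities: $(S,\delta_0)$ (state space) and $(A,\varrho)$ (observation space) are complete separable metric spaces with Borel $\sigma$-algebras $\mathcal F,\mathcal A$; $\lambda$, $\tau$ are positive $\sigma$-finite measures on $S$, $A$; $m:S\times S\times A\to[0,\infty)$ is measurable with $\int_S\int_A m(s,t,a)\tau(da)\lambda(dt)=1$ for all $s$; $p(s,t)=\int_A m(s,t,a)\tau(da)$; the Markov kernel is $P(s,F)=\int_F p(s,t)\lambda(dt)$. If $S$ (resp. $A$) is denumerable, the metric is taken discrete and $\lambda$ (resp. $\tau$) is counting measure. For $a\in A$, $x\in\mathcal Q_\lambda(S,\mathcal F)$, let $(xM_a)(F)=\int_S\int_F m(s,t,a)\lambda(dt)x(ds)$. $\mathcal H$ is regular if $(x,a)\mapsto xM_a$ is a continuous map $\mathcal Q_\lambda(S,\mathcal F)\times A\to\mathcal Q_\lambda(S,\mathcal F)$ (total variation topology on $\mathcal Q_\lambda$, product topology on the domain). $K=\mathcal P_\lambda(S,\mathcal F)$ with metric $\delta_{TV}$ and Borel $\sigma$-algebra $\mathcal E$. The filter kernel is $\mathbf P(x,E)=\int_{A_x^+} I_E\big(xM_a/\|xM_a\|\big)\|xM_a\|\,\tau(da)$, $x\in K$, $E\in\mathcal E$, where $A_x^+=\{a\in A:\|xM_a\|>0\}$. $\mathcal H$ is strongly ergodic with limit measure $\pi\in\mathcal P(S,\mathcal F)$ if $\lim_n\delta_{TV}(P^n(s,\cdot),\pi)=0$ for all $s\in S$, and uniformly ergodic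 if moreover $\lim_n\sup_{s\in S}\delta_{TV}(P^n(s,\cdot),\pi)=0$. The barycenter of $\mu\in\mathcal P(K,\mathcal E)$ is $\overline b(\mu)(F)=\int_K x(F)\mu(dx)$, $F\in\mathcal F$; $\mathcal P(K|\pi)$ is the set of $\mu\in\mathcal P(K,\mathcal E)$ with $\overline b(\mu)=\pi$. Condition E: for every $\rho>0$ there exist a positive integer $N$ and a number $\alpha>0$ such that for any $\mu,\nu\in\mathcal P(K|\pi)$ there is a coupling $\tilde\mu_N$ of $\mu\mathbf P^N$ and $\nu\mathbf P^N$ (a probability on $K\times K$ with these marginals) with $\tilde\mu_N(\{(x,y)\in K\times K:\delta_{TV}(x,y)<\rho\})\ge\alpha$. For a Markov kernel $Q$ on a metric space $X$ with metric $\phi$: $\mathrm{Lip}_1[X]$ is the set of bounded real functions with $|u(x)-u(y)|\le\phi(x,y)$; $C[X]$ the bounded continuous real functions. $Q$ is weakly contracting if $\lim_n\sup\{\langle u,Q^n(x,\cdot)\rangle-\langle u,Q^n(y,\cdot)\rangle:u\in\mathrm{Lip}_1[X]\}=0$ for all $x,y\in X$. $Q$ is weakly ergodic if it is weakly contracting and there is a probability measure $\nu$ on $X$ with $\lim_n\langle u,Q^n(x,\cdot)\rangle=\langle u,\nu\rangle$ for all $u\in C[X]$ and all $x\in X$. *)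

theory Defs
  imports "HOL-Probability.Probability"
begin

definition metric_borel :: "'x set \<Rightarrow> ('x \<Rightarrow> 'x \<Rightarrow> real) \<Rightarrow> 'x measure" where
  "metric_borel X d = sigma X {U. openin (Metric_space.mtopology X d) U}"

definition Lip1 :: "'x set \<Rightarrow> ('x \<Rightarrow> 'x \<Rightarrow> real) \<Rightarrow> ('x \<Rightarrow> real) set" where
  "Lip1 X d = {u. bounded (u ` X) \<and> (\<forall>x\<in>X. \<forall>y\<in>X. \<bar>u x - u y\<bar> \<le> d x y)}"

definition bcont :: "'x set \<Rightarrow> ('x \<Rightarrow> 'x \<Rightarrow> real) \<Rightarrow> ('x \<Rightarrow> real) set" where
  "bcont X d = {u. bounded (u ` X) \<and> continuous_map (Metric_space.mtopology X d) euclideanreal u}"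

definition tight_seq :: "'x set \<Rightarrow> ('x \<Rightarrow> 'x \<Rightarrow> real) \<Rightarrow> (nat \<Rightarrow> 'x measure) \<Rightarrow> bool" where
  "tight_seq X d M \<longleftrightarrow>
     (\<forall>\<epsilon>>0. \<exists>C. compactin (Metric_space.mtopology X d) C \<and> (\<forall>n\<ge>1. measure (M n) C \<ge> 1 - \<epsilon>))"

text \<open>
  The zeroth power is the identity kernel; the powers from 1 on do not depend on the argument
  \<open>X\<close>. The measure \<open>\<mu> Q\<close> is written \<open>\<mu> \<bind> Q\<close>.
\<close>

fun kernel_power :: "'x measure \<Rightarrow> ('x \<Rightarrow> 'x measure) \<Rightarrow> nat \<Rightarrow> 'x \<Rightarrow> 'x measure" where
  "kernel_power X Q 0 x = return X x"
| "kernel_power X Q (Suc 0) x = Q x"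
| "kernel_power X Q (Suc (Suc n)) x = Q x \<bind> kernel_power X Q (Suc n)"

text \<open>The supremum is taken in the extended reals, as it need not be finite if \<open>d\<close> is unbounded.\<close>

definition weakly_contracting ::
    "'x set \<Rightarrow> ('x \<Rightarrow> 'x \<Rightarrow> real) \<Rightarrow> ('x \<Rightarrow> 'x measure) \<Rightarrow> bool" where
  "weakly_contracting X d Q \<longleftrightarrow>
     (\<forall>x\<in>X. \<forall>y\<in>X.
        (\<lambda>n. SUP u\<in>Lip1 X d.
           ereal ((\<integral>z. u z \<partial>kernel_power (metric_borel X d) Q n x)
                - (\<integral>z. u z \<partial>kernel_power (metric_borel X d) Q n y))) \<longlonglongrightarrow> 0)"

definition weakly_ergodic ::
    "'x set \<Rightarrow> ('x \<Rightarrow> 'x \<Rightarrow> real) \<Rightarrow> ('x \<Rightarrow> 'x measure) \<Rightarrow> bool" where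
  "weakly_ergodic X d Q \<longleftrightarrow>
     weakly_contracting X d Q \<and>
     (\<exists>\<nu>\<in>space (prob_algebra (metric_borel X d)). \<forall>u\<in>bcont X d. \<forall>x\<in>X.
        (\<lambda>n. \<integral>z. u z \<partial>kernel_power (metric_borel X d) Q n x) \<longlonglongrightarrow> (\<integral>z. u z \<partial>\<nu>))"

text \<open>
  The total variation distance is only meant for finite measures on a common \<open>\<sigma>\<close>-algebra. The
  value 0 elsewhere makes it nonnegative and symmetric on the whole type, as the locale
  \<^locale>\<open>Metric_space\<close> demands.
\<close>

definition tv_dist :: "'x measure \<Rightarrow> 'x measure \<Rightarrow> real" where
  "tv_dist \<mu> \<nu> =
     (if finite_measure \<mu> \<and> finite_measure \<nu> \<and> sets \<mu> = sets \<nu>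
      then (SUP F\<in>sets \<mu>. measure \<mu> F - measure \<nu> F) + (SUP F\<in>sets \<mu>. measure \<nu> F - measure \<mu> F)
      else 0)"

definition fin_dens :: "'x measure \<Rightarrow> 'x measure set" where
  "fin_dens lam = {\<mu>. finite_measure \<mu> \<and> (\<exists>f\<in>borel_measurable lam. \<mu> = density lam f)}"

definition prob_dens :: "'x measure \<Rightarrow> 'x measure set" where
  "prob_dens lam = {\<mu>. prob_space \<mu> \<and> (\<exists>f\<in>borel_measurable lam. \<mu> = density lam f)}"

lemma Metric_space_fin_dens: "Metric_space (fin_dens lam) tv_dist"
proof -
  define D where "D \<mu> \<nu> = (SUP F\<in>sets \<mu>. measure \<mu> F - measure \<nu> F)" for \<mu> \<nu> :: "'a measure"
  define ok where "ok \<mu> \<nu> \<longleftrightarrow> finite_measure \<mu> \<and> finite_measure \<nu> \<and> sets \<mu> = sets \<nu>"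
    for \<mu> \<nu> :: "'a measure"
  have tv: "tv_dist \<mu> \<nu> = (if ok \<mu> \<nu> then D \<mu> \<nu> + D \<nu> \<mu> else 0)" for \<mu> \<nu>
    by (simp add: tv_dist_def D_def ok_def)
  have ok: "ok \<mu> \<nu>" if "\<mu> \<in> fin_dens lam" "\<nu> \<in> fin_dens lam" for \<mu> \<nu>
    using that by (auto simp: fin_dens_def ok_def)
  have ok_sym: "ok \<mu> \<nu> = ok \<nu> \<mu>" for \<mu> \<nu>
    by (auto simp: ok_def)
  have bdd: "bdd_above ((\<lambda>F. measure \<mu> F - measure \<nu> F) ` sets \<mu>)" if "ok \<mu> \<nu>" for \<mu> \<nu>
  proof (rule bdd_aboveI2)
    fix F
    have "measure \<mu> F \<le> measure \<mu> (space \<mu>)"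
      using that by (simp add: ok_def finite_measure.bounded_measure)
    then show "measure \<mu> F - measure \<nu> F \<le> measure \<mu> (space \<mu>)"
      by (smt (verit) measure_nonneg)
  qed
  have upper: "measure \<mu> F - measure \<nu> F \<le> D \<mu> \<nu>" if "ok \<mu> \<nu>" "F \<in> sets \<mu>" for \<mu> \<nu> F
    unfolding D_def by (rule cSUP_upper[OF that(2) bdd[OF that(1)]])
  have nonneg: "0 \<le> D \<mu> \<nu>" if "ok \<mu> \<nu>" for \<mu> \<nu>
    using upper[OF that, of "{}"] by simp
  have tri: "D \<mu> \<kappa> \<le> D \<mu> \<nu> + D \<nu> \<kappa>" if "ok \<mu> \<nu>" "ok \<nu> \<kappa>" for \<mu> \<nu> \<kappa>
    unfolding D_def[of \<mu> \<kappa>]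
  proof (rule cSUP_least)
    fix F assume "F \<in> sets \<mu>"
    then show "measure \<mu> F - measure \<kappa> F \<le> D \<mu> \<nu> + D \<nu> \<kappa>"
      using upper[OF that(1), of F] upper[OF that(2), of F] that by (auto simp: ok_def)
  qed auto
  show ?thesis
  proof
    fix \<mu> \<nu> assume *: "\<mu> \<in> fin_dens lam" "\<nu> \<in> fin_dens lam"
    note ok1 = ok[OF *] and ok2 = ok[OF *(2,1)]
    show "(tv_dist \<mu> \<nu> = 0) = (\<mu> = \<nu>)"
    proof
      assume "tv_dist \<mu> \<nu> = 0"
      then have z: "D \<mu> \<nu> = 0" "D \<nu> \<mu> = 0"
        using nonneg[OF ok1] nonneg[OF ok2] tv[of \<mu> \<nu>] ok1 by auto
      show "\<mu> = \<nu>"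
      proof (rule measure_eqI)
        show s: "sets \<mu> = sets \<nu>" using ok1 by (simp add: ok_def)
        fix F assume F: "F \<in> sets \<mu>"
        have "measure \<mu> F = measure \<nu> F"
          using upper[OF ok1 F] upper[OF ok2, of F] F s z by simp
        then show "emeasure \<mu> F = emeasure \<nu> F"
          using ok1 by (simp add: ok_def finite_measure.emeasure_eq_measure)
      qed
    next
      assume "\<mu> = \<nu>"
      moreover have "sets \<nu> \<noteq> {}" using sets.top by blast
      ultimately show "tv_dist \<mu> \<nu> = 0" by (simp add: tv_dist_def)
    qed
  next
    fix \<mu> \<nu> \<kappa> assume *: "\<mu> \<in> fin_dens lam" "\<nu> \<in> fin_dens lam" "\<kappa> \<in> fin_dens lam"
    show "tv_dist \<mu> \<kappa> \<le> tv_dist \<mu> \<nu> + tv_dist \<nu> \<kappa>"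
      using tri[OF ok ok, OF *(1,2,2,3)] tri[OF ok ok, OF *(3,2,2,1)] ok * by (simp add: tv)
  next
    fix \<mu> \<nu> :: "'a measure"
    show "0 \<le> tv_dist \<mu> \<nu>"
      using nonneg[of \<mu> \<nu>] nonneg[of \<nu> \<mu>] ok_sym[of \<mu> \<nu>] by (simp add: tv)
    show "tv_dist \<mu> \<nu> = tv_dist \<nu> \<mu>"
      using ok_sym[of \<mu> \<nu>] by (simp add: tv)
  qed
qed

lemma Metric_space_prob_dens: "Metric_space (prob_dens lam) tv_dist"
  by (rule Metric_space.subspace[OF Metric_space_fin_dens[of lam]])
    (auto simp: prob_dens_def fin_dens_def prob_space_def)

text \<open>
  The state space and the observation space are the types \<open>'s\<close> and \<open>'a\<close>. By convention, if one
  of them is countable, its metric is the discrete one and its reference measure counts points.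
\<close>

locale hmm =
  fixes lam :: "'s::polish_space measure"
    and \<tau> :: "'a::polish_space measure"
    and m :: "'s \<Rightarrow> 's \<Rightarrow> 'a \<Rightarrow> real"
  assumes sets_lam: "sets lam = sets borel"
    and sigma_finite_lam: "sigma_finite_measure lam"
    and sets_tau: "sets \<tau> = sets borel"
    and sigma_finite_tau: "sigma_finite_measure \<tau>"
    and measurable_m:
      "(\<lambda>(s, t, a). m s t a) \<in> borel_measurable (borel \<Otimes>\<^sub>M borel \<Otimes>\<^sub>M borel)"
    and m_nonneg: "0 \<le> m s t a"
    and m_total: "(\<integral>\<^sup>+t. \<integral>\<^sup>+a. ennreal (m s t a) \<partial>\<tau> \<partial>lam) = 1"
    and countable_states: "countable (UNIV :: 's set) \<Longrightarrow>
      lam = count_space UNIV \<and> (\<forall>x y :: 's. dist x y = (if x = y then 0 else 1))"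
    and countable_observations: "countable (UNIV :: 'a set) \<Longrightarrow>
      \<tau> = count_space UNIV \<and> (\<forall>x y :: 'a. dist x y = (if x = y then 0 else 1))"

definition trans_density :: "'a measure \<Rightarrow> ('s \<Rightarrow> 's \<Rightarrow> 'a \<Rightarrow> real) \<Rightarrow> 's \<Rightarrow> 's \<Rightarrow> ennreal" where
  "trans_density \<tau> m s t = (\<integral>\<^sup>+a. ennreal (m s t a) \<partial>\<tau>)"

definition trans_kernel ::
    "'s measure \<Rightarrow> 'a measure \<Rightarrow> ('s \<Rightarrow> 's \<Rightarrow> 'a \<Rightarrow> real) \<Rightarrow> 's \<Rightarrow> 's measure" where
  "trans_kernel lam \<tau> m s = density lam (trans_density \<tau> m s)"

definition obs_step ::
    "'s measure \<Rightarrow> ('s \<Rightarrow> 's \<Rightarrow> 'a \<Rightarrow> real) \<Rightarrow> 's measure \<Rightarrow> 'a \<Rightarrow> 's measure" where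
  "obs_step lam m x a =
     measure_of (space lam) (sets lam) (\<lambda>F. \<integral>\<^sup>+s. (\<integral>\<^sup>+t\<in>F. ennreal (m s t a) \<partial>lam) \<partial>x)"

definition total_mass :: "'x measure \<Rightarrow> ennreal" where
  "total_mass \<nu> = emeasure \<nu> (space \<nu>)"

definition regular_hmm :: "'s measure \<Rightarrow> ('s \<Rightarrow> 's \<Rightarrow> 'a::topological_space \<Rightarrow> real) \<Rightarrow> bool" where
  "regular_hmm lam m \<longleftrightarrow>
     continuous_map
       (prod_topology (Metric_space.mtopology (fin_dens lam) tv_dist) (euclidean :: 'a topology))
       (Metric_space.mtopology (fin_dens lam) tv_dist)
       (\<lambda>(x, a). obs_step lam m x a)"

abbreviation filter_space :: "'s measure \<Rightarrow> 's measure measure" where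
  "filter_space lam \<equiv> metric_borel (prob_dens lam) tv_dist"

definition filter_kernel ::
    "'s measure \<Rightarrow> 'a measure \<Rightarrow> ('s \<Rightarrow> 's \<Rightarrow> 'a \<Rightarrow> real) \<Rightarrow> 's measure \<Rightarrow> 's measure measure" where
  "filter_kernel lam \<tau> m x =
     measure_of (prob_dens lam) (sets (filter_space lam))
       (\<lambda>E. \<integral>\<^sup>+a\<in>{a \<in> space \<tau>. total_mass (obs_step lam m x a) > 0}.
              (indicator E (scale_measure (1 / total_mass (obs_step lam m x a)) (obs_step lam m x a))
               * total_mass (obs_step lam m x a)) \<partial>\<tau>)"

definition strongly_ergodic_hmm ::
    "'s measure \<Rightarrow> 'a measure \<Rightarrow> ('s \<Rightarrow> 's \<Rightarrow> 'a \<Rightarrow> real) \<Rightarrow> 's measure \<Rightarrow> bool" where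
  "strongly_ergodic_hmm lam \<tau> m \<pi> \<longleftrightarrow>
     \<pi> \<in> space (prob_algebra lam) \<and>
     (\<forall>s. (\<lambda>n. tv_dist (kernel_power lam (trans_kernel lam \<tau> m) n s) \<pi>) \<longlonglongrightarrow> 0)"

definition uniformly_ergodic_hmm ::
    "'s measure \<Rightarrow> 'a measure \<Rightarrow> ('s \<Rightarrow> 's \<Rightarrow> 'a \<Rightarrow> real) \<Rightarrow> 's measure \<Rightarrow> bool" where
  "uniformly_ergodic_hmm lam \<tau> m \<pi> \<longleftrightarrow>
     strongly_ergodic_hmm lam \<tau> m \<pi> \<and>
     (\<lambda>n. SUP s. tv_dist (kernel_power lam (trans_kernel lam \<tau> m) n s) \<pi>) \<longlonglongrightarrow> 0"

definition barycenter :: "'s measure \<Rightarrow> 's measure measure \<Rightarrow> 's measure" where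
  "barycenter lam \<mu> = measure_of (space lam) (sets lam) (\<lambda>F. \<integral>\<^sup>+x. emeasure x F \<partial>\<mu>)"

definition prob_with_barycenter :: "'s measure \<Rightarrow> 's measure \<Rightarrow> 's measure measure set" where
  "prob_with_barycenter lam \<pi> =
     {\<mu> \<in> space (prob_algebra (filter_space lam)). barycenter lam \<mu> = \<pi>}"

definition coupling :: "'x measure \<Rightarrow> 'x measure \<Rightarrow> ('x \<times> 'x) measure \<Rightarrow> bool" where
  "coupling \<mu> \<nu> \<kappa> \<longleftrightarrow>
     \<kappa> \<in> space (prob_algebra (\<mu> \<Otimes>\<^sub>M \<nu>)) \<and> distr \<kappa> \<mu> fst = \<mu> \<and> distr \<kappa> \<nu> snd = \<nu>"

text \<open>
  Couplings live on the product \<open>\<sigma>\<close>-algebra. It agrees with the Borel \<open>\<sigma>\<close>-algebra of the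
  product topology, because \<open>prob_dens lam\<close> is separable if \<open>lam\<close> is \<open>\<sigma>\<close>-finite on the Borel
  sets of a Polish space; in particular the set of pairs at distance less than \<open>\<rho>\<close> is measurable.
\<close>

definition condition_E ::
    "'s measure \<Rightarrow> 'a measure \<Rightarrow> ('s \<Rightarrow> 's \<Rightarrow> 'a \<Rightarrow> real) \<Rightarrow> 's measure \<Rightarrow> bool" where
  "condition_E lam \<tau> m \<pi> \<longleftrightarrow>
     (\<forall>\<rho>>0. \<exists>N\<ge>1. \<exists>\<alpha>>0.
        \<forall>\<mu>\<in>prob_with_barycenter lam \<pi>. \<forall>\<nu>\<in>prob_with_barycenter lam \<pi>.
          \<exists>\<kappa>. coupling
                (\<mu> \<bind> kernel_power (filter_space lam) (filter_kernel lam \<tau> m) N)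
                (\<nu> \<bind> kernel_power (filter_space lam) (filter_kernel lam \<tau> m) N) \<kappa> \<and>
              measure \<kappa> {(x, y) \<in> prob_dens lam \<times> prob_dens lam. tv_dist x y < \<rho>} \<ge> \<alpha>)"

end

theory Submission
  imports Defs
begin

text \<open>
  Write \<open>K\<close> for the set of probability measures with a density and \<open>P\<close> for the filter kernel on \<open>K\<close>.
  Three facts carry the proof.

  \<^item> The powers of \<open>P\<close> are equi-Lipschitz (\<open>kernel_power_lipschitz\<close>). A 1-Lipschitz function on \<open>K\<close>,
    shifted to be bounded by 2, extends to a positively homogeneous 4-Lipschitz function \<open>U\<close> on the cone
    of finite measures. Homogeneity absorbs the normalisation in the filter, so that
    \<open>\<integral>U(z) P(x, dz) = \<integral>U(x M\<^sub>a) \<tau>(da)\<close>, and the linear maps \<open>x \<mapsto> x M\<^sub>a\<close> contract the total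
    variation distance when it is summed over \<open>a\<close>. Hence the constant 4 survives any number of steps.

  \<^item> Barycentres follow the hidden chain: the barycentre of \<open>\<mu> P\<^sup>n\<close> is the barycentre of \<open>\<mu>\<close> moved
    \<open>n\<close> steps (\<open>bary_bind_kernel_power\<close>), so strong ergodicity drives it to \<open>\<pi>\<close>. Moreover a measure on
    \<open>K\<close> with barycentre \<open>q\<close> can be transported to one with barycentre \<open>\<pi>\<close> at mean cost at most the
    distance of \<open>q\<close> and \<open>\<pi>\<close> (\<open>recentre\<close>).

  \<^item> Condition E makes the oscillation of \<open>P\<^sup>l u\<close> over measures with barycentre \<open>\<pi>\<close> shrink
    (\<open>oscillation_le_step\<close>). Couple \<open>\<mu> P\<^sup>N\<close> and \<open>\<nu> P\<^sup>N\<close>. Where the two points are closer than \<open>\<rho>\<close>,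
    equi-Lipschitz continuity bounds the difference by \<open>4\<rho>\<close>. Elsewhere one conditions; the two
    conditional marginals need not have barycentre \<open>\<pi>\<close>, but their barycentres are dominated by a
    multiple of \<open>\<pi>\<close>, so that \<open>k + 1\<close> further steps bring them close to \<open>\<pi>\<close> and they can be recentred at
    a small cost. A bound \<open>c\<close> on the oscillation thus becomes \<open>4\<rho> + (1 - \<alpha>)(c - 4\<rho>)\<close> up to a small
    error. Since \<open>\<alpha>\<close> depends on \<open>\<rho>\<close>, it matters that the factor acts on the excess over \<open>4\<rho>\<close> alone:
    the limit of the oscillation is then at most \<open>4\<rho>\<close>, for every \<open>\<rho>\<close>.

  Weak contraction follows by recentring \<open>P\<^sup>k(x, \<cdot>)\<close> and \<open>P\<^sup>k(y, \<cdot>)\<close>. For weak ergodicity, start the filter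
  at \<open>\<pi>\<close>. All measures \<open>P\<^sup>n(\<pi>, \<cdot>)\<close> have barycentre \<open>\<pi>\<close>, so the third fact, applied to \<open>P\<^sup>j(\<pi>, \<cdot>)\<close> and the
  point mass at \<open>\<pi>\<close>, shows that they form a Cauchy sequence, uniformly over 1-Lipschitz test functions.
  They live on a common separable subset of the complete space \<open>K\<close>, and such a sequence has a limit
  measure (\<open>limit_exists\<close>). By weak contraction the limit does not depend on the starting point, and
  convergence for Lipschitz test functions implies convergence for bounded continuous ones
  (\<open>weak_convergence_from_Lip1\<close>).
\<close>

section \<open>Borel sets of a metric space given by a carrier set\<close>

lemma space_metric_borel [simp]: "space (metric_borel X d) = X"
  by (simp add: metric_borel_def space_measure_of_conv)

definition lipschitz :: "'x set \<Rightarrow> ('x \<Rightarrow> 'x \<Rightarrow> real) \<Rightarrow> real \<Rightarrow> ('x \<Rightarrow> real) \<Rightarrow> bool" where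
  "lipschitz X d c u \<longleftrightarrow> (\<forall>x\<in>X. \<forall>y\<in>X. \<bar>u x - u y\<bar> \<le> c * d x y)"

context Metric_space
begin

abbreviation "\<B> \<equiv> metric_borel M d"

lemma sets_metric_borel: "sets \<B> = sigma_sets M {U. openin mtopology U}"
  unfolding metric_borel_def by (rule sets_measure_of) (use openin_subset in fastforce)

lemma openin_in_sets: "openin mtopology U \<Longrightarrow> U \<in> sets \<B>"
  by (simp add: sets_metric_borel sigma_sets.Basic)

lemma continuous_map_borel_measurable:
  assumes "continuous_map mtopology euclideanreal f"
  shows "f \<in> borel_measurable \<B>"
proof (rule borel_measurableI)
  fix S :: "real set" assume "open S"
  then have "openin mtopology {x \<in> topspace mtopology. f x \<in> S}"
    using assms by (simp add: continuous_map_def)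
  moreover have "{x \<in> topspace mtopology. f x \<in> S} = f -` S \<inter> space \<B>" by auto
  ultimately show "f -` S \<inter> space \<B> \<in> sets \<B>" by (metis openin_in_sets)
qed

lemma lipschitz_continuous_map:
  assumes "lipschitz M d c u"
  shows "continuous_map mtopology euclideanreal u"
proof -
  have "\<exists>\<delta>>0. \<forall>y. y \<in> M \<and> d x y < \<delta> \<longrightarrow> \<bar>u x - u y\<bar> < \<epsilon>" if "x \<in> M" "0 < \<epsilon>" for x \<epsilon>
  proof (intro exI conjI allI impI)
    let ?c = "max c 1"
    show "0 < \<epsilon> / ?c" using that by simp
    fix y assume y: "y \<in> M \<and> d x y < \<epsilon> / ?c"
    have "\<bar>u x - u y\<bar> \<le> c * d x y" using assms y that by (simp add: lipschitz_def)
    also have "\<dots> \<le> ?c * d x y" by (intro mult_right_mono) auto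
    also have "\<dots> < \<epsilon>" using y by (simp add: field_simps)
    finally show "\<bar>u x - u y\<bar> < \<epsilon>" .
  qed
  then have "continuous_map mtopology Met_TC.mtopology u"
    by (subst metric_continuous_map[OF Met_TC.Metric_space_axioms]) (simp add: dist_real_def)
  then show ?thesis by simp
qed

lemma lipschitz_borel_measurable: "lipschitz M d c u \<Longrightarrow> u \<in> borel_measurable \<B>"
  by (rule continuous_map_borel_measurable[OF lipschitz_continuous_map])

text \<open>
  The gap to the complement of an open set, capped at 1, is a 1-Lipschitz function that is positive
  exactly on the set. It reduces statements on open sets to statements on Lipschitz functions with values in
  the unit interval. The cap also gives a meaning to the gap when the complement is empty.
\<close>

definition gap :: "'a set \<Rightarrow> 'a \<Rightarrow> real" where
  "gap E x = (if M \<subseteq> E then 1 else min 1 (INF c\<in>M - E. d x c))"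

lemma bdd_below_dist: "bdd_below ((\<lambda>c. d x c) ` A)"
  by (rule bdd_belowI2[where m=0]) simp

lemma gap_bounds: "0 \<le> gap E x" "gap E x \<le> 1"
  by (auto simp: gap_def intro!: cINF_greatest)

lemma lipschitz_gap: "lipschitz M d 1 (gap E)"
proof (cases "M \<subseteq> E")
  case False
  have *: "(INF c\<in>M - E. d x c) \<le> d x y + (INF c\<in>M - E. d y c)" if "x \<in> M" "y \<in> M" for x y
  proof -
    have "(INF c\<in>M - E. d x c) - d x y \<le> (INF c\<in>M - E. d y c)"
    proof (rule cINF_greatest)
      show "M - E \<noteq> {}" using False by auto
      fix c assume c: "c \<in> M - E"
      have "(INF c\<in>M - E. d x c) \<le> d x c" by (rule cINF_lower[OF bdd_below_dist c])
      also have "\<dots> \<le> d x y + d y c" using c that triangle by auto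
      finally show "(INF c\<in>M - E. d x c) - d x y \<le> d y c" by simp
    qed
    then show ?thesis by simp
  qed
  show ?thesis unfolding lipschitz_def
  proof (intro ballI)
    fix x y assume xy: "x \<in> M" "y \<in> M"
    show "\<bar>gap E x - gap E y\<bar> \<le> 1 * d x y"
      using *[OF xy] *[OF xy(2,1)] False nonneg[of x y] by (auto simp: gap_def commute[of y x] min_def)
  qed
qed (auto simp: lipschitz_def gap_def)

lemma gap_pos_iff:
  assumes "openin mtopology E" "x \<in> M"
  shows "0 < gap E x \<longleftrightarrow> x \<in> E"
proof (cases "M \<subseteq> E")
  case False
  show ?thesis
  proof
    assume *: "0 < gap E x"
    show "x \<in> E"
    proof (rule ccontr)
      assume "x \<notin> E"
      then have "(INF c\<in>M - E. d x c) \<le> d x x" using assms by (intro cINF_lower bdd_below_dist) auto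
      with * False assms show False by (simp add: gap_def)
    qed
  next
    assume "x \<in> E"
    then obtain r where r: "r > 0" "mball x r \<subseteq> E" using assms by (auto simp: openin_mtopology)
    then have "r \<le> (INF c\<in>M - E. d x c)"
      using False assms by (intro cINF_greatest) (force simp: not_less[symmetric])+
    with r False show "0 < gap E x" by (auto simp: gap_def)
  qed
qed (use assms in \<open>auto simp: gap_def\<close>)

text \<open>
  An open set \<open>U\<close> is the set where its gap is positive. So a map into the space is measurable as
  soon as its compositions with Lipschitz functions are.
\<close>

lemma measurable_metric_borelI:
  assumes f: "f \<in> space N \<rightarrow> M"
    and u: "\<And>u. lipschitz M d 1 u \<Longrightarrow> (\<And>x. x \<in> M \<Longrightarrow> 0 \<le> u x \<and> u x \<le> 1) \<Longrightarrow>
      (\<lambda>x. u (f x)) \<in> borel_measurable N"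
  shows "f \<in> N \<rightarrow>\<^sub>M \<B>"
  unfolding metric_borel_def
proof (rule measurable_measure_of)
  fix U assume "U \<in> {U. openin mtopology U}"
  then have U: "openin mtopology U" by simp
  have "f -` U \<inter> space N = {x \<in> space N. 0 < gap U (f x)}"
    using gap_pos_iff[OF U] f by auto
  moreover have "(\<lambda>x. gap U (f x)) \<in> borel_measurable N"
    by (intro u lipschitz_gap) (simp add: gap_bounds)
  ultimately show "f -` U \<inter> space N \<in> sets N" by simp
qed (use f openin_subset in fastforce)+

text \<open>
  The Borel sets of a product of metric spaces can be more than the product of the Borel
  \<open>\<sigma>\<close>-algebras. One second countable factor excludes this: an open set is the union, over a countable base of
  that factor, of the largest open rectangles with the given second side.
\<close>

lemma continuous_map_borel_measurable_pair:
  fixes f :: "'a \<times> 'b::second_countable_topology \<Rightarrow> real"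
  assumes "continuous_map (prod_topology mtopology euclidean) euclideanreal f"
  shows "f \<in> borel_measurable (\<B> \<Otimes>\<^sub>M borel)"
proof (rule borel_measurableI)
  fix S :: "real set" assume "open S"
  define G where "G = {z \<in> M \<times> UNIV. f z \<in> S}"
  have G: "openin (prod_topology mtopology euclidean) G"
    using assms \<open>open S\<close> by (simp add: continuous_map_def G_def)
  obtain B :: "'b set set" where B: "countable B" "topological_basis B"
    using ex_countable_basis by blast
  define W where "W V = \<Union>{U. openin mtopology U \<and> U \<times> V \<subseteq> G}" for V
  have "G = (\<Union>V\<in>B. W V \<times> V)"
  proof
    show "G \<subseteq> (\<Union>V\<in>B. W V \<times> V)"
    proof
      fix z assume z: "z \<in> G"
      obtain x y where xy: "z = (x, y)" by (cases z)
      then obtain U V where UV: "openin mtopology U" "open V" "x \<in> U" "y \<in> V" "U \<times> V \<subseteq> G"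
        using z G unfolding openin_prod_topology_alt by (metis open_openin)
      then obtain V' where "V' \<in> B" "y \<in> V'" "V' \<subseteq> V"
        using B(2) topological_basisE by blast
      moreover have "U \<times> V' \<subseteq> G" using UV(5) \<open>V' \<subseteq> V\<close> by blast
      ultimately show "z \<in> (\<Union>V\<in>B. W V \<times> V)" using UV xy by (auto simp: W_def)
    qed
  qed (auto simp: W_def)
  moreover have "W V \<in> sets \<B>" for V
    unfolding W_def by (rule openin_in_sets) auto
  moreover have "V \<in> sets borel" if "V \<in> B" for V
    using topological_basis_open[OF B(2) that] by simp
  ultimately have "G \<in> sets (\<B> \<Otimes>\<^sub>M borel)" using B(1) by auto
  moreover have "G = f -` S \<inter> space (\<B> \<Otimes>\<^sub>M borel)" by (auto simp: G_def space_pair_measure)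
  ultimately show "f -` S \<inter> space (\<B> \<Otimes>\<^sub>M borel) \<in> sets (\<B> \<Otimes>\<^sub>M borel)" by simp
qed

end

section \<open>Powers of a Markov kernel\<close>

locale markov_kernel =
  fixes X :: "'x measure" and Q :: "'x \<Rightarrow> 'x measure"
  assumes kernel [measurable]: "Q \<in> X \<rightarrow>\<^sub>M prob_algebra X"
begin

abbreviation "Qn \<equiv> kernel_power X Q"

lemma kernel_subprob [measurable]: "Q \<in> X \<rightarrow>\<^sub>M subprob_algebra X"
  by (rule measurable_prob_algebraD[OF kernel])

lemma kernel_power_Suc: "x \<in> space X \<Longrightarrow> Qn (Suc n) x = Q x \<bind> Qn n"
proof (cases n)
  case 0
  assume "x \<in> space X"
  then have "sets (Q x) = sets X" using sets_kernel[OF kernel_subprob] by simp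
  then show ?thesis using 0 by (simp add: bind_return'' kernel_power.simps(1)[abs_def])
qed simp

lemma measurable_kernel_power [measurable]: "Qn n \<in> X \<rightarrow>\<^sub>M prob_algebra X"
proof (induction n)
  case 0
  show ?case
    by (subst measurable_cong[of _ _ "return X"]) (auto simp: measurable_return_prob_space)
next
  case (Suc n)
  then have [measurable]: "Qn n \<in> X \<rightarrow>\<^sub>M prob_algebra X" .
  show ?case
    by (subst measurable_cong[OF kernel_power_Suc]) (auto intro!: measurable_bind_prob_space[OF kernel])
qed

lemma measurable_kernel_power_subprob [measurable]: "Qn n \<in> X \<rightarrow>\<^sub>M subprob_algebra X"
  by (rule measurable_prob_algebraD[OF measurable_kernel_power])

lemma kernel_power_in_space: "x \<in> space X \<Longrightarrow> Qn n x \<in> space (prob_algebra X)"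
  using measurable_space[OF measurable_kernel_power] .

lemma bind_kernel_power_in_space:
  "\<mu> \<in> space (prob_algebra X) \<Longrightarrow> \<mu> \<bind> Qn n \<in> space (prob_algebra X)"
  by (rule measurable_space[of "\<lambda>\<mu>. \<mu> \<bind> Qn n" "prob_algebra X"]) (auto intro!: measurable_bind_prob_space)

lemma kernel_power_add:
  assumes "x \<in> space X"
  shows "Qn (n + k) x = Qn n x \<bind> Qn k"
  using assms
proof (induction n arbitrary: x)
  case 0
  have "Qn 0 x = return X x" by simp
  then show ?case
    using bind_return[OF measurable_kernel_power_subprob 0, of k] by simp
next
  case (Suc n)
  have s: "sets (Q x) = sets X" using Suc.prems sets_kernel[OF kernel_subprob] by simp
  then have sQ: "space (Q x) = space X" using sets_eq_imp_space_eq by auto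
  have "Qn (Suc n + k) x = Q x \<bind> (\<lambda>y. Qn n y \<bind> Qn k)"
    unfolding add_Suc kernel_power_Suc[OF Suc.prems] by (rule bind_cong) (auto simp: Suc.IH sQ)
  also have "\<dots> = (Q x \<bind> Qn n) \<bind> Qn k"
    by (subst bind_assoc[where N=X and R=X]) (simp_all add: measurable_cong_sets[OF s])
  finally show ?case using Suc.prems by (simp add: kernel_power_Suc)
qed

lemma bind_kernel_power_add:
  assumes "\<mu> \<in> space (prob_algebra X)"
  shows "\<mu> \<bind> Qn (n + k) = (\<mu> \<bind> Qn n) \<bind> Qn k"
proof -
  have s: "sets \<mu> = sets X" using assms by (simp add: space_prob_algebra)
  have "\<mu> \<bind> Qn (n + k) = \<mu> \<bind> (\<lambda>x. Qn n x \<bind> Qn k)"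
    by (rule bind_cong) (auto simp: kernel_power_add sets_eq_imp_space_eq[OF s])
  also have "\<dots> = (\<mu> \<bind> Qn n) \<bind> Qn k"
    by (subst bind_assoc[where N=X and R=X]) (simp_all add: measurable_cong_sets[OF s])
  finally show ?thesis .
qed

lemma integral_bind_kernel_power:
  fixes u :: "'x \<Rightarrow> real"
  assumes "\<mu> \<in> space (prob_algebra X)" and u: "u \<in> borel_measurable X"
    and B: "\<And>x. x \<in> space X \<Longrightarrow> \<bar>u x\<bar> \<le> B"
  shows "(\<integral>z. u z \<partial>(\<mu> \<bind> Qn n)) = (\<integral>x. (\<integral>z. u z \<partial>Qn n x) \<partial>\<mu>)"
proof -
  have s: "sets \<mu> = sets X" and "prob_space \<mu>" using assms by (auto simp: space_prob_algebra)
  then interpret prob_space \<mu> by simp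
  have [measurable_cong]: "sets \<mu> = sets X" by fact
  have "AE x in \<mu>. emeasure (Qn n x) (space (Qn n x)) \<le> ennreal 1"
    using kernel_power_in_space[of _ n] sets_eq_imp_space_eq[OF s]
    by (auto simp: space_prob_algebra prob_space.emeasure_space_1)
  then show ?thesis
    by (intro integral_bind[OF u, of B _ _ 1]) (use B sets_eq_imp_space_eq[OF s] finite_measure_axioms in \<open>auto\<close>)
qed

end

section \<open>Lipschitz test functions and weak convergence\<close>

lemma Lip1_iff: "u \<in> Lip1 X d \<longleftrightarrow> bounded (u ` X) \<and> lipschitz X d 1 u"
  by (simp add: Lip1_def lipschitz_def)

lemma bounded_imageE:
  fixes u :: "'x \<Rightarrow> real"
  assumes "bounded (u ` X)"
  obtains B where "B > 0" "\<And>x. x \<in> X \<Longrightarrow> \<bar>u x\<bar> \<le> B"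
  using assms unfolding bounded_pos by auto

lemma bcontD:
  assumes "u \<in> bcont X d"
  shows "bounded (u ` X)" "continuous_map (Metric_space.mtopology X d) euclideanreal u"
  using assms by (auto simp: bcont_def)

lemma prob_integrable_bounded:
  fixes u :: "'x \<Rightarrow> real"
  assumes "\<mu> \<in> space (prob_algebra X)" "u \<in> borel_measurable X" "\<And>x. x \<in> space X \<Longrightarrow> \<bar>u x\<bar> \<le> B"
  shows "integrable \<mu> u"
proof -
  have s: "sets \<mu> = sets X" and "prob_space \<mu>" using assms by (auto simp: space_prob_algebra)
  then interpret prob_space \<mu> by simp
  show ?thesis
    using assms sets_eq_imp_space_eq[OF s] by (intro integrable_const_bound[where B=B]) (auto simp: measurable_cong_sets[OF s])
qed

lemma prob_algebraD:
  assumes "\<mu> \<in> space (prob_algebra X)"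
  shows "prob_space \<mu>" "sets \<mu> = sets X" "space \<mu> = space X"
  using assms sets_eq_imp_space_eq[of \<mu> X] by (auto simp: space_prob_algebra)

context Metric_space
begin

text \<open>
  The functions \<open>v\<^sub>k x = inf\<^sub>y (u y + k d(x, y))\<close> are Lipschitz, lie below \<open>u\<close> and increase to \<open>u\<close> at
  every point of continuity. Dominated convergence makes their integrals converge.
\<close>

lemma lipschitz_approx_below:
  assumes u: "u \<in> bcont M d" and \<nu>: "\<nu> \<in> space (prob_algebra \<B>)" and "0 < \<epsilon>"
  obtains v c where "0 < c" "lipschitz M d c v" "bounded (v ` M)" "\<And>x. x \<in> M \<Longrightarrow> v x \<le> u x"
    "(\<integral>x. u x \<partial>\<nu>) - \<epsilon> < (\<integral>x. v x \<partial>\<nu>)"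
proof -
  note \<nu>D = prob_algebraD[OF \<nu>]
  interpret \<nu>: prob_space \<nu> by fact
  have ne: "M \<noteq> {}" using \<nu>.not_empty \<nu>D by simp
  obtain B where B: "B > 0" "\<And>x. x \<in> M \<Longrightarrow> \<bar>u x\<bar> \<le> B"
    using bounded_imageE[OF bcontD(1)[OF u]] by blast
  define v where "v k x = (INF y\<in>M. u y + real k * d x y)" for k :: nat and x
  have bdd: "bdd_below ((\<lambda>y. u y + real k * d x y) ` M)" for k x
    using B by (intro bdd_belowI2[where m="-B"]) (smt (verit) mult_nonneg_nonneg nonneg of_nat_0_le_iff)
  have v_le: "v k x \<le> u x" if "x \<in> M" for k x
    using cINF_lower[OF bdd that, of k x] that by (simp add: v_def)
  have v_ge: "-B \<le> v k x" for k x
    unfolding v_def using B ne by (intro cINF_greatest) (smt (verit) mult_nonneg_nonneg nonneg of_nat_0_le_iff)+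
  have v_abs: "\<bar>v k x\<bar> \<le> B" if "x \<in> M" for k x
    using v_le[OF that, of k] v_ge[of k x] B(2)[OF that] by linarith
  have v_diff: "v k x \<le> v k y + real k * d x y" if xy: "x \<in> M" "y \<in> M" for k x y
  proof -
    have "v k x - real k * d x y \<le> v k y"
      unfolding v_def[of k y]
    proof (rule cINF_greatest[OF ne])
      fix z assume z: "z \<in> M"
      have "v k x \<le> u z + real k * d x z"
        unfolding v_def by (rule cINF_lower[OF bdd z])
      also have "real k * d x z \<le> real k * (d x y + d y z)"
        by (intro mult_left_mono triangle xy z) simp
      finally show "v k x - real k * d x y \<le> u z + real k * d y z"
        by (simp add: algebra_simps)
    qed
    then show ?thesis by simp
  qed
  have lip: "lipschitz M d (real k + 1) (v k)" for k
    unfolding lipschitz_def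
  proof (intro ballI)
    fix x y assume xy: "x \<in> M" "y \<in> M"
    have "\<bar>v k x - v k y\<bar> \<le> real k * d x y"
      using v_diff[OF xy, of k] v_diff[OF xy(2,1), of k] by (simp add: commute[of y x] abs_le_iff)
    also have "\<dots> \<le> (real k + 1) * d x y" by (intro mult_right_mono) auto
    finally show "\<bar>v k x - v k y\<bar> \<le> (real k + 1) * d x y" .
  qed
  have lim: "(\<lambda>k. v k x) \<longlonglongrightarrow> u x" if x: "x \<in> M" for x
  proof (rule LIMSEQ_I)
    fix r :: real assume "0 < r"
    have "continuous_map mtopology Met_TC.mtopology u" using u by (simp add: bcont_def)
    then obtain \<delta> where \<delta>: "\<delta> > 0" "\<And>y. y \<in> M \<Longrightarrow> d x y < \<delta> \<Longrightarrow> \<bar>u x - u y\<bar> < r / 2"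
      unfolding metric_continuous_map[OF Met_TC.Metric_space_axioms] dist_real_def
      using x \<open>0 < r\<close> by (metis half_gt_zero)
    obtain N :: nat where N: "2 * B / \<delta> < real N" using reals_Archimedean2 by blast
    have "norm (v k x - u x) < r" if k: "N \<le> k" for k
    proof -
      have "u x - r / 2 \<le> v k x"
        unfolding v_def
      proof (rule cINF_greatest[OF ne])
        fix y assume y: "y \<in> M"
        show "u x - r / 2 \<le> u y + real k * d x y"
        proof (cases "d x y < \<delta>")
          case True
          have "0 \<le> real k * d x y" by simp
          then show ?thesis using \<delta>(2)[OF y True] by linarith
        next
          case False
          have "2 * B \<le> real N * \<delta>" using N \<delta>(1) by (simp add: field_simps)
          also have "\<dots> \<le> real k * d x y" using False k \<delta>(1) by (intro mult_mono) auto
          finally show ?thesis using B(2)[OF x] B(2)[OF y] \<open>0 < r\<close> by linarith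
        qed
      qed
      then show ?thesis using v_le[OF x, of k] \<open>0 < r\<close> by simp
    qed
    then show "\<exists>no. \<forall>n\<ge>no. norm (v n x - u x) < r" by blast
  qed
  have meas: "v k \<in> borel_measurable \<nu>" for k
    using lipschitz_borel_measurable[OF lip] measurable_cong_sets[OF \<nu>D(2) refl] by blast
  have "(\<lambda>k. \<integral>x. v k x \<partial>\<nu>) \<longlonglongrightarrow> (\<integral>x. u x \<partial>\<nu>)"
  proof (rule integral_dominated_convergence[where w="\<lambda>_. B"])
    show "u \<in> borel_measurable \<nu>"
      using continuous_map_borel_measurable u measurable_cong_sets[OF \<nu>D(2) refl] by (auto simp: bcont_def)
  qed (use meas lim v_abs \<nu>D in auto)
  then have "\<forall>\<^sub>F k in sequentially. (\<integral>x. u x \<partial>\<nu>) - \<epsilon> < (\<integral>x. v k x \<partial>\<nu>)"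
    by (rule order_tendstoD(1)) (use \<open>0 < \<epsilon>\<close> in simp)
  then obtain k where "(\<integral>x. u x \<partial>\<nu>) - \<epsilon> < (\<integral>x. v k x \<partial>\<nu>)"
    using eventually_happens'[OF sequentially_bot] by blast
  moreover have "bounded (v k ` M)" using v_abs by (auto simp: bounded_iff)
  ultimately show ?thesis using that[of "real k + 1" "v k"] lip v_le by auto
qed

lemma integral_lipschitz_tendsto:
  assumes conv: "\<And>u. u \<in> Lip1 M d \<Longrightarrow> (\<lambda>n. \<integral>x. u x \<partial>\<mu> n) \<longlonglongrightarrow> (\<integral>x. u x \<partial>\<nu>)"
    and "0 < c" "lipschitz M d c v" "bounded (v ` M)"
  shows "(\<lambda>n. \<integral>x. v x \<partial>\<mu> n) \<longlonglongrightarrow> (\<integral>x. v x \<partial>\<nu>)"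
proof -
  have "bounded ((\<lambda>x. v x / c) ` M)"
    using bounded_scaling[OF assms(4), of "1/c"] by (simp add: image_image)
  moreover have "\<bar>v x / c - v y / c\<bar> \<le> 1 * d x y" if "x \<in> M" "y \<in> M" for x y
    using assms that by (simp add: lipschitz_def field_simps flip: diff_divide_distrib)
  ultimately have "(\<lambda>x. v x / c) \<in> Lip1 M d" by (simp add: Lip1_def)
  from tendsto_mult_left[OF conv[OF this], of c] show ?thesis using \<open>0 < c\<close> by simp
qed

text \<open>
  Approximation from below by Lipschitz functions gives the lower bound on the limit of the
  integrals of \<open>u\<close>, and the same bound for \<open>- u\<close> is the upper one.
\<close>

lemma weak_convergence_from_Lip1:
  assumes \<mu>: "\<And>n. \<mu> n \<in> space (prob_algebra \<B>)" and \<nu>: "\<nu> \<in> space (prob_algebra \<B>)"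
    and conv: "\<And>u. u \<in> Lip1 M d \<Longrightarrow> (\<lambda>n. \<integral>x. u x \<partial>\<mu> n) \<longlonglongrightarrow> (\<integral>x. u x \<partial>\<nu>)"
    and u: "u \<in> bcont M d"
  shows "(\<lambda>n. \<integral>x. u x \<partial>\<mu> n) \<longlonglongrightarrow> (\<integral>x. u x \<partial>\<nu>)"
proof -
  have int: "integrable (\<mu> n) u" if "u \<in> bcont M d" for u n
  proof -
    obtain B where "\<And>x. x \<in> M \<Longrightarrow> \<bar>u x\<bar> \<le> B" using bounded_imageE[OF bcontD(1)[OF \<open>u \<in> bcont M d\<close>]] by blast
    then show ?thesis using prob_integrable_bounded[OF \<mu>, of u B] \<open>u \<in> bcont M d\<close> continuous_map_borel_measurable
      by (auto simp: bcont_def)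
  qed
  have lower: "\<forall>\<^sub>F n in sequentially. (\<integral>x. u x \<partial>\<nu>) - \<epsilon> < (\<integral>x. u x \<partial>\<mu> n)"
    if u: "u \<in> bcont M d" and "0 < \<epsilon>" for u \<epsilon>
  proof -
    obtain v c where v: "0 < c" "lipschitz M d c v" "bounded (v ` M)" "\<And>x. x \<in> M \<Longrightarrow> v x \<le> u x"
      "(\<integral>x. u x \<partial>\<nu>) - \<epsilon> < (\<integral>x. v x \<partial>\<nu>)"
      using lipschitz_approx_below[OF u \<nu> \<open>0 < \<epsilon>\<close>] by blast
    have "v \<in> bcont M d" using v lipschitz_continuous_map by (auto simp: bcont_def)
    have "(\<integral>x. v x \<partial>\<mu> n) \<le> (\<integral>x. u x \<partial>\<mu> n)" for n
      using v(4) prob_algebraD(3)[OF \<mu>] by (intro integral_mono int u \<open>v \<in> bcont M d\<close>) auto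
    moreover have "\<forall>\<^sub>F n in sequentially. (\<integral>x. u x \<partial>\<nu>) - \<epsilon> < (\<integral>x. v x \<partial>\<mu> n)"
      by (rule order_tendstoD(1)[OF integral_lipschitz_tendsto[OF conv v(1,2,3)] v(5)])
    ultimately show ?thesis by (auto elim!: eventually_mono intro: less_le_trans)
  qed
  have "(\<lambda>x. - u x) \<in> bcont M d"
    using u by (auto simp: bcont_def bounded_iff intro: continuous_map_minus)
  note low = lower[OF u] and up = lower[OF this, simplified]
  show ?thesis
  proof (rule order_tendstoI)
    fix a assume "a < (\<integral>x. u x \<partial>\<nu>)"
    with low[of "(\<integral>x. u x \<partial>\<nu>) - a"] show "\<forall>\<^sub>F n in sequentially. a < (\<integral>x. u x \<partial>\<mu> n)" by simp
  next
    fix a assume "(\<integral>x. u x \<partial>\<nu>) < a"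
    with up[of "a - (\<integral>x. u x \<partial>\<nu>)"] show "\<forall>\<^sub>F n in sequentially. (\<integral>x. u x \<partial>\<mu> n) < a" by simp
  qed
qed

end

section \<open>Limits of Cauchy sequences of probability measures\<close>

text \<open>
  Probability measures that are Cauchy, uniformly over the 1-Lipschitz functions, and live on a
  common separable part of a complete metric space have a limit measure. Their integrals converge to a
  positive functional \<open>Lam\<close> on bounded Lipschitz functions, and the task is to represent it by a measure.

  A random point is located by digits. At scale \<open>2\<^sup>-\<^sup>j\<close> a Lipschitz partition of unity \<open>part j i\<close>, indexed by
  the points \<open>q i\<close>, assigns digit \<open>i\<close> to points near \<open>q i\<close>. Applying \<open>Lam\<close> to the products of these
  functions yields consistent probabilities for the digits \<open>w 0, \<dots>, w (n - 1)\<close>, hence by the theorem of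
  Ionescu-Tulcea a law on digit sequences. Almost surely the points \<open>q (w j)\<close> form a Cauchy sequence; the law of
  their limit is the measure wanted.
\<close>

locale lip_cauchy = Metric_space +
  fixes \<mu> :: "nat \<Rightarrow> 'a measure" and q :: "nat \<Rightarrow> 'a"
  assumes \<mu>: "\<And>n. \<mu> n \<in> space (prob_algebra \<B>)"
    and q: "\<And>i. q i \<in> M"
    and dense: "\<And>n. AE x in \<mu> n. \<forall>e>0. \<exists>i. d x (q i) < e"
    and cauchy: "\<And>\<epsilon>. 0 < \<epsilon> \<Longrightarrow>
      \<exists>L. \<forall>n\<ge>L. \<forall>m\<ge>L. \<forall>u\<in>Lip1 M d. \<bar>(\<integral>x. u x \<partial>\<mu> n) - (\<integral>x. u x \<partial>\<mu> m)\<bar> \<le> \<epsilon>"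
    and complete: mcomplete
begin

text \<open>
  The bounded Lipschitz functions, with any constant, form an algebra; products of members of the
  partitions of unity therefore stay in the domain of \<open>Lam\<close>.
\<close>

definition BL :: "('a \<Rightarrow> real) \<Rightarrow> bool" where
  "BL u \<longleftrightarrow> (\<exists>B. \<forall>x\<in>M. \<bar>u x\<bar> \<le> B) \<and> (\<exists>c. lipschitz M d c u)"

lemma BL_E:
  assumes "BL u"
  obtains B c where "\<And>x. x \<in> M \<Longrightarrow> \<bar>u x\<bar> \<le> B" "lipschitz M d c u"
  using assms unfolding BL_def by blast

lemma Lip1_BL: "u \<in> Lip1 M d \<Longrightarrow> BL u"
  unfolding BL_def Lip1_iff by (metis bounded_imageE)

lemma BL_const [intro]: "BL (\<lambda>_. a)"
  unfolding BL_def lipschitz_def by (intro conjI exI[of _ "\<bar>a\<bar>"] exI[of _ 0]) auto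

lemma BL_add [intro]:
  assumes "BL u" "BL v" shows "BL (\<lambda>x. u x + v x)"
proof -
  obtain B B' c c' where *: "\<And>x. x \<in> M \<Longrightarrow> \<bar>u x\<bar> \<le> B" "\<And>x. x \<in> M \<Longrightarrow> \<bar>v x\<bar> \<le> B'"
    "lipschitz M d c u" "lipschitz M d c' v" using assms by (metis BL_E)
  have "\<bar>u x + v x\<bar> \<le> B + B'" if "x \<in> M" for x
    using *(1,2)[OF that] by linarith
  moreover have "\<bar>(u x + v x) - (u y + v y)\<bar> \<le> (c + c') * d x y" if "x \<in> M" "y \<in> M" for x y
  proof -
    have "\<bar>u x - u y\<bar> \<le> c * d x y" "\<bar>v x - v y\<bar> \<le> c' * d x y" using * that by (auto simp: lipschitz_def)
    then show ?thesis by (simp add: distrib_right)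
  qed
  ultimately show ?thesis unfolding BL_def lipschitz_def by blast
qed

lemma BL_mult [intro]:
  assumes "BL u" "BL v" shows "BL (\<lambda>x. u x * v x)"
proof -
  obtain B B' c c' where *: "\<And>x. x \<in> M \<Longrightarrow> \<bar>u x\<bar> \<le> B" "\<And>x. x \<in> M \<Longrightarrow> \<bar>v x\<bar> \<le> B'"
    "lipschitz M d c u" "lipschitz M d c' v" using assms by (metis BL_E)
  have "\<bar>u x * v x\<bar> \<le> B * B'" if "x \<in> M" for x
    using *(1,2)[OF that] by (simp add: abs_mult mult_mono')
  moreover have "\<bar>u x * v x - u y * v y\<bar> \<le> (B * c' + B' * c) * d x y" if "x \<in> M" "y \<in> M" for x y
  proof -
    have "\<bar>u x * v x - u y * v y\<bar> = \<bar>u x * (v x - v y) + v y * (u x - u y)\<bar>" by (simp add: algebra_simps)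
    also have "\<dots> \<le> \<bar>u x\<bar> * \<bar>v x - v y\<bar> + \<bar>v y\<bar> * \<bar>u x - u y\<bar>"
      by (metis abs_mult abs_triangle_ineq)
    also have "\<dots> \<le> B * (c' * d x y) + B' * (c * d x y)"
      using * that order_trans[OF abs_ge_zero *(1)[OF that(1)]] order_trans[OF abs_ge_zero *(2)[OF that(1)]]
      by (intro add_mono mult_mono) (auto simp: lipschitz_def)
    finally show ?thesis by (simp add: algebra_simps)
  qed
  ultimately show ?thesis unfolding BL_def lipschitz_def by blast
qed

lemma BL_diff [intro]: "BL u \<Longrightarrow> BL v \<Longrightarrow> BL (\<lambda>x. u x - v x)"
  using BL_add[OF _ BL_mult[OF BL_const[of "-1"], of v], of u] by simp

lemma BL_prod [intro]: "(\<And>i. i \<in> I \<Longrightarrow> BL (f i)) \<Longrightarrow> BL (\<lambda>x. \<Prod>i\<in>I. f i x)"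
  by (induction I rule: infinite_finite_induct) auto

lemma BL_scaled_Lip1:
  assumes "BL u" obtains c where "0 < c" "(\<lambda>x. u x / c) \<in> Lip1 M d"
proof -
  obtain B c where *: "\<And>x. x \<in> M \<Longrightarrow> \<bar>u x\<bar> \<le> B" "lipschitz M d c u" using assms by (metis BL_E)
  have "bounded ((\<lambda>x. u x / (max c 1)) ` M)"
    unfolding bounded_iff using * by (intro exI[of _ "B / max c 1"]) (auto simp: divide_right_mono)
  moreover have "\<bar>u x / max c 1 - u y / max c 1\<bar> \<le> d x y" if "x \<in> M" "y \<in> M" for x y
  proof -
    have "\<bar>u x - u y\<bar> \<le> c * d x y" using * that by (simp add: lipschitz_def)
    also have "\<dots> \<le> max c 1 * d x y" by (intro mult_right_mono) auto
    finally show ?thesis by (simp add: field_simps flip: diff_divide_distrib)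
  qed
  ultimately show ?thesis using that[of "max c 1"] by (auto simp: Lip1_def)
qed

lemma BL_measurable: "BL u \<Longrightarrow> u \<in> borel_measurable \<B>"
  using lipschitz_borel_measurable by (auto simp: BL_def)

lemma BL_integrable: "BL u \<Longrightarrow> integrable (\<mu> n) u"
  using prob_integrable_bounded[OF \<mu> BL_measurable] by (auto simp: BL_def)

definition Lam :: "('a \<Rightarrow> real) \<Rightarrow> real" where "Lam u = lim (\<lambda>n. \<integral>x. u x \<partial>\<mu> n)"

lemma Lip1_Cauchy: "u \<in> Lip1 M d \<Longrightarrow> Cauchy (\<lambda>n. \<integral>x. u x \<partial>\<mu> n)"
  unfolding Cauchy_altdef2
proof (intro allI impI)
  fix e :: real assume "u \<in> Lip1 M d" "0 < e"
  then obtain L where L: "\<And>n m. n \<ge> L \<Longrightarrow> m \<ge> L \<Longrightarrow> \<bar>(\<integral>x. u x \<partial>\<mu> n) - (\<integral>x. u x \<partial>\<mu> m)\<bar> \<le> e / 2"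
    using cauchy[of "e/2"] by auto
  show "\<exists>N. \<forall>n\<ge>N. dist (\<integral>x. u x \<partial>\<mu> n) (\<integral>x. u x \<partial>\<mu> N) < e"
    using L[OF _ order.refl] \<open>0 < e\<close> unfolding dist_real_def by (intro exI[of _ L]) fastforce
qed

lemma Lam_tendsto:
  assumes "BL u" shows "(\<lambda>n. \<integral>x. u x \<partial>\<mu> n) \<longlonglongrightarrow> Lam u"
proof -
  obtain c where c: "0 < c" "(\<lambda>x. u x / c) \<in> Lip1 M d" using BL_scaled_Lip1[OF assms] .
  then have "convergent (\<lambda>n. \<integral>x. u x / c \<partial>\<mu> n)"
    using Lip1_Cauchy Cauchy_convergent by blast
  then have "convergent (\<lambda>n. c * (\<integral>x. u x / c \<partial>\<mu> n))" by (rule convergent_mult[OF convergent_const])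
  then show ?thesis using c unfolding Lam_def by (simp add: convergent_LIMSEQ_iff)
qed

lemma Lam_mono:
  assumes "BL u" "BL v" "\<And>x. x \<in> M \<Longrightarrow> u x \<le> v x" shows "Lam u \<le> Lam v"
  by (rule LIMSEQ_le[OF Lam_tendsto[OF assms(1)] Lam_tendsto[OF assms(2)]])
    (use assms prob_algebraD(3)[OF \<mu>] in \<open>auto intro!: integral_mono BL_integrable\<close>)

lemma Lam_const [simp]: "Lam (\<lambda>_. a) = a"
proof -
  have "(\<integral>x. a \<partial>\<mu> n) = a" for n
    using prob_space.prob_space[OF prob_algebraD(1)[OF \<mu>]] by (simp add: prob_algebraD(3)[OF \<mu>])
  then show ?thesis unfolding Lam_def by (simp only: limI[OF tendsto_const])
qed

lemma Lam_add:
  assumes "BL u" "BL v" shows "Lam (\<lambda>x. u x + v x) = Lam u + Lam v"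
  using LIMSEQ_unique[OF Lam_tendsto[OF BL_add[OF assms]]] tendsto_add[OF assms[THEN Lam_tendsto]]
    assms[THEN BL_integrable] by (simp add: Bochner_Integration.integral_add)

lemma Lam_cmult:
  assumes "BL u" shows "Lam (\<lambda>x. a * u x) = a * Lam u"
  using LIMSEQ_unique[OF Lam_tendsto[OF BL_mult[OF BL_const assms]]] tendsto_mult_left[OF assms[THEN Lam_tendsto]]
  by simp

lemma Lam_cong: "(\<And>x. x \<in> M \<Longrightarrow> u x = v x) \<Longrightarrow> Lam u = Lam v"
  unfolding Lam_def using prob_algebraD(3)[OF \<mu>]
  by (intro arg_cong[where f=lim] ext Bochner_Integration.integral_cong) auto

lemma Lam_uniform:
  assumes "0 < \<epsilon>" obtains n where "\<And>u. u \<in> Lip1 M d \<Longrightarrow> \<bar>Lam u - (\<integral>x. u x \<partial>\<mu> n)\<bar> \<le> \<epsilon>"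
proof -
  obtain L where L: "\<And>n m u. n \<ge> L \<Longrightarrow> m \<ge> L \<Longrightarrow> u \<in> Lip1 M d \<Longrightarrow>
      \<bar>(\<integral>x. u x \<partial>\<mu> n) - (\<integral>x. u x \<partial>\<mu> m)\<bar> \<le> \<epsilon>"
    using cauchy[OF assms] by blast
  have "\<bar>Lam u - (\<integral>x. u x \<partial>\<mu> L)\<bar> \<le> \<epsilon>" if u: "u \<in> Lip1 M d" for u
  proof -
    have "BL u" by (rule Lip1_BL[OF u])
    have "(\<lambda>n. \<bar>(\<integral>x. u x \<partial>\<mu> n) - (\<integral>x. u x \<partial>\<mu> L)\<bar>) \<longlonglongrightarrow> \<bar>Lam u - (\<integral>x. u x \<partial>\<mu> L)\<bar>"
      by (intro tendsto_intros Lam_tendsto \<open>BL u\<close>)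
    then show ?thesis
      by (rule LIMSEQ_le_const2) (use L u in auto)
  qed
  then show ?thesis using that by blast
qed

definition bump :: "nat \<Rightarrow> nat \<Rightarrow> 'a \<Rightarrow> real" where
  "bump j i x = max 0 (1 - 2 ^ j * d x (q i))"

text \<open>
  Multiplying each bump by the complements of its predecessors makes the sum of the first \<open>n\<close>
  members equal to \<open>1 - (\<Prod>k<n. 1 - bump j k x)\<close>, without any normalisation.
\<close>

definition part :: "nat \<Rightarrow> nat \<Rightarrow> 'a \<Rightarrow> real" where
  "part j i x = bump j i x * (\<Prod>k<i. 1 - bump j k x)"

text \<open>
  This function dominates the defect \<open>\<Prod>k<n. 1 - bump j k x\<close> of the partition of unity. In contrast
  to the defect, whose Lipschitz constants grow with \<open>n\<close>, it is \<open>2\<^sup>j\<close>-Lipschitz for all \<open>n\<close>, which makes the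
  uniform Cauchy property applicable.
\<close>

primrec uncovered :: "nat \<Rightarrow> nat \<Rightarrow> 'a \<Rightarrow> real" where
  "uncovered j 0 x = 1"
| "uncovered j (Suc n) x = min (uncovered j n x) (1 - bump j n x)"

lemma bump_bounds: "0 \<le> bump j i x" "bump j i x \<le> 1"
  by (auto simp: bump_def)

lemma bump_lipschitz:
  assumes "x \<in> M" "y \<in> M" shows "\<bar>bump j i x - bump j i y\<bar> \<le> 2 ^ j * d x y"
proof -
  have "\<bar>d x (q i) - d y (q i)\<bar> \<le> d x y"
    using mdist_reverse_triangle[OF assms(1) q[of i] assms(2)] by (simp add: commute)
  then have "\<bar>2 ^ j * d x (q i) - 2 ^ j * d y (q i)\<bar> \<le> 2 ^ j * d x y"
    by (simp flip: right_diff_distrib add: abs_mult)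
  then show ?thesis by (auto simp: bump_def)
qed

lemma BL_bump [intro]: "BL (bump j i)"
  unfolding BL_def lipschitz_def using bump_bounds bump_lipschitz
  by (intro conjI exI[of _ 1] exI[of _ "2^j"]) (auto simp: abs_of_nonneg)

lemma BL_part [intro]: "BL (part j i)"
  unfolding part_def by (intro BL_mult BL_prod BL_diff BL_const BL_bump)

lemma part_bounds: "0 \<le> part j i x" "part j i x \<le> 1"
  unfolding part_def using bump_bounds by (auto intro!: mult_nonneg_nonneg mult_le_one prod_nonneg prod_le_1)

lemma part_pos_near:
  assumes "0 < part j i x" shows "d x (q i) < (1/2) ^ j"
proof -
  have "0 < bump j i x" using assms bump_bounds(1)[of j i x] by (cases "bump j i x = 0") (auto simp: part_def)
  then show ?thesis by (auto simp: bump_def max_def field_simps split: if_splits)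
qed

lemma prod_le_uncovered: "0 \<le> (\<Prod>k<n. 1 - bump j k x) \<and> (\<Prod>k<n. 1 - bump j k x) \<le> uncovered j n x \<and> uncovered j n x \<le> 1"
proof (induction n)
  case (Suc n)
  have 1: "(\<Prod>k<n. 1 - bump j k x) * (1 - bump j n x) \<le> (\<Prod>k<n. 1 - bump j k x) * 1"
    using Suc bump_bounds by (intro mult_left_mono) auto
  have 2: "(\<Prod>k<n. 1 - bump j k x) * (1 - bump j n x) \<le> 1 * (1 - bump j n x)"
    using Suc bump_bounds by (intro mult_right_mono) auto
  show ?case using Suc 1 2 bump_bounds[of j n x] by auto
qed simp

lemma uncovered_nonneg: "0 \<le> uncovered j n x"
  using prod_le_uncovered[of j x n] by linarith

lemma uncovered_Lip1: "(\<lambda>x. uncovered j n x / 2 ^ j) \<in> Lip1 M d"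
proof -
  have "\<bar>uncovered j n x - uncovered j n y\<bar> \<le> 2 ^ j * d x y" if "x \<in> M" "y \<in> M" for x y
  proof (induction n)
    case (Suc n)
    then show ?case using bump_lipschitz[OF that, of j n] by (auto simp: min_def)
  qed simp
  then have "\<bar>uncovered j n x / 2 ^ j - uncovered j n y / 2 ^ j\<bar> \<le> d x y" if "x \<in> M" "y \<in> M" for x y
    using that by (simp add: field_simps flip: diff_divide_distrib)
  moreover have "\<bar>uncovered j n x / 2 ^ j\<bar> \<le> 1" for x
  proof -
    have "uncovered j n x \<le> 2 ^ j"
      using prod_le_uncovered[where j=j and x=x and n=n] one_le_power[of "2::real" j] by linarith
    then show ?thesis using uncovered_nonneg[of j n x] by simp
  qed
  then have "bounded ((\<lambda>x. uncovered j n x / 2 ^ j) ` M)"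
    by (intro boundedI[where B=1]) auto
  ultimately show ?thesis by (simp add: Lip1_def)
qed

lemma BL_uncovered: "BL (uncovered j n)"
proof -
  have "BL (\<lambda>x. uncovered j n x / 2 ^ j)" by (rule Lip1_BL[OF uncovered_Lip1])
  from BL_mult[OF BL_const[of "2^j"] this] show ?thesis by simp
qed

lemma uncovered_tendsto_0:
  assumes "\<forall>e>0. \<exists>i. d x (q i) < e" shows "(\<lambda>n. uncovered j n x) \<longlonglongrightarrow> 0"
proof (rule LIMSEQ_I)
  fix r :: real assume "0 < r"
  then obtain i where i: "d x (q i) < r / 2 ^ j" using assms by (metis divide_pos_pos zero_less_numeral zero_less_power)
  have "uncovered j n x < r" if "Suc i \<le> n" for n
    using that
  proof (induction rule: dec_induct)
    case base
    have "1 - bump j i x \<le> 2 ^ j * d x (q i)" by (simp add: bump_def)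
    also have "\<dots> < r" using i by (simp add: field_simps)
    finally show ?case by simp
  qed auto
  then show "\<exists>no. \<forall>n\<ge>no. norm (uncovered j n x - 0) < r" using uncovered_nonneg by auto
qed

text \<open>
  No mass escapes in the limit: \<open>Lam\<close> is close to the integral for one fixed \<open>\<mu> m\<close>, uniformly
  in \<open>n\<close>, and that integral tends to 0 because \<open>\<mu> m\<close> lives on the closure of the points \<open>q i\<close>.
\<close>

lemma Lam_uncovered_tendsto_0: "(\<lambda>n. Lam (uncovered j n)) \<longlonglongrightarrow> 0"
proof (rule LIMSEQ_I)
  fix r :: real assume "0 < r"
  obtain m where m: "\<And>u. u \<in> Lip1 M d \<Longrightarrow> \<bar>Lam u - (\<integral>x. u x \<partial>\<mu> m)\<bar> \<le> r / 2 / 2 ^ j"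
    using Lam_uniform[of "r / 2 / 2 ^ j"] \<open>0 < r\<close> by auto
  have 1: "Lam (uncovered j n) \<le> (\<integral>x. uncovered j n x \<partial>\<mu> m) + r / 2" for n
  proof -
    have "\<bar>Lam (\<lambda>x. uncovered j n x / 2 ^ j) - (\<integral>x. uncovered j n x / 2 ^ j \<partial>\<mu> m)\<bar> \<le> r / 2 / 2 ^ j"
      by (rule m[OF uncovered_Lip1])
    moreover have "Lam (\<lambda>x. uncovered j n x / 2 ^ j) = Lam (uncovered j n) / 2 ^ j"
      using Lam_cmult[OF BL_uncovered, of "1 / 2^j" j n] by simp
    ultimately have "\<bar>Lam (uncovered j n) - (\<integral>x. uncovered j n x \<partial>\<mu> m)\<bar> \<le> r / 2"
      by (simp flip: diff_divide_distrib add: field_simps)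
    then show ?thesis by linarith
  qed
  have "(\<lambda>n. \<integral>x. uncovered j n x \<partial>\<mu> m) \<longlonglongrightarrow> (\<integral>x. 0 \<partial>\<mu> m)"
  proof (rule integral_dominated_convergence[where w="\<lambda>_. 1"])
    show "AE x in \<mu> m. (\<lambda>n. uncovered j n x) \<longlonglongrightarrow> 0"
      using dense[of m] by eventually_elim (rule uncovered_tendsto_0)
    show "integrable (\<mu> m) (\<lambda>_. 1 :: real)" by (rule BL_integrable[OF BL_const])
    show "AE x in \<mu> m. norm (uncovered j n x) \<le> 1" for n
      using uncovered_nonneg prod_le_uncovered by auto
  qed (use BL_integrable[OF BL_uncovered] borel_measurable_integrable in auto)
  then obtain N where N: "\<And>n. n \<ge> N \<Longrightarrow> norm (\<integral>x. uncovered j n x \<partial>\<mu> m) < r / 2"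
    using LIMSEQ_D[of _ "0::real" "r/2"] \<open>0 < r\<close> by auto
  have "norm (Lam (uncovered j n) - 0) < r" if "n \<ge> N" for n
  proof -
    have "Lam (\<lambda>_. 0) \<le> Lam (uncovered j n)"
      by (intro Lam_mono BL_uncovered BL_const uncovered_nonneg)
    then show ?thesis using 1[of n] N[OF that] by simp
  qed
  then show "\<exists>no. \<forall>n\<ge>no. norm (Lam (uncovered j n) - 0) < r" by blast
qed

lemma Lam_partition_sums:
  assumes v: "BL v" "\<And>x. x \<in> M \<Longrightarrow> 0 \<le> v x" "\<And>x. x \<in> M \<Longrightarrow> v x \<le> 1"
  shows "(\<lambda>i. Lam (\<lambda>x. v x * part j i x)) sums Lam v"
proof -
  let ?r = "\<lambda>n x. v x * (\<Prod>k<n. 1 - bump j k x)"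
  have BLr: "BL (?r n)" for n using v by (intro BL_mult BL_prod BL_diff BL_const BL_bump)
  have sum: "(\<Sum>i<n. Lam (\<lambda>x. v x * part j i x)) = Lam v - Lam (?r n)" for n
  proof (induction n)
    case (Suc n)
    have "Lam (?r n) = Lam (\<lambda>x. ?r (Suc n) x + v x * part j n x)"
      by (rule Lam_cong) (simp add: part_def algebra_simps)
    also have "\<dots> = Lam (?r (Suc n)) + Lam (\<lambda>x. v x * part j n x)"
      by (rule Lam_add[OF BLr BL_mult[OF v(1) BL_part]])
    finally show ?case using Suc by simp
  qed simp
  have "(\<lambda>n. Lam (?r n)) \<longlonglongrightarrow> 0"
  proof (rule tendsto_sandwich[OF _ _ tendsto_const Lam_uncovered_tendsto_0])
    have "Lam (\<lambda>_. 0) \<le> Lam (?r n)" for n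
      using prod_le_uncovered v by (intro Lam_mono BLr BL_const) auto
    then show "\<forall>\<^sub>F n in sequentially. 0 \<le> Lam (?r n)" by simp
    have "Lam (?r n) \<le> Lam (uncovered j n)" for n
    proof (intro Lam_mono BLr BL_uncovered)
      fix x assume "x \<in> M"
      then have "?r n x \<le> 1 * uncovered j n x" using prod_le_uncovered v by (intro mult_mono) auto
      then show "?r n x \<le> uncovered j n x" by simp
    qed
    then show "\<forall>\<^sub>F n in sequentially. Lam (?r n) \<le> Lam (uncovered j n)" by simp
  qed
  then have "(\<lambda>n. Lam v - Lam (?r n)) \<longlonglongrightarrow> Lam v - 0" by (intro tendsto_diff tendsto_const)
  then show ?thesis unfolding sums_def sum by simp
qed


definition weight :: "(nat \<Rightarrow> nat) \<Rightarrow> nat \<Rightarrow> 'a \<Rightarrow> real" where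
  "weight w n x = (\<Prod>j<n. part j (w j) x)"

definition cylinder_mass :: "(nat \<Rightarrow> nat) \<Rightarrow> nat \<Rightarrow> real" where
  "cylinder_mass w n = Lam (weight w n)"

text \<open>
  The mean of \<open>u\<close> under \<open>Lam\<close>, given that the digits of the point begin like \<open>w\<close>. The value is 0
  if the beginning has probability 0.
\<close>

definition cond_mean :: "('a \<Rightarrow> real) \<Rightarrow> nat \<Rightarrow> (nat \<Rightarrow> nat) \<Rightarrow> real" where
  "cond_mean u n w = Lam (\<lambda>x. u x * weight w n x) / cylinder_mass w n"

text \<open>
  The conditional law of digit \<open>n\<close> given the digits before it. On beginnings of probability 0 any
  probability measure would do.
\<close>

definition digit_kernel :: "nat \<Rightarrow> (nat \<Rightarrow> nat) \<Rightarrow> nat measure" where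
  "digit_kernel n w = (if 0 < cylinder_mass w n
     then density (count_space UNIV) (\<lambda>i. ennreal (cylinder_mass (w(n := i)) (Suc n) / cylinder_mass w n))
     else return (count_space UNIV) 0)"

abbreviation "digits \<equiv> \<lambda>_ :: nat. count_space (UNIV :: nat set)"

lemma BL_weight [intro]: "BL (weight w n)"
  unfolding weight_def by (intro BL_prod BL_part)

lemma weight_bounds: "0 \<le> weight w n x" "weight w n x \<le> 1"
  unfolding weight_def using part_bounds by (auto intro!: prod_nonneg prod_le_1)

lemma weight_Suc: "weight (w(n := i)) (Suc n) x = weight w n x * part n i x"
  unfolding weight_def by (auto intro!: prod.cong)

lemma weight_cong: "(\<And>j. j < n \<Longrightarrow> w j = w' j) \<Longrightarrow> weight w n = weight w' n"
  unfolding weight_def by (auto intro!: prod.cong)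

lemma cylinder_mass_cong: "(\<And>j. j < n \<Longrightarrow> w j = w' j) \<Longrightarrow> cylinder_mass w n = cylinder_mass w' n"
  using weight_cong[of n w w'] by (simp add: cylinder_mass_def)

lemma cond_mean_cong: "(\<And>j. j < n \<Longrightarrow> w j = w' j) \<Longrightarrow> cond_mean u n w = cond_mean u n w'"
  using weight_cong[of n w w'] by (simp add: cond_mean_def cylinder_mass_def)

lemma cylinder_mass_nonneg: "0 \<le> cylinder_mass w n"
  using Lam_mono[OF BL_const BL_weight, of 0 w n] weight_bounds by (simp add: cylinder_mass_def)

lemma Lam_weighted_bounds:
  assumes "BL u" "\<And>x. x \<in> M \<Longrightarrow> 0 \<le> u x" "\<And>x. x \<in> M \<Longrightarrow> u x \<le> 1"
  shows "0 \<le> Lam (\<lambda>x. u x * weight w n x)" "Lam (\<lambda>x. u x * weight w n x) \<le> cylinder_mass w n"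
proof -
  show "0 \<le> Lam (\<lambda>x. u x * weight w n x)"
    using Lam_mono[OF BL_const BL_mult[OF assms(1) BL_weight], of 0 w n] weight_bounds assms by simp
  show "Lam (\<lambda>x. u x * weight w n x) \<le> cylinder_mass w n"
    unfolding cylinder_mass_def
    using assms weight_bounds by (intro Lam_mono BL_mult BL_weight) (auto intro: mult_left_le_one_le)
qed

lemma weighted_sums:
  assumes "BL u" "\<And>x. x \<in> M \<Longrightarrow> 0 \<le> u x" "\<And>x. x \<in> M \<Longrightarrow> u x \<le> 1"
  shows "(\<lambda>i. Lam (\<lambda>x. u x * weight (w(n := i)) (Suc n) x)) sums Lam (\<lambda>x. u x * weight w n x)"
  unfolding weight_Suc mult.assoc[symmetric]
  using assms weight_bounds by (intro Lam_partition_sums BL_mult BL_weight) (auto intro: mult_le_one)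

lemma cylinder_mass_sums: "(\<lambda>i. cylinder_mass (w(n := i)) (Suc n)) sums cylinder_mass w n"
  using weighted_sums[of "\<lambda>_. 1" w n] by (auto simp: cylinder_mass_def[abs_def])

text \<open>
  The conditional means form a martingale. If the beginning \<open>w\<close> has probability 0, both sides are 0,
  as every extension of \<open>w\<close> has probability 0 too.
\<close>

lemma nn_integral_digit_kernel:
  assumes u: "BL u" "\<And>x. x \<in> M \<Longrightarrow> 0 \<le> u x" "\<And>x. x \<in> M \<Longrightarrow> u x \<le> 1"
  shows "(\<integral>\<^sup>+i. ennreal (cond_mean u (Suc n) (w(n := i))) \<partial>digit_kernel n w) = ennreal (cond_mean u n w)"
proof (cases "0 < cylinder_mass w n")
  case True
  let ?a = "\<lambda>i. Lam (\<lambda>x. u x * weight (w(n := i)) (Suc n) x)"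
  have eq: "ennreal (cylinder_mass (w(n := i)) (Suc n) / cylinder_mass w n) * ennreal (cond_mean u (Suc n) (w(n := i)))
      = ennreal (?a i / cylinder_mass w n)" for i
    using Lam_weighted_bounds[OF u, of "w(n := i)" "Suc n"] cylinder_mass_nonneg[of "w(n := i)" "Suc n"] True
    by (subst ennreal_mult[symmetric]) (auto simp: cond_mean_def)
  have "(\<integral>\<^sup>+i. ennreal (cond_mean u (Suc n) (w(n := i))) \<partial>digit_kernel n w) = (\<Sum>i. ennreal (?a i / cylinder_mass w n))"
    using True by (simp add: digit_kernel_def nn_integral_density nn_integral_count_space_nat eq)
  also have "\<dots> = ennreal (Lam (\<lambda>x. u x * weight w n x) / cylinder_mass w n)"
    using weighted_sums[OF u, of w n] True Lam_weighted_bounds(1)[OF u]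
    by (intro suminf_ennreal_eq sums_divide) auto
  finally show ?thesis by (simp add: cond_mean_def)
next
  case False
  then have z: "cylinder_mass w n = 0" using cylinder_mass_nonneg[of w n] by simp
  have "cylinder_mass (w(n := 0)) (Suc n) = 0"
    using sums_le[OF _ sums_single[of 0 "\<lambda>i. cylinder_mass (w(n := i)) (Suc n)"] cylinder_mass_sums[of w n]] z cylinder_mass_nonneg
    by (simp add: antisym)
  then show ?thesis using False z by (simp add: digit_kernel_def nn_integral_return cond_mean_def)
qed

lemma PiM_digits: "PiM {0..<n} digits = count_space (PiE {0..<n} (\<lambda>_. UNIV))"
  by (intro count_space_PiM_finite) auto

lemma prob_space_digit_kernel: "prob_space (digit_kernel n w)"
proof (cases "0 < cylinder_mass w n")
  case True
  have "emeasure (digit_kernel n w) UNIV = (\<Sum>i. ennreal (cylinder_mass (w(n := i)) (Suc n) / cylinder_mass w n))"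
    using True by (simp add: digit_kernel_def emeasure_density nn_integral_count_space_nat)
  also have "\<dots> = ennreal (cylinder_mass w n / cylinder_mass w n)"
    using True cylinder_mass_nonneg by (intro suminf_ennreal_eq sums_divide cylinder_mass_sums) auto
  finally show ?thesis using True by (intro prob_spaceI) (simp add: digit_kernel_def)
next
  case False
  then show ?thesis by (simp add: digit_kernel_def prob_space_return)
qed

lemma sets_digit_kernel: "sets (digit_kernel n w) = sets (count_space UNIV)"
  by (simp add: digit_kernel_def)

sublocale IT: Ionescu_Tulcea digit_kernel digits
proof (rule Ionescu_Tulcea.intro)
  fix n
  show "digit_kernel n \<in> PiM {0..<n} digits \<rightarrow>\<^sub>M subprob_algebra (count_space UNIV)"
    unfolding PiM_digits measurable_count_space_eq1
    by (auto simp: space_subprob_algebra sets_digit_kernel prob_space_imp_subprob_space[OF prob_space_digit_kernel])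
  show "prob_space (digit_kernel n w)" for w by (rule prob_space_digit_kernel)
qed

abbreviation "codes \<equiv> IT.PF.lim"

lemma nn_integral_C_cond_mean:
  assumes u: "BL u" "\<And>x. x \<in> M \<Longrightarrow> 0 \<le> u x" "\<And>x. x \<in> M \<Longrightarrow> u x \<le> 1"
  shows "(\<integral>\<^sup>+w. ennreal (cond_mean u n w) \<partial>IT.C 0 n (\<lambda>_. undefined)) = ennreal (Lam u)"
proof (induction n)
  case 0
  have "cond_mean u 0 w = Lam u" for w by (simp add: cond_mean_def cylinder_mass_def weight_def[abs_def])
  then have "(\<integral>\<^sup>+w. ennreal (cond_mean u 0 w) \<partial>IT.C 0 0 (\<lambda>_. undefined))
      = ennreal (Lam u) * emeasure (IT.C 0 0 (\<lambda>_. undefined)) (space (IT.C 0 0 (\<lambda>_. undefined)))"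
    by simp
  then show ?case using prob_space.emeasure_space_1[OF IT.prob_space_C[of "\<lambda>_. undefined" 0 0]] by simp
next
  case (Suc n)
  have meas: "(\<lambda>w. ennreal (cond_mean u k w)) \<in> borel_measurable (PiM {0..<k} digits)" for k
    unfolding PiM_digits by simp
  have "(\<integral>\<^sup>+w. ennreal (cond_mean u (Suc n) w) \<partial>IT.C 0 (Suc n) (\<lambda>_. undefined))
      = (\<integral>\<^sup>+w. (\<integral>\<^sup>+w'. ennreal (cond_mean u (Suc n) w') \<partial>IT.eP n w) \<partial>IT.C 0 n (\<lambda>_. undefined))"
    using IT.measurable_eP[of n] IT.sets_C[of "\<lambda>_. undefined" 0 n]
    by (simp, subst nn_integral_bind[OF meas]) (auto cong: measurable_cong_sets)
  also have "\<dots> = (\<integral>\<^sup>+w. ennreal (cond_mean u n w) \<partial>IT.C 0 n (\<lambda>_. undefined))"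
    using meas nn_integral_digit_kernel[OF u]
    by (intro nn_integral_cong) (auto simp: IT.space_C IT.nn_integral_eP)
  finally show ?case using Suc by simp
qed

lemma distr_codes_restrict: "distr codes (PiM {0..<n} digits) (\<lambda>w. restrict w {0..<n}) = IT.C 0 n (\<lambda>_. undefined)"
proof -
  have "distr codes (PiM {0..<n} digits) (\<lambda>w. restrict w {0..<n}) = IT.CI {0..<n}"
    by (rule IT.distr_lim) simp
  also have "\<dots> = IT.C 0 n (\<lambda>_. undefined)"
  proof (rule measure_eqI)
    show "sets (IT.CI {0..<n}) = sets (IT.C 0 n (\<lambda>_. undefined))"
      by (simp add: IT.CI_def IT.sets_C)
    fix A assume "A \<in> sets (IT.CI {0..<n})"
    then have A: "A \<in> sets (PiM {0..<n} digits)" by (simp add: IT.CI_def)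
    then show "emeasure (IT.CI {0..<n}) A = emeasure (IT.C 0 n (\<lambda>_. undefined)) A"
      using sets.sets_into_space[OF A] by (subst IT.emeasure_CI[of _ n]) (auto simp: prod_emb_id space_PiM)
  qed
  finally show ?thesis .
qed

lemma restrict_measurable: "(\<lambda>w. restrict w {0..<n}) \<in> codes \<rightarrow>\<^sub>M PiM {0..<n} digits"
  by (simp cong: measurable_cong_sets)

lemma prob_space_codes: "prob_space codes"
  by (rule prob_space_distrD[OF restrict_measurable[of 0]], subst distr_codes_restrict, rule IT.prob_space_C) simp

lemma measurable_prefix:
  fixes f :: "(nat \<Rightarrow> nat) \<Rightarrow> real"
  assumes "\<And>w w'. (\<And>j. j < n \<Longrightarrow> w j = w' j) \<Longrightarrow> f w = f w'"
  shows "f \<in> borel_measurable codes"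
proof -
  have "(\<lambda>w. f (restrict w {0..<n})) \<in> borel_measurable codes"
    by (rule measurable_compose[OF restrict_measurable]) (simp add: PiM_digits)
  moreover have "f (restrict w {0..<n}) = f w" for w by (rule assms) simp
  ultimately show ?thesis by simp
qed

lemma cond_mean_measurable: "cond_mean u n \<in> borel_measurable codes"
  by (rule measurable_prefix[of n]) (rule cond_mean_cong)

lemma cylinder_mass_measurable: "(\<lambda>w. cylinder_mass w n) \<in> borel_measurable codes"
  by (rule measurable_prefix[of n]) (rule cylinder_mass_cong)

lemma cond_mean_bounds:
  assumes u: "BL u" "\<And>x. x \<in> M \<Longrightarrow> 0 \<le> u x" "\<And>x. x \<in> M \<Longrightarrow> u x \<le> 1"
  shows "0 \<le> cond_mean u n w" "cond_mean u n w \<le> 1"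
  using Lam_weighted_bounds[OF u, where w=w and n=n] cylinder_mass_nonneg[of w n] by (auto simp: cond_mean_def divide_le_eq_1)

lemma nn_integral_cond_mean:
  assumes u: "BL u" "\<And>x. x \<in> M \<Longrightarrow> 0 \<le> u x" "\<And>x. x \<in> M \<Longrightarrow> u x \<le> 1"
  shows "(\<integral>\<^sup>+w. ennreal (cond_mean u n w) \<partial>codes) = ennreal (Lam u)"
proof -
  have "(\<integral>\<^sup>+w. ennreal (cond_mean u n w) \<partial>codes) = (\<integral>\<^sup>+w. ennreal (cond_mean u n (restrict w {0..<n})) \<partial>codes)"
    by (intro nn_integral_cong arg_cong[where f=ennreal] cond_mean_cong) simp
  also have "\<dots> = (\<integral>\<^sup>+w. ennreal (cond_mean u n w) \<partial>distr codes (PiM {0..<n} digits) (\<lambda>w. restrict w {0..<n}))"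
    by (rule nn_integral_distr[symmetric, OF restrict_measurable]) (simp add: PiM_digits)
  finally show ?thesis by (simp add: distr_codes_restrict nn_integral_C_cond_mean[OF u])
qed

lemma integral_cond_mean:
  assumes u: "BL u" "\<And>x. x \<in> M \<Longrightarrow> 0 \<le> u x" "\<And>x. x \<in> M \<Longrightarrow> u x \<le> 1"
  shows "(\<integral>w. cond_mean u n w \<partial>codes) = Lam u"
  using nn_integral_cond_mean[OF u, of n] cond_mean_bounds[OF u] cond_mean_measurable
    Lam_weighted_bounds(1)[OF u, of undefined 0]
  by (subst integral_eq_nn_integral) (auto simp: weight_def)

lemma AE_cylinder_mass_pos: "AE w in codes. \<forall>n. 0 < cylinder_mass w n"
proof -
  interpret codes: prob_space codes by (rule prob_space_codes)
  have "AE w in codes. 0 < cylinder_mass w n" for n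
  proof -
    have c: "cond_mean (\<lambda>_. 1) n w = indicator {w \<in> space codes. 0 < cylinder_mass w n} w" if "w \<in> space codes" for w
      using cylinder_mass_nonneg[of w n] that by (auto simp: cond_mean_def cylinder_mass_def[symmetric] indicator_def)
    have m: "{w \<in> space codes. 0 < cylinder_mass w n} \<in> sets codes"
      using borel_measurable_less[OF borel_measurable_const cylinder_mass_measurable[of n]] .
    have "(\<integral>w. cond_mean (\<lambda>_. 1) n w \<partial>codes) = (\<integral>w. indicator {w \<in> space codes. 0 < cylinder_mass w n} w \<partial>codes)"
      by (rule Bochner_Integration.integral_cong[OF refl c])
    then have "codes.prob {w \<in> space codes. 0 < cylinder_mass w n} = (\<integral>w. cond_mean (\<lambda>_. 1) n w \<partial>codes)"
      using m by simp
    also have "\<dots> = 1" using integral_cond_mean[of "\<lambda>_. 1" n] by auto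
    finally have "AE w in codes. w \<in> {w \<in> space codes. 0 < cylinder_mass w n}" by (rule codes.AE_prob_1)
    then show ?thesis by eventually_elim simp
  qed
  then show ?thesis by (simp add: AE_all_countable)
qed

text \<open>
  A beginning of positive probability is witnessed by a point at which all its partition functions
  are positive.
\<close>

lemma cylinder_mass_pos_near:
  assumes "0 < cylinder_mass w n" obtains x where "x \<in> M" "\<And>j. j < n \<Longrightarrow> d x (q (w j)) < (1/2) ^ j"
proof -
  have "\<exists>x\<in>M. 0 < weight w n x"
  proof (rule ccontr)
    assume "\<not> (\<exists>x\<in>M. 0 < weight w n x)"
    then have "weight w n x = 0" if "x \<in> M" for x
      using that weight_bounds(1)[of w n x] by force
    then have "cylinder_mass w n = Lam (\<lambda>_. 0)" unfolding cylinder_mass_def by (rule Lam_cong)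
    then show False using assms by simp
  qed
  then obtain x where x: "x \<in> M" "0 < weight w n x" by blast
  have "0 < part j (w j) x" if "j < n" for j
  proof (rule ccontr)
    assume "\<not> 0 < part j (w j) x"
    then have "part j (w j) x = 0" using part_bounds(1)[of j "w j" x] by simp
    then have "weight w n x = 0" using that unfolding weight_def by auto
    then show False using x by simp
  qed
  then show ?thesis using that[OF x(1)] part_pos_near by blast
qed

lemma cylinder_mass_pos_Cauchy:
  assumes "\<forall>n. 0 < cylinder_mass w n" shows "MCauchy (\<lambda>j. q (w j))"
  unfolding MCauchy_def
proof (intro conjI allI impI)
  show "range (\<lambda>j. q (w j)) \<subseteq> M" using q by auto
  fix e :: real assume "0 < e"
  then obtain N where N: "(1/2 :: real) ^ N < e / 2"
    using real_arch_pow_inv[of "e/2" "1/2"] by auto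
  show "\<exists>N. \<forall>n n'. N \<le> n \<longrightarrow> N \<le> n' \<longrightarrow> d (q (w n)) (q (w n')) < e"
  proof (intro exI allI impI)
    fix n n' assume n: "N \<le> n" "N \<le> n'"
    obtain x where x: "x \<in> M" "\<And>j. j < Suc (max n n') \<Longrightarrow> d x (q (w j)) < (1/2) ^ j"
      using cylinder_mass_pos_near[of w "Suc (max n n')"] assms by blast
    have "d (q (w n)) (q (w n')) \<le> d x (q (w n)) + d x (q (w n'))"
      using triangle''[OF q x(1) q] by simp
    also have "\<dots> < (1/2) ^ n + (1/2) ^ n'" by (intro add_strict_mono x(2)) auto
    also have "\<dots> \<le> (1/2) ^ N + (1/2) ^ N" using n by (intro add_mono power_decreasing) auto
    also have "\<dots> < e" using N by simp
    finally show "d (q (w n)) (q (w n')) < e" .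
  qed
qed

text \<open>
  The value \<open>q 0\<close> on the null set of digit sequences with an impossible beginning is arbitrary.
\<close>

definition limpt :: "(nat \<Rightarrow> nat) \<Rightarrow> 'a" where
  "limpt w = (if \<forall>n. 0 < cylinder_mass w n then SOME x. limitin mtopology (\<lambda>j. q (w j)) x sequentially else q 0)"

lemma limpt_limitin:
  assumes "\<forall>n. 0 < cylinder_mass w n" shows "limitin mtopology (\<lambda>j. q (w j)) (limpt w) sequentially"
proof -
  have "\<exists>x. limitin mtopology (\<lambda>j. q (w j)) x sequentially"
    using complete cylinder_mass_pos_Cauchy[OF assms] unfolding mcomplete_def by blast
  from someI_ex[OF this] show ?thesis using assms by (simp add: limpt_def)
qed

lemma limpt_in_space: "limpt w \<in> M"
proof (cases "\<forall>n. 0 < cylinder_mass w n")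
  case True
  show ?thesis by (rule limitin_mspace[OF limpt_limitin[OF True]])
next
  case False
  then show ?thesis using q by (simp only: limpt_def if_False)
qed

lemma lipschitz_limpt:
  assumes "lipschitz M d c u" "\<forall>n. 0 < cylinder_mass w n"
  shows "(\<lambda>j. u (q (w j))) \<longlonglongrightarrow> u (limpt w)"
  using continuous_map_limit[OF lipschitz_continuous_map[OF assms(1)] limpt_limitin[OF assms(2)]]
  by (simp add: comp_def)

lemma measurable_limpt: "limpt \<in> codes \<rightarrow>\<^sub>M \<B>"
proof (rule measurable_metric_borelI)
  show "limpt \<in> space codes \<rightarrow> M" using limpt_in_space by simp
  fix u assume u: "lipschitz M d 1 u"
  have eq: "u (limpt w) = (if \<forall>n. 0 < cylinder_mass w n then lim (\<lambda>j. u (q (w j))) else u (q 0))" for w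
  proof (cases "\<forall>n. 0 < cylinder_mass w n")
    case False
    then show ?thesis by (simp only: limpt_def if_False)
  qed (simp add: limI[OF lipschitz_limpt[OF u]])
  have [measurable]: "(\<lambda>w. u (q (w j))) \<in> borel_measurable codes" for j
    by (rule measurable_prefix[of "Suc j"]) simp
  note [measurable] = cylinder_mass_measurable
  show "(\<lambda>w. u (limpt w)) \<in> borel_measurable codes" unfolding eq by measurable
qed

text \<open>
  The martingale of conditional means of \<open>u\<close> has constant mean \<open>Lam u\<close>. A point with digits \<open>w\<close>
  lies within \<open>2\<^sup>-\<^sup>n\<close> of \<open>q (w n)\<close>, so the conditional mean differs from \<open>u (q (w n))\<close> by at most \<open>c 2\<^sup>-\<^sup>n\<close> and
  converges to the value of \<open>u\<close> at the limit point.
\<close>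

lemma integral_limpt_unit:
  assumes u: "lipschitz M d c u" "\<And>x. x \<in> M \<Longrightarrow> 0 \<le> u x" "\<And>x. x \<in> M \<Longrightarrow> u x \<le> 1"
  shows "(\<integral>w. u (limpt w) \<partial>codes) = Lam u"
proof -
  have BLu: "BL u" using u unfolding BL_def by (intro conjI exI[of _ c] exI[of _ 1]) (auto simp: abs_of_nonneg)
  interpret codes: prob_space codes by (rule prob_space_codes)
  have near: "\<bar>cond_mean u (Suc n) w - u (q (w n))\<bar> \<le> \<bar>c\<bar> * (1/2) ^ n" if pos: "0 < cylinder_mass w (Suc n)" for n w
  proof -
    let ?e = "\<bar>c\<bar> * (1/2) ^ n" and ?W = "weight w (Suc n)"
    have le: "\<bar>u x - u (q (w n))\<bar> * ?W x \<le> ?e * ?W x" if x: "x \<in> M" for x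
    proof (cases "?W x = 0")
      case False
      then have "part n (w n) x \<noteq> 0" by (auto simp: weight_def)
      then have "d x (q (w n)) < (1/2) ^ n" using part_pos_near part_bounds(1)[of n "w n" x] by simp
      have "\<bar>u x - u (q (w n))\<bar> \<le> c * d x (q (w n))" using u x q by (simp add: lipschitz_def)
      also have "\<dots> \<le> \<bar>c\<bar> * d x (q (w n))" by (intro mult_right_mono) auto
      also have "\<dots> \<le> ?e" using \<open>d x (q (w n)) < (1/2) ^ n\<close> by (intro mult_left_mono) auto
      finally show ?thesis using weight_bounds(1) by (intro mult_right_mono)
    qed simp
    have le': "(u x - u (q (w n))) * ?W x \<le> ?e * ?W x" "(u (q (w n)) - u x) * ?W x \<le> ?e * ?W x"
      if "x \<in> M" for x
      by (rule order_trans[OF mult_right_mono[OF _ weight_bounds(1)] le[OF that]], simp)+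
    have 1: "Lam (\<lambda>x. u x * ?W x) \<le> Lam (\<lambda>x. (u (q (w n)) + ?e) * ?W x)"
      using le'(1) by (intro Lam_mono BL_mult BLu BL_weight BL_const) (simp add: algebra_simps)
    have 2: "Lam (\<lambda>x. (u (q (w n)) - ?e) * ?W x) \<le> Lam (\<lambda>x. u x * ?W x)"
      using le'(2) by (intro Lam_mono BL_mult BLu BL_weight BL_const) (simp add: algebra_simps)
    show ?thesis
      using 1[unfolded Lam_cmult[OF BL_weight]] 2[unfolded Lam_cmult[OF BL_weight]] pos
      unfolding cylinder_mass_def[symmetric] cond_mean_def pos_divide_le_eq[OF pos, symmetric] pos_le_divide_eq[OF pos, symmetric]
      by linarith
  qed
  have "(\<lambda>n. \<integral>w. cond_mean u (Suc n) w \<partial>codes) \<longlonglongrightarrow> (\<integral>w. u (limpt w) \<partial>codes)"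
  proof (rule integral_dominated_convergence[where w="\<lambda>_. 1"])
    show "(\<lambda>w. u (limpt w)) \<in> borel_measurable codes"
      by (rule measurable_compose[OF measurable_limpt BL_measurable[OF BLu]])
    show "AE w in codes. (\<lambda>n. cond_mean u (Suc n) w) \<longlonglongrightarrow> u (limpt w)"
      using AE_cylinder_mass_pos
    proof eventually_elim
      fix w assume w: "\<forall>n. 0 < cylinder_mass w n"
      have "(\<lambda>n. \<bar>c\<bar> * (1/2) ^ n) \<longlonglongrightarrow> \<bar>c\<bar> * 0" by (intro tendsto_mult_left LIMSEQ_power_zero) simp
      then have e0: "(\<lambda>n. \<bar>c\<bar> * (1/2) ^ n) \<longlonglongrightarrow> 0" by simp
      have "(\<lambda>n. cond_mean u (Suc n) w - u (q (w n))) \<longlonglongrightarrow> 0"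
        by (rule Lim_null_comparison[OF always_eventually e0]) (simp add: near w)
      from tendsto_add[OF this lipschitz_limpt[OF u(1) w]]
      show "(\<lambda>n. cond_mean u (Suc n) w) \<longlonglongrightarrow> u (limpt w)" by simp
    qed
    show "AE w in codes. norm (cond_mean u (Suc n) w) \<le> 1" for n
      using cond_mean_bounds[OF BLu u(2,3)] by auto
  qed (use cond_mean_measurable in auto)
  moreover have "(\<integral>w. cond_mean u (Suc n) w \<partial>codes) = Lam u" for n by (rule integral_cond_mean[OF BLu u(2,3)])
  ultimately show ?thesis using LIMSEQ_unique[OF _ tendsto_const] by simp
qed

theorem limit_exists:
  obtains \<nu> where "\<nu> \<in> space (prob_algebra \<B>)"
    "\<And>u. u \<in> Lip1 M d \<Longrightarrow> (\<lambda>n. \<integral>x. u x \<partial>\<mu> n) \<longlonglongrightarrow> (\<integral>x. u x \<partial>\<nu>)"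
proof
  interpret codes: prob_space codes by (rule prob_space_codes)
  let ?\<nu> = "distr codes \<B> limpt"
  show "?\<nu> \<in> space (prob_algebra \<B>)"
    using codes.prob_space_distr[OF measurable_limpt] by (simp add: space_prob_algebra)
  fix u assume u: "u \<in> Lip1 M d"
  obtain B where B: "B > 0" "\<And>x. x \<in> M \<Longrightarrow> \<bar>u x\<bar> \<le> B" using u bounded_imageE unfolding Lip1_iff by metis
  have BLu: "BL u" by (rule Lip1_BL[OF u])
  let ?v = "\<lambda>x. 1 / 2 + (1 / (2 * B)) * u x"
  have BLv: "BL ?v" by (intro BL_add BL_mult BL_const BLu)
  then obtain c where c: "lipschitz M d c ?v" by (rule BL_E)
  have "(\<integral>w. ?v (limpt w) \<partial>codes) = Lam ?v"
  proof (rule integral_limpt_unit[OF c])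
    fix x assume "x \<in> M"
    then show "0 \<le> ?v x" "?v x \<le> 1" using B(1) B(2)[of x] by (auto simp: field_simps abs_le_iff)
  qed
  moreover have "Lam ?v = 1 / 2 + (1 / (2 * B)) * Lam u"
    by (simp only: Lam_add[OF BL_const BL_mult[OF BL_const BLu]] Lam_cmult[OF BLu] Lam_const)
  moreover have "(\<integral>w. ?v (limpt w) \<partial>codes) = 1 / 2 + (1 / (2 * B)) * (\<integral>w. u (limpt w) \<partial>codes)"
  proof -
    have "integrable codes (\<lambda>w. u (limpt w))"
      using B limpt_in_space measurable_compose[OF measurable_limpt BL_measurable[OF BLu]]
      by (intro codes.integrable_const_bound[where B=B]) auto
    then show ?thesis using codes.prob_space by simp
  qed
  ultimately have "(\<integral>w. u (limpt w) \<partial>codes) = Lam u" using B(1) by simp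
  then have "(\<integral>x. u x \<partial>?\<nu>) = Lam u"
    using integral_distr[OF measurable_limpt BL_measurable[OF BLu]] by simp
  then show "(\<lambda>n. \<integral>x. u x \<partial>\<mu> n) \<longlonglongrightarrow> (\<integral>x. u x \<partial>?\<nu>)" using Lam_tendsto[OF BLu] by simp
qed

end

section \<open>Total variation and densities\<close>

lemma density_in_fin_dens:
  assumes "f \<in> borel_measurable lam" "(\<integral>\<^sup>+t. f t \<partial>lam) \<noteq> \<infinity>"
  shows "density lam f \<in> fin_dens lam"
  using assms by (auto simp: fin_dens_def emeasure_density intro!: finite_measureI cong: nn_integral_cong)

lemma density_in_prob_dens:
  assumes "f \<in> borel_measurable lam" "(\<integral>\<^sup>+t. f t \<partial>lam) = 1"
  shows "density lam f \<in> prob_dens lam"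
  using assms by (auto simp: prob_dens_def emeasure_density intro!: prob_spaceI cong: nn_integral_cong)

lemma prob_dens_subset: "prob_dens lam \<subseteq> fin_dens lam"
  by (auto simp: prob_dens_def fin_dens_def prob_space_def)

lemma prob_dens_fin_dens: "x \<in> prob_dens lam \<Longrightarrow> x \<in> fin_dens lam"
  using prob_dens_subset by blast

lemma fin_densE:
  assumes "x \<in> fin_dens lam"
  obtains f :: "'s \<Rightarrow> real" where "integrable lam f" "\<And>s. 0 \<le> f s" "x = density lam (\<lambda>s. ennreal (f s))"
proof -
  obtain f where f: "finite_measure x" "f \<in> borel_measurable lam" "x = density lam f"
    using assms by (auto simp: fin_dens_def)
  interpret finite_measure x by fact
  have fin: "(\<integral>\<^sup>+s. f s \<partial>lam) \<noteq> \<infinity>"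
    using emeasure_finite[of "space lam"] f by (simp add: emeasure_density cong: nn_integral_cong)
  have AE: "AE s in lam. ennreal (enn2real (f s)) = f s"
    using nn_integral_noteq_infinite[OF f(2) fin] by eventually_elim (simp add: top.not_eq_extremum)
  show ?thesis
  proof (rule that[of "\<lambda>s. enn2real (f s)"])
    have "(\<integral>\<^sup>+s. ennreal (enn2real (f s)) \<partial>lam) = (\<integral>\<^sup>+s. f s \<partial>lam)"
      by (rule nn_integral_cong_AE[OF AE])
    then show "integrable lam (\<lambda>s. enn2real (f s))"
      using f(2) fin by (intro integrableI_nonneg) (auto simp: less_top)
    show "x = density lam (\<lambda>s. ennreal (enn2real (f s)))"
      unfolding f(3) using f(2) AE by (intro density_cong) (auto simp: eq_commute)
  qed simp
qed

lemma fin_dens_sets: "x \<in> fin_dens lam \<Longrightarrow> sets x = sets lam"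
  by (auto simp: fin_dens_def)

lemma fin_dens_space: "x \<in> fin_dens lam \<Longrightarrow> space x = space lam"
  by (auto simp: fin_dens_def)

lemma fin_dens_finite: "x \<in> fin_dens lam \<Longrightarrow> finite_measure x"
  by (auto simp: fin_dens_def)

lemma prob_dens_prob_space: "x \<in> prob_dens lam \<Longrightarrow> prob_space x"
  by (auto simp: prob_dens_def)

lemma prob_dens_prob_algebra: "x \<in> prob_dens lam \<Longrightarrow> x \<in> space (prob_algebra lam)"
  by (auto simp: prob_dens_def space_prob_algebra)

lemma prob_dens_iff: "x \<in> prob_dens lam \<longleftrightarrow> x \<in> fin_dens lam \<and> prob_space x"
  by (auto simp: prob_dens_def fin_dens_def prob_space_def)

lemma measure_density_real:
  assumes f: "integrable lam f" "\<And>s. 0 \<le> f s" and F: "F \<in> sets lam"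
  shows "measure (density lam (\<lambda>s. ennreal (f s))) F = (\<integral>s. indicator F s * f s \<partial>lam)"
proof -
  have "emeasure (density lam (\<lambda>s. ennreal (f s))) F = (\<integral>\<^sup>+s. ennreal (indicator F s * f s) \<partial>lam)"
    using f F by (subst emeasure_density) (auto intro!: nn_integral_cong simp: indicator_def)
  also have "\<dots> = ennreal (\<integral>s. indicator F s * f s \<partial>lam)"
    using f integrable_mult_indicator[OF F f(1)] by (intro nn_integral_eq_integral) auto
  finally show ?thesis using f by (simp add: measure_def integral_nonneg_AE)
qed

lemma measure_diff_le_tv_dist:
  assumes "finite_measure x" "finite_measure y" "sets x = sets y" "F \<in> sets x"
  shows "\<bar>measure x F - measure y F\<bar> \<le> tv_dist x y"
proof -
  have bdd: "bdd_above ((\<lambda>F. measure \<mu> F - measure \<nu> F) ` sets x)" if "finite_measure \<mu>" for \<mu> \<nu> :: "'a measure"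
  proof (rule bdd_aboveI2)
    fix F show "measure \<mu> F - measure \<nu> F \<le> measure \<mu> (space \<mu>)"
      using finite_measure.bounded_measure[OF that, of F] measure_nonneg[of \<nu> F] by linarith
  qed
  have up: "measure x F - measure y F \<le> (SUP F\<in>sets x. measure x F - measure y F)"
    "measure y F - measure x F \<le> (SUP F\<in>sets x. measure y F - measure x F)" if "F \<in> sets x" for F
    using that by (auto intro!: cSUP_upper bdd assms)
  show ?thesis
    using up[OF assms(4)] up[of "{}"] assms by (auto simp: tv_dist_def abs_le_iff)
qed

lemma tv_dist_le_twice:
  assumes "\<And>F. F \<in> sets x \<Longrightarrow> \<bar>measure x F - measure y F\<bar> \<le> e" "0 \<le> e"
  shows "tv_dist x y \<le> 2 * e"
proof -
  have ne: "sets x \<noteq> {}" using sets.top by blast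
  have "(SUP F\<in>sets x. measure x F - measure y F) \<le> e" "(SUP F\<in>sets x. measure y F - measure x F) \<le> e"
    using assms(1) by (auto intro!: cSUP_least ne simp: abs_le_iff)
  then show ?thesis unfolding tv_dist_def using assms(2) by (auto split: if_splits)
qed

text \<open>
  The supremum of \<open>\<integral>\<^sub>F (f - g)\<close> over \<open>F\<close> is attained at the set where \<open>f > g\<close>.
\<close>

lemma tv_dist_density:
  assumes f: "integrable lam f" "\<And>s. 0 \<le> f s" and g: "integrable lam g" "\<And>s. 0 \<le> g s"
  shows "tv_dist (density lam (\<lambda>s. ennreal (f s))) (density lam (\<lambda>s. ennreal (g s))) = (\<integral>s. \<bar>f s - g s\<bar> \<partial>lam)"
proof -
  let ?x = "\<lambda>f. density lam (\<lambda>s. ennreal (f s))"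
  have fin: "finite_measure (?x f)" if "integrable lam f" "\<And>s. 0 \<le> f s" for f :: "'a \<Rightarrow> real"
    using fin_dens_finite[OF density_in_fin_dens[of "\<lambda>s. ennreal (f s)" lam]] that
    by (simp add: nn_integral_eq_integral)
  have sup: "(SUP F\<in>sets lam. measure (?x f) F - measure (?x g) F) = (\<integral>s. max 0 (f s - g s) \<partial>lam)"
    if f: "integrable lam f" "\<And>s. 0 \<le> f s" and g: "integrable lam g" "\<And>s. 0 \<le> g s" for f g :: "'a \<Rightarrow> real"
  proof -
    have eq: "measure (?x f) F - measure (?x g) F = (\<integral>s. indicator F s * (f s - g s) \<partial>lam)"
      and int: "integrable lam (\<lambda>s. indicator F s * (f s - g s))" if "F \<in> sets lam" for F
      using integrable_real_mult_indicator[OF that f(1)] integrable_real_mult_indicator[OF that g(1)]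
      by (simp_all add: measure_density_real[OF f that] measure_density_real[OF g that] right_diff_distrib mult.commute)
    have intm: "integrable lam (\<lambda>s. max 0 (f s - g s))" using f g by (intro integrable_max) auto
    define P where "P = {s \<in> space lam. g s < f s}"
    have P: "P \<in> sets lam" unfolding P_def using f g by (intro borel_measurable_less) auto
    show ?thesis
    proof (rule cSup_eq_maximum)
      have "(\<integral>s. max 0 (f s - g s) \<partial>lam) = (\<integral>s. indicator P s * (f s - g s) \<partial>lam)"
        by (rule Bochner_Integration.integral_cong) (auto simp: P_def indicator_def)
      then show "(\<integral>s. max 0 (f s - g s) \<partial>lam) \<in> (\<lambda>F. measure (?x f) F - measure (?x g) F) ` sets lam"
        using eq[OF P] P by (intro image_eqI[of _ _ P]) simp_all
      fix r assume "r \<in> (\<lambda>F. measure (?x f) F - measure (?x g) F) ` sets lam"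
      then obtain F where F: "F \<in> sets lam" "r = (\<integral>s. indicator F s * (f s - g s) \<partial>lam)" using eq by auto
      show "r \<le> (\<integral>s. max 0 (f s - g s) \<partial>lam)"
        unfolding F(2) by (intro integral_mono int F intm) (auto simp: indicator_def)
    qed
  qed
  have "(\<integral>s. max 0 (f s - g s) \<partial>lam) + (\<integral>s. max 0 (g s - f s) \<partial>lam) = (\<integral>s. \<bar>f s - g s\<bar> \<partial>lam)"
  proof -
    have "integrable lam (\<lambda>s. max 0 (f s - g s))" "integrable lam (\<lambda>s. max 0 (g s - f s))"
      using f g by (auto intro!: integrable_max)
    then have "(\<integral>s. max 0 (f s - g s) \<partial>lam) + (\<integral>s. max 0 (g s - f s) \<partial>lam)
        = (\<integral>s. max 0 (f s - g s) + max 0 (g s - f s) \<partial>lam)"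
      by (rule Bochner_Integration.integral_add[symmetric])
    also have "\<dots> = (\<integral>s. \<bar>f s - g s\<bar> \<partial>lam)"
      by (rule Bochner_Integration.integral_cong) auto
    finally show ?thesis .
  qed
  then show ?thesis
    using sup[OF f g] sup[OF g f] fin[OF f] fin[OF g] by (simp add: tv_dist_def)
qed

text \<open>
  The distance of two extended nonnegative numbers; subtraction truncates at 0, so at most one of the
  summands is positive. It avoids passing to real densities, which are finite only almost everywhere.
\<close>

definition absdiff :: "ennreal \<Rightarrow> ennreal \<Rightarrow> ennreal" where
  "absdiff a b = (a - b) + (b - a)"

lemma absdiff_measurable [measurable]:
  "f \<in> borel_measurable N \<Longrightarrow> g \<in> borel_measurable N \<Longrightarrow> (\<lambda>x. absdiff (f x) (g x)) \<in> borel_measurable N"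
  unfolding absdiff_def by (intro borel_measurable_add borel_measurable_minus_ennreal)

lemma le_absdiff: "a \<le> b + absdiff a b" "b \<le> a + absdiff a b"
  unfolding absdiff_def
  by (metis add.assoc add.commute add_increasing2 diff_add_self_ennreal le_cases le_iff_add zero_le)+

lemma absdiff_ennreal: "0 \<le> a \<Longrightarrow> 0 \<le> b \<Longrightarrow> absdiff (ennreal a) (ennreal b) = ennreal \<bar>a - b\<bar>"
  unfolding absdiff_def by (cases "a \<le> b") (auto simp: ennreal_minus ennreal_neg)

lemma absdiff_le: assumes "a \<le> b + e" "b \<le> a + e" "a \<noteq> \<top>" shows "absdiff a b \<le> e"
  unfolding absdiff_def
proof (cases "a \<le> b")
  case True
  then show "a - b + (b - a) \<le> e"
    using assms by (simp add: diff_eq_0_ennreal less_top[symmetric] top.not_eq_extremum[symmetric] ennreal_minus_le_iff)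
next
  case False
  then have "b \<le> a" by simp
  moreover from this have "b < \<top>" using assms(3) by (simp add: less_top le_less_trans)
  ultimately show "a - b + (b - a) \<le> e"
    using assms by (simp add: diff_eq_0_ennreal ennreal_minus_le_iff)
qed

lemma tv_dist_density_nn:
  assumes f: "f \<in> borel_measurable lam" "(\<integral>\<^sup>+t. f t \<partial>lam) \<noteq> \<infinity>"
    and g: "g \<in> borel_measurable lam" "(\<integral>\<^sup>+t. g t \<partial>lam) \<noteq> \<infinity>"
  shows "ennreal (tv_dist (density lam f) (density lam g)) = (\<integral>\<^sup>+t. absdiff (f t) (g t) \<partial>lam)"
proof -
  let ?r = "\<lambda>f t. enn2real (f t)"
  have AE: "AE s in lam. ennreal (?r f s) = f s" if "f \<in> borel_measurable lam" "(\<integral>\<^sup>+t. f t \<partial>lam) \<noteq> \<infinity>" for f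
    using nn_integral_noteq_infinite[OF that] by eventually_elim (simp add: top.not_eq_extremum)
  have int: "integrable lam (?r f)" if "f \<in> borel_measurable lam" "(\<integral>\<^sup>+t. f t \<partial>lam) \<noteq> \<infinity>" for f
    using that nn_integral_cong_AE[OF AE[OF that]] by (intro integrableI_nonneg) (auto simp: less_top)
  have dens: "density lam f = density lam (\<lambda>s. ennreal (?r f s))"
    if "f \<in> borel_measurable lam" "(\<integral>\<^sup>+t. f t \<partial>lam) \<noteq> \<infinity>" for f
    using that(1) AE[OF that] by (intro density_cong) (auto simp: eq_commute)
  have "ennreal (tv_dist (density lam f) (density lam g)) = ennreal (\<integral>s. \<bar>?r f s - ?r g s\<bar> \<partial>lam)"
    unfolding dens[OF f] dens[OF g] by (simp only: tv_dist_density[OF int[OF f] enn2real_nonneg int[OF g] enn2real_nonneg])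
  also have "\<dots> = (\<integral>\<^sup>+s. ennreal \<bar>?r f s - ?r g s\<bar> \<partial>lam)"
    using int[OF f] int[OF g] by (intro nn_integral_eq_integral[symmetric]) auto
  also have "\<dots> = (\<integral>\<^sup>+t. absdiff (f t) (g t) \<partial>lam)"
  proof (rule nn_integral_cong_AE)
    show "AE s in lam. ennreal \<bar>?r f s - ?r g s\<bar> = absdiff (f s) (g s)"
      using AE[OF f] AE[OF g]
    proof eventually_elim
      case (elim s)
      then show ?case using absdiff_ennreal[of "?r f s" "?r g s"] by simp
    qed
  qed
  finally show ?thesis .
qed

lemma tv_dist_prob_le_2:
  assumes "prob_space x" "prob_space y"
  shows "tv_dist x y \<le> 2"
proof -
  interpret x: prob_space x by fact
  interpret y: prob_space y by fact
  have "\<bar>x.prob F - y.prob F\<bar> \<le> 1" for F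
    using x.prob_le_1[of F] y.prob_le_1[of F] measure_nonneg[of x F] measure_nonneg[of y F] by linarith
  then show ?thesis using tv_dist_le_twice[of x y 1] by simp
qed

lemma tv_dist_nonneg: "0 \<le> tv_dist x y"
  by (rule Metric_space.nonneg[OF Metric_space_fin_dens])

lemma tv_dist_commute: "tv_dist x y = tv_dist y x"
  by (rule Metric_space.commute[OF Metric_space_fin_dens])

lemma Radon_Nikodym_fin_dens:
  assumes "sigma_finite_measure lam" "finite_measure x" "sets x = sets lam" "absolutely_continuous lam x"
  shows "x \<in> fin_dens lam"
  using sigma_finite_measure.Radon_Nikodym[OF assms(1,4,3)] assms(2) by (force simp: fin_dens_def)

text \<open>
  A null set of \<open>lam\<close> is a null set of all the \<open>x n\<close>, hence of their limit, which has a density by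
  Radon-Nikodym.
\<close>

lemma tv_limit_in_prob_dens:
  assumes "sigma_finite_measure lam" and x: "\<And>n. x n \<in> prob_dens lam"
    and y: "prob_space y" "sets y = sets lam"
    and lim: "\<And>F. F \<in> sets lam \<Longrightarrow> (\<lambda>n. measure (x n) F) \<longlonglongrightarrow> measure y F"
  shows "y \<in> prob_dens lam"
proof -
  interpret y: prob_space y by fact
  have "absolutely_continuous lam y"
    unfolding absolutely_continuous_def
  proof
    fix N assume N: "N \<in> null_sets lam"
    have "measure (x n) N = 0" for n
    proof -
      obtain f where f: "f \<in> borel_measurable lam" "x n = density lam f" using x[of n] by (auto simp: prob_dens_def)
      then have "N \<in> null_sets (x n)" using N by (auto intro: absolutely_continuousI_density[THEN absolutely_continuousD] simp: absolutely_continuousI_density[unfolded absolutely_continuous_def, THEN subsetD])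
      then show ?thesis by (rule measure_eq_0_null_sets)
    qed
    then have "measure y N = 0" using lim[of N] N LIMSEQ_unique[of "\<lambda>_. 0::real" "measure y N" 0] by auto
    then show "N \<in> null_sets y" using N y by (auto simp: null_sets_def y.emeasure_eq_measure)
  qed
  then have "y \<in> fin_dens lam"
    by (intro Radon_Nikodym_fin_dens[OF assms(1) _ y(2)] y.finite_measure_axioms)
  then show ?thesis using y by (simp add: prob_dens_iff)
qed

text \<open>
  A Cauchy sequence converges setwise, uniformly over all measurable sets. Uniformity makes the limit
  continuous at the empty set, hence countably additive.
\<close>

lemma mcomplete_prob_dens:
  assumes sf: "sigma_finite_measure lam"
  shows "Metric_space.mcomplete (prob_dens lam) tv_dist"
proof -
  interpret K: Metric_space "prob_dens lam" tv_dist by (rule Metric_space_prob_dens)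
  show ?thesis unfolding K.mcomplete_def
  proof (intro allI impI)
    fix \<sigma> assume C: "K.MCauchy \<sigma>"
    have K: "\<sigma> n \<in> prob_dens lam" for n using C by (auto simp: K.MCauchy_def)
    have ps: "prob_space (\<sigma> n)" and s: "sets (\<sigma> n) = sets lam" for n
      using K[of n] by (auto simp: prob_dens_def)
    have fm: "finite_measure (\<sigma> n)" for n using ps[of n] by (simp add: prob_space_def)
    have sp: "space (\<sigma> n) = space lam" for n using s sets_eq_imp_space_eq by blast
    have unif: "\<exists>N. \<forall>n\<ge>N. \<forall>m\<ge>N. \<forall>F\<in>sets lam. \<bar>measure (\<sigma> n) F - measure (\<sigma> m) F\<bar> \<le> e" if "e > 0" for e
    proof -
      obtain N where N: "\<And>n m. N \<le> n \<Longrightarrow> N \<le> m \<Longrightarrow> tv_dist (\<sigma> n) (\<sigma> m) < e"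
        using C[unfolded K.MCauchy_def, THEN conjunct2, rule_format, OF \<open>0 < e\<close>] by auto
      have "\<bar>measure (\<sigma> n) F - measure (\<sigma> m) F\<bar> \<le> e" if "N \<le> n" "N \<le> m" "F \<in> sets lam" for n m F
        using measure_diff_le_tv_dist[OF fm fm, of n m F] s that N[OF that(1,2)] by simp
      then show ?thesis by blast
    qed
    have conv: "convergent (\<lambda>n. measure (\<sigma> n) F)" if F: "F \<in> sets lam" for F
    proof -
      have "Cauchy (\<lambda>n. measure (\<sigma> n) F)"
      proof (rule CauchyI)
        fix e :: real assume "0 < e"
        then obtain N where "\<forall>n\<ge>N. \<forall>m\<ge>N. \<forall>F\<in>sets lam. \<bar>measure (\<sigma> n) F - measure (\<sigma> m) F\<bar> \<le> e / 2"
          using unif[of "e/2"] by auto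
        with F \<open>0 < e\<close> show "\<exists>N. \<forall>m\<ge>N. \<forall>n\<ge>N. norm (measure (\<sigma> m) F - measure (\<sigma> n) F) < e"
          by (intro exI[of _ N]) fastforce
      qed
      then show ?thesis by (rule Cauchy_convergent)
    qed
    define \<phi> where "\<phi> F = lim (\<lambda>n. measure (\<sigma> n) F)" for F
    have lim: "(\<lambda>n. measure (\<sigma> n) F) \<longlonglongrightarrow> \<phi> F" if "F \<in> sets lam" for F
      using conv[OF that] unfolding \<phi>_def by (simp add: convergent_LIMSEQ_iff)
    have \<phi>0: "0 \<le> \<phi> F" if "F \<in> sets lam" for F
      using LIMSEQ_le_const[OF lim[OF that], of 0] by auto
    have unif\<phi>: "\<exists>N. \<forall>n\<ge>N. \<forall>F\<in>sets lam. \<bar>measure (\<sigma> n) F - \<phi> F\<bar> \<le> e" if "e > 0" for e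
    proof -
      obtain N where N: "\<forall>n\<ge>N. \<forall>m\<ge>N. \<forall>F\<in>sets lam. \<bar>measure (\<sigma> n) F - measure (\<sigma> m) F\<bar> \<le> e"
        using unif[OF \<open>0 < e\<close>] by blast
      have "\<bar>measure (\<sigma> n) F - \<phi> F\<bar> \<le> e" if n: "n \<ge> N" and F: "F \<in> sets lam" for n F
      proof -
        have "(\<lambda>m. \<bar>measure (\<sigma> n) F - measure (\<sigma> m) F\<bar>) \<longlonglongrightarrow> \<bar>measure (\<sigma> n) F - \<phi> F\<bar>"
          by (intro tendsto_intros lim F)
        then show ?thesis by (rule LIMSEQ_le_const2) (use N n F in auto)
      qed
      then show ?thesis by blast
    qed
    define y where "y = measure_of (space lam) (sets lam) (\<lambda>F. ennreal (\<phi> F))"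
    have pos: "positive (sets lam) (\<lambda>F. ennreal (\<phi> F))"
      by (simp add: positive_def \<phi>_def)
    have add: "additive (sets lam) (\<lambda>F. ennreal (\<phi> F))"
      unfolding additive_def
    proof (intro ballI impI)
      fix A B assume AB: "A \<in> sets lam" "B \<in> sets lam" "A \<inter> B = {}"
      have "(\<lambda>n. measure (\<sigma> n) (A \<union> B)) \<longlonglongrightarrow> \<phi> A + \<phi> B"
        using tendsto_add[OF lim[OF AB(1)] lim[OF AB(2)]] AB finite_measure.finite_measure_Union[OF fm] s by simp
      then have "\<phi> (A \<union> B) = \<phi> A + \<phi> B" using lim[of "A \<union> B"] AB LIMSEQ_unique by blast
      then show "ennreal (\<phi> (A \<union> B)) = ennreal (\<phi> A) + ennreal (\<phi> B)" using \<phi>0 AB by simp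
    qed
    have ca: "countably_additive (sets lam) (\<lambda>F. ennreal (\<phi> F))"
    proof (rule sets.empty_continuous_imp_countably_additive[OF pos add])
      fix A :: "nat \<Rightarrow> _" assume A: "range A \<subseteq> sets lam" "decseq A" "(\<Inter>i. A i) = {}"
      have "(\<lambda>i. \<phi> (A i)) \<longlonglongrightarrow> 0"
      proof (rule LIMSEQ_I)
        fix r :: real assume "0 < r"
        then obtain N where N: "\<And>F. F \<in> sets lam \<Longrightarrow> \<bar>measure (\<sigma> N) F - \<phi> F\<bar> \<le> r / 2" using unif\<phi>[of "r/2"] by auto
        have "(\<lambda>i. measure (\<sigma> N) (A i)) \<longlonglongrightarrow> measure (\<sigma> N) (\<Inter>i. A i)"
          using A s by (intro finite_measure.finite_Lim_measure_decseq[OF fm]) auto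
        then have "(\<lambda>i. measure (\<sigma> N) (A i)) \<longlonglongrightarrow> 0" using A(3) by simp
        then obtain no where no: "\<And>i. i \<ge> no \<Longrightarrow> norm (measure (\<sigma> N) (A i) - 0) < r / 2"
          using LIMSEQ_D[of _ 0 "r/2"] \<open>0 < r\<close> by (metis half_gt_zero)
        have "norm (\<phi> (A i) - 0) < r" if "i \<ge> no" for i
        proof -
          have "A i \<in> sets lam" using A by auto
          then show ?thesis using no[OF that] N[of "A i"] \<phi>0[of "A i"] by (simp add: abs_if split: if_splits)
        qed
        then show "\<exists>no. \<forall>n\<ge>no. norm (\<phi> (A n) - 0) < r" by blast
      qed
      then show "(\<lambda>i. ennreal (\<phi> (A i))) \<longlonglongrightarrow> 0" using tendsto_ennrealI by fastforce
    qed simp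
    have y: "sets y = sets lam" "space y = space lam"
      by (simp_all add: y_def space_measure_of_conv)
    have em: "emeasure y F = ennreal (\<phi> F)" if "F \<in> sets lam" for F
      unfolding y_def by (rule emeasure_measure_of_sigma) (use pos ca that sets.sigma_algebra_axioms in auto)
    have my: "measure y F = \<phi> F" if "F \<in> sets lam" for F
      using em[OF that] \<phi>0[OF that] by (simp add: measure_def)
    have "\<phi> (space lam) = 1"
      using lim[of "space lam"] prob_space.prob_space[OF ps] sp LIMSEQ_unique[OF _ tendsto_const] by fastforce
    then have psy: "prob_space y" using em[of "space lam"] y by (intro prob_spaceI) simp
    have yK: "y \<in> prob_dens lam"
      by (rule tv_limit_in_prob_dens[where x=\<sigma>, OF sf K psy y(1)]) (simp add: my lim)
    have "limitin K.mtopology \<sigma> y sequentially"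
      unfolding K.limit_metric_sequentially
    proof (intro conjI yK allI impI)
      fix e :: real assume "0 < e"
      then obtain N where N: "\<forall>n\<ge>N. \<forall>F\<in>sets lam. \<bar>measure (\<sigma> n) F - \<phi> F\<bar> \<le> e / 3" using unif\<phi>[of "e/3"] by auto
      have "tv_dist (\<sigma> n) y < e" if "n \<ge> N" for n
        using tv_dist_le_twice[of "\<sigma> n" y "e/3"] N that my s \<open>0 < e\<close> by auto
      then show "\<exists>N. \<forall>n\<ge>N. \<sigma> n \<in> prob_dens lam \<and> tv_dist (\<sigma> n) y < e" using K by blast
    qed
    then show "\<exists>x. limitin K.mtopology \<sigma> x sequentially" by blast
  qed
qed

section \<open>Positively homogeneous Lipschitz functions\<close>

text \<open>
  Positive homogeneity is what removes the normalisation from the filter: the mass of \<open>x\<close> times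
  \<open>U\<close> at the normalised measure is \<open>U x\<close>.
\<close>

definition homlip :: "'s measure \<Rightarrow> real \<Rightarrow> ('s measure \<Rightarrow> real) \<Rightarrow> bool" where
  "homlip lam c U \<longleftrightarrow> lipschitz (fin_dens lam) tv_dist c U \<and>
     (\<forall>x\<in>fin_dens lam. \<forall>r\<ge>0. U (scale_measure (ennreal r) x) = r * U x)"

definition mass :: "'s measure \<Rightarrow> real" where "mass x = measure x (space x)"

definition normalized :: "'s measure \<Rightarrow> 's measure" where
  "normalized x = scale_measure (1 / total_mass x) x"

definition hom_ext :: "('s measure \<Rightarrow> real) \<Rightarrow> 's measure \<Rightarrow> real" where
  "hom_ext u x = (if mass x = 0 then 0 else mass x * u (normalized x))"

lemma scale_density:
  assumes "f \<in> borel_measurable lam"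
  shows "scale_measure c (density lam f) = density lam (\<lambda>s. c * f s)"
  using assms by (intro measure_eqI) (auto simp: emeasure_density nn_integral_cmult mult.assoc)

lemma scale_density_real:
  assumes "f \<in> borel_measurable lam" "0 \<le> r" "\<And>s. 0 \<le> f s"
  shows "scale_measure (ennreal r) (density lam (\<lambda>s. ennreal (f s))) = density lam (\<lambda>s. ennreal (r * f s))"
  using assms by (subst scale_density) (auto simp: ennreal_mult)

lemma mass_density_real:
  assumes f: "integrable lam f" "\<And>s. 0 \<le> f s"
  shows "mass (density lam (\<lambda>s. ennreal (f s))) = (\<integral>s. f s \<partial>lam)"
  unfolding mass_def space_density using measure_density_real[OF f sets.top]
  by (simp cong: Bochner_Integration.integral_cong)

lemma total_mass_eq: "x \<in> fin_dens lam \<Longrightarrow> total_mass x = ennreal (mass x)"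
  by (simp add: total_mass_def mass_def finite_measure.emeasure_eq_measure[OF fin_dens_finite])

lemma mass_nonneg: "0 \<le> mass x" by (simp add: mass_def)

lemma mass_prob: "x \<in> prob_dens lam \<Longrightarrow> mass x = 1"
  by (simp add: mass_def prob_space.prob_space prob_dens_prob_space)

lemma scale_in_fin_dens:
  assumes "x \<in> fin_dens lam" "0 \<le> r" shows "scale_measure (ennreal r) x \<in> fin_dens lam"
proof -
  obtain f where f: "integrable lam f" "\<And>s. 0 \<le> f s" "x = density lam (\<lambda>s. ennreal (f s))"
    using fin_densE[OF assms(1)] by blast
  have "(\<integral>\<^sup>+s. ennreal (r * f s) \<partial>lam) = ennreal (\<integral>s. r * f s \<partial>lam)"
    using f assms by (intro nn_integral_eq_integral) auto
  then show ?thesis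
    using f assms by (simp add: scale_density_real density_in_fin_dens)
qed

lemma mass_scale: "0 \<le> r \<Longrightarrow> mass (scale_measure (ennreal r) x) = r * mass x"
  by (simp add: mass_def measure_scale_measure space_scale_measure)

lemma normalized_eq:
  assumes "x \<in> fin_dens lam" "0 < mass x"
  shows "normalized x = scale_measure (ennreal (1 / mass x)) x"
  using assms by (simp add: normalized_def total_mass_eq divide_ennreal[symmetric] ennreal_1[symmetric] del: ennreal_1)

lemma normalized_in_prob_dens:
  assumes "x \<in> fin_dens lam" "0 < mass x" shows "normalized x \<in> prob_dens lam"
proof -
  have f: "normalized x \<in> fin_dens lam"
    using assms scale_in_fin_dens[OF assms(1), of "1 / mass x"] by (simp add: normalized_eq)
  moreover have "mass (normalized x) = 1"
    using assms by (simp add: normalized_eq[OF assms] mass_scale)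
  ultimately have "prob_space (normalized x)"
    using total_mass_eq[OF f] by (intro prob_spaceI) (simp add: total_mass_def)
  with f show ?thesis by (simp add: prob_dens_iff)
qed

lemma mass_zero_scale:
  assumes "x \<in> fin_dens lam" "mass x = 0" shows "scale_measure (ennreal 0) x = x"
proof (rule measure_eqI)
  fix A assume "A \<in> sets (scale_measure (ennreal 0) x)"
  have "emeasure x A \<le> emeasure x (space x)" by (rule emeasure_space)
  also have "\<dots> = 0" using total_mass_eq[OF assms(1)] assms(2) by (simp add: total_mass_def)
  finally show "emeasure (scale_measure (ennreal 0) x) A = emeasure x A" by simp
qed simp

lemma homlip_mass_zero:
  assumes "homlip lam c U" "x \<in> fin_dens lam" "mass x = 0" shows "U x = 0"
proof -
  have "U (scale_measure (ennreal 0) x) = 0 * U x"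
    using assms unfolding homlip_def by blast
  then show ?thesis unfolding mass_zero_scale[OF assms(2,3)] by simp
qed

lemma homlip_normalized:
  assumes "homlip lam c U" "x \<in> fin_dens lam" "0 < mass x" shows "mass x * U (normalized x) = U x"
proof -
  have "U (scale_measure (ennreal (1 / mass x)) x) = 1 / mass x * U x"
    using assms unfolding homlip_def by (metis less_eq_real_def zero_le_divide_1_iff)
  then show ?thesis using assms by (simp add: normalized_eq[OF assms(2,3)])
qed

lemma tv_dist_scale_self:
  assumes "x \<in> fin_dens lam" "0 \<le> r" shows "tv_dist (scale_measure (ennreal r) x) x = \<bar>1 - r\<bar> * mass x"
proof -
  obtain f where f: "integrable lam f" "\<And>s. 0 \<le> f s" "x = density lam (\<lambda>s. ennreal (f s))"
    using fin_densE[OF assms(1)] by blast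
  have "tv_dist (scale_measure (ennreal r) x) x = (\<integral>s. \<bar>r * f s - f s\<bar> \<partial>lam)"
    using f assms by (simp add: scale_density_real) (subst tv_dist_density, auto)
  also have "\<dots> = (\<integral>s. \<bar>1 - r\<bar> * f s \<partial>lam)"
  proof (rule Bochner_Integration.integral_cong[OF refl])
    fix s
    have "r * f s - f s = (r - 1) * f s" by (simp add: algebra_simps)
    then show "\<bar>r * f s - f s\<bar> = \<bar>1 - r\<bar> * f s" using f(2)[of s] by (simp add: abs_mult abs_minus_commute)
  qed
  finally show ?thesis using f by (simp add: mass_density_real)
qed

lemma homlip_bound:
  assumes "homlip lam c U" "x \<in> fin_dens lam" shows "\<bar>U x\<bar> \<le> c * mass x"
proof -
  let ?z = "scale_measure (ennreal 0) x"
  have "?z \<in> fin_dens lam" by (rule scale_in_fin_dens[OF assms(2)]) simp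
  then have "\<bar>U ?z - U x\<bar> \<le> c * tv_dist ?z x" using assms by (simp add: homlip_def lipschitz_def)
  moreover have "U ?z = 0 * U x" using assms unfolding homlip_def by blast
  moreover have "tv_dist ?z x = mass x" using tv_dist_scale_self[OF assms(2), of 0] by simp
  ultimately show ?thesis by simp
qed

lemma tv_dist_scale_both:
  assumes "x \<in> fin_dens lam" "y \<in> fin_dens lam" "0 \<le> r"
  shows "tv_dist (scale_measure (ennreal r) x) (scale_measure (ennreal r) y) = r * tv_dist x y"
proof -
  obtain f where f: "integrable lam f" "\<And>s. 0 \<le> f s" "x = density lam (\<lambda>s. ennreal (f s))"
    using fin_densE[OF assms(1)] by blast
  obtain g where g: "integrable lam g" "\<And>s. 0 \<le> g s" "y = density lam (\<lambda>s. ennreal (g s))"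
    using fin_densE[OF assms(2)] by blast
  have "tv_dist (scale_measure (ennreal r) x) (scale_measure (ennreal r) y) = (\<integral>s. \<bar>r * f s - r * g s\<bar> \<partial>lam)"
    using f g assms by (simp add: scale_density_real) (subst tv_dist_density, auto)
  also have "\<dots> = (\<integral>s. r * \<bar>f s - g s\<bar> \<partial>lam)"
    using assms(3) by (intro Bochner_Integration.integral_cong) (simp_all add: abs_mult flip: right_diff_distrib)
  finally show ?thesis using f g by (simp add: tv_dist_density)
qed

lemma mass_diff_le: "x \<in> fin_dens lam \<Longrightarrow> y \<in> fin_dens lam \<Longrightarrow> \<bar>mass x - mass y\<bar> \<le> tv_dist x y"
  using measure_diff_le_tv_dist[of x y "space lam"]
  by (simp add: mass_def fin_dens_finite fin_dens_sets fin_dens_space)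

lemma homlip_mass: "homlip lam 1 mass"
  unfolding homlip_def lipschitz_def using mass_diff_le mass_scale by auto

text \<open>
  The constant 4 comes from writing, for masses \<open>a\<close>, \<open>b\<close> and normalisations \<open>x'\<close>, \<open>y'\<close>,
  \<open>a u(x') - b u(y') = (a - b) u(x') + b (u(x') - u(y'))\<close>: the first summand is at most \<open>2 |a - b|\<close>, and
  \<open>b x'\<close> and \<open>b y' = y\<close> have distance at most \<open>|a - b|\<close> plus the distance of \<open>x\<close> and \<open>y\<close>.
\<close>

lemma homlip_hom_ext:
  assumes u: "lipschitz (prob_dens lam) tv_dist 1 u" "\<And>x. x \<in> prob_dens lam \<Longrightarrow> \<bar>u x\<bar> \<le> 2"
  shows "homlip lam 4 (hom_ext u)"
proof -
  interpret F: Metric_space "fin_dens lam" tv_dist by (rule Metric_space_fin_dens)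
  have bound: "\<bar>hom_ext u x\<bar> \<le> 2 * mass x" if "x \<in> fin_dens lam" for x
  proof (cases "mass x = 0")
    case False
    then have "0 < mass x" using mass_nonneg[of x] by simp
    then have "mass x * \<bar>u (normalized x)\<bar> \<le> mass x * 2"
      using u(2)[OF normalized_in_prob_dens[OF that]] by (intro mult_left_mono) auto
    then show ?thesis using False \<open>0 < mass x\<close> by (simp add: hom_ext_def abs_mult)
  qed (simp add: hom_ext_def)
  have tvz: "mass x \<le> tv_dist x y" "mass x \<le> tv_dist y x"
    if "x \<in> fin_dens lam" "y \<in> fin_dens lam" "mass y = 0" for x y
    using mass_diff_le[OF that(1,2)] that(3) mass_nonneg[of x] F.commute[of x y] by auto
  have "\<bar>hom_ext u x - hom_ext u y\<bar> \<le> 4 * tv_dist x y" if xy: "x \<in> fin_dens lam" "y \<in> fin_dens lam" for x y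
  proof (cases "mass x = 0 \<or> mass y = 0")
    case True
    then show ?thesis
    proof
      assume "mass x = 0"
      then show ?thesis using bound[OF xy(2)] tvz(2)[OF xy(2,1)] F.nonneg[of x y] by (simp add: hom_ext_def[of _ x])
    next
      assume "mass y = 0"
      then show ?thesis using bound[OF xy(1)] tvz(1)[OF xy] F.nonneg[of x y] by (simp add: hom_ext_def[of _ y])
    qed
  next
    case False
    define a b where "a = mass x" and "b = mass y"
    have pos: "0 < a" "0 < b" using False mass_nonneg[of x] mass_nonneg[of y] by (auto simp: a_def b_def)
    let ?n = normalized
    have nx: "?n x \<in> prob_dens lam" and ny: "?n y \<in> prob_dens lam"
      using normalized_in_prob_dens xy pos by (auto simp: a_def b_def)
    have "b * tv_dist (?n x) (?n y) \<le> 2 * tv_dist x y"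
    proof -
      let ?s = "\<lambda>r. scale_measure (ennreal r)"
      have sx: "?s b (?n x) = ?s (b / a) x"
        using pos normalized_eq[OF xy(1)] by (simp add: a_def ennreal_mult[symmetric] mult.commute)
      have sy: "?s b (?n y) = y"
        using pos normalized_eq[OF xy(2)] by (simp add: b_def ennreal_mult[symmetric] mult.commute)
      have "b * tv_dist (?n x) (?n y) = tv_dist (?s b (?n x)) (?s b (?n y))"
        using tv_dist_scale_both[OF prob_dens_fin_dens[OF nx] prob_dens_fin_dens[OF ny], of b] pos by simp
      also have "\<dots> \<le> tv_dist (?s (b / a) x) x + tv_dist x y"
        unfolding sx sy using pos xy scale_in_fin_dens[OF xy(1), of "b/a"] by (intro F.triangle) auto
      also have "tv_dist (?s (b / a) x) x = \<bar>a - b\<bar>"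
        using pos tv_dist_scale_self[OF xy(1), of "b/a"] by (simp add: a_def abs_if field_simps)
      also have "\<bar>a - b\<bar> \<le> tv_dist x y" using mass_diff_le[OF xy] by (simp add: a_def b_def)
      finally show ?thesis by simp
    qed
    moreover have "\<bar>u (?n x) - u (?n y)\<bar> \<le> tv_dist (?n x) (?n y)"
      using u(1) nx ny by (simp add: lipschitz_def)
    then have "b * \<bar>u (?n x) - u (?n y)\<bar> \<le> b * tv_dist (?n x) (?n y)"
      using pos by (intro mult_left_mono) auto
    moreover have "\<bar>a - b\<bar> * \<bar>u (?n x)\<bar> \<le> tv_dist x y * 2"
      using mass_diff_le[OF xy] u(2)[OF nx] by (intro mult_mono) (auto simp: a_def b_def)
    moreover have "a * u (?n x) - b * u (?n y) = (a - b) * u (?n x) + b * (u (?n x) - u (?n y))"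
      by (simp add: algebra_simps)
    then have "\<bar>a * u (?n x) - b * u (?n y)\<bar> \<le> \<bar>a - b\<bar> * \<bar>u (?n x)\<bar> + b * \<bar>u (?n x) - u (?n y)\<bar>"
      using pos abs_triangle_ineq[of "(a - b) * u (?n x)" "b * (u (?n x) - u (?n y))"] by (simp add: abs_mult)
    ultimately show ?thesis using False by (simp add: hom_ext_def a_def b_def)
  qed
  moreover have "hom_ext u (scale_measure (ennreal r) x) = r * hom_ext u x" if x: "x \<in> fin_dens lam" and r: "0 \<le> r" for x r
  proof (cases "r = 0 \<or> mass x = 0")
    case True
    then show ?thesis using mass_scale[OF r, of x] by (auto simp: hom_ext_def)
  next
    case False
    then have pos: "0 < r" "0 < mass x" using r mass_nonneg[of x] by auto
    have "normalized (scale_measure (ennreal r) x) = normalized x"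
      using pos mass_scale[OF r, of x] scale_in_fin_dens[OF x r] x
      by (simp add: normalized_eq[where lam=lam] ennreal_mult[symmetric])
    then show ?thesis using False mass_scale[OF r, of x] by (simp add: hom_ext_def)
  qed
  ultimately show ?thesis by (simp add: homlip_def lipschitz_def)
qed

lemma hom_ext_prob: "x \<in> prob_dens lam \<Longrightarrow> hom_ext u x = u x"
  using mass_prob[of x lam] normalized_eq[OF prob_dens_fin_dens[of x lam]]
  by (simp add: hom_ext_def)

section \<open>One step of the unnormalised filter\<close>

context hmm
begin

lemma space_lam [simp]: "space lam = UNIV"
  using sets_eq_imp_space_eq[OF sets_lam] by simp

lemma space_tau [simp]: "space \<tau> = UNIV"
  using sets_eq_imp_space_eq[OF sets_tau] by simp

declare sets_lam [measurable_cong] sets_tau [measurable_cong]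

lemma m_measurable [measurable (raw)]:
  assumes "f \<in> N \<rightarrow>\<^sub>M borel" "g \<in> N \<rightarrow>\<^sub>M borel" "h \<in> N \<rightarrow>\<^sub>M borel"
  shows "(\<lambda>x. m (f x) (g x) (h x)) \<in> borel_measurable N"
proof -
  have "(\<lambda>x. (f x, g x, h x)) \<in> N \<rightarrow>\<^sub>M borel \<Otimes>\<^sub>M borel \<Otimes>\<^sub>M borel" using assms by measurable
  from measurable_compose[OF this measurable_m] show ?thesis by simp
qed

abbreviation "upd \<equiv> obs_step lam m"
abbreviation "Tk \<equiv> trans_kernel lam \<tau> m"
abbreviation "FD \<equiv> fin_dens lam"
abbreviation "K \<equiv> prob_dens lam"
abbreviation "FS \<equiv> filter_space lam"

text \<open>
  The density of \<open>x M\<^sub>a\<close> with respect to \<open>lam\<close>.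
\<close>

definition upd_density :: "'s measure \<Rightarrow> 'a \<Rightarrow> 's \<Rightarrow> ennreal" where
  "upd_density x a t = (\<integral>\<^sup>+s. ennreal (m s t a) \<partial>x)"

lemma FD_sets: "x \<in> FD \<Longrightarrow> sets x = sets borel"
  by (simp add: fin_dens_sets sets_lam)

lemma FD_sigma_finite: "x \<in> FD \<Longrightarrow> sigma_finite_measure x"
  using fin_dens_finite by (auto simp: finite_measure_def)

lemma upd_density_measurable2:
  assumes "x \<in> FD" shows "(\<lambda>(t, a). upd_density x a t) \<in> borel_measurable (borel \<Otimes>\<^sub>M borel)"
proof -
  interpret x: sigma_finite_measure x by (rule FD_sigma_finite[OF assms])
  note [measurable_cong] = FD_sets[OF assms]
  show ?thesis unfolding upd_density_def by measurable
qed

lemma upd_density_measurable_comp: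
  assumes "x \<in> FD" "f \<in> N \<rightarrow>\<^sub>M borel" "g \<in> N \<rightarrow>\<^sub>M borel"
  shows "(\<lambda>z. upd_density x (g z) (f z)) \<in> borel_measurable N"
proof -
  have "(\<lambda>z. (f z, g z)) \<in> N \<rightarrow>\<^sub>M borel \<Otimes>\<^sub>M borel" using assms by measurable
  from measurable_compose[OF this upd_density_measurable2[OF assms(1)]] show ?thesis by simp
qed

lemma measurable_lam_iff: "f \<in> measurable lam N \<longleftrightarrow> f \<in> measurable borel N"
  using measurable_cong_sets[OF sets_lam refl] by blast

lemma upd_density_measurable: "x \<in> FD \<Longrightarrow> upd_density x a \<in> borel_measurable lam"
  unfolding measurable_lam_iff by (rule upd_density_measurable_comp[where f="\<lambda>t. t"]) auto

lemma upd_eq_density: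
  assumes x: "x \<in> FD" shows "upd x a = density lam (upd_density x a)"
proof -
  interpret x: sigma_finite_measure x by (rule FD_sigma_finite[OF x])
  interpret l: sigma_finite_measure lam by (rule sigma_finite_lam)
  interpret P: pair_sigma_finite lam x ..
  note [measurable_cong] = FD_sets[OF x]
  note [measurable] = upd_density_measurable[OF x]
  have eq: "(\<integral>\<^sup>+s. (\<integral>\<^sup>+t\<in>F. ennreal (m s t a) \<partial>lam) \<partial>x) = emeasure (density lam (upd_density x a)) F"
    if F[measurable]: "F \<in> sets lam" for F
  proof -
    have "(\<integral>\<^sup>+s. (\<integral>\<^sup>+t. ennreal (m s t a) * indicator F t \<partial>lam) \<partial>x)
        = (\<integral>\<^sup>+t. (\<integral>\<^sup>+s. ennreal (m s t a) * indicator F t \<partial>x) \<partial>lam)"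
      by (rule P.Fubini') measurable
    also have "\<dots> = (\<integral>\<^sup>+t. upd_density x a t * indicator F t \<partial>lam)"
      by (intro nn_integral_cong) (simp add: nn_integral_multc upd_density_def)
    finally show ?thesis by (simp add: emeasure_density)
  qed
  have "upd x a = measure_of (space lam) (sets lam) (emeasure (density lam (upd_density x a)))"
    unfolding obs_step_def
    by (rule measure_of_eq) (use sets.space_closed in \<open>auto simp: eq sets.sigma_sets_eq simp del: space_lam\<close>)
  also have "\<dots> = density lam (upd_density x a)"
    using measure_of_of_measure[of "density lam (upd_density x a)"] by simp
  finally show ?thesis .
qed

lemma trans_density_measurable2: "(\<lambda>(s, t). trans_density \<tau> m s t) \<in> borel_measurable (borel \<Otimes>\<^sub>M borel)"
proof -
  interpret t: sigma_finite_measure \<tau> by (rule sigma_finite_tau)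
  show ?thesis unfolding trans_density_def by measurable
qed

lemma trans_density_measurable [measurable (raw)]:
  assumes "f \<in> N \<rightarrow>\<^sub>M borel" "g \<in> N \<rightarrow>\<^sub>M borel"
  shows "(\<lambda>x. trans_density \<tau> m (f x) (g x)) \<in> borel_measurable N"
  using measurable_compose[OF _ trans_density_measurable2, of "\<lambda>x. (f x, g x)" N] assms by simp

lemma trans_density_integral: "(\<integral>\<^sup>+t. trans_density \<tau> m s t \<partial>lam) = 1"
  unfolding trans_density_def by (rule m_total)

lemma trans_kernel_in_K: "Tk s \<in> K"
  unfolding trans_kernel_def by (intro density_in_prob_dens trans_density_integral) measurable

lemma emeasure_trans_kernel:
  "F \<in> sets borel \<Longrightarrow> emeasure (Tk s) F = (\<integral>\<^sup>+t. trans_density \<tau> m s t * indicator F t \<partial>lam)"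
  unfolding trans_kernel_def by (subst emeasure_density) (auto simp: sets_lam)

lemma trans_kernel_measurable: "Tk \<in> lam \<rightarrow>\<^sub>M prob_algebra lam"
proof (rule measurable_prob_algebraI)
  interpret l: sigma_finite_measure lam by (rule sigma_finite_lam)
  show "prob_space (Tk s)" for s using prob_dens_prob_space[OF trans_kernel_in_K] .
  show "Tk \<in> lam \<rightarrow>\<^sub>M subprob_algebra lam"
  proof (rule measurable_subprob_algebra)
    show "subprob_space (Tk s)" for s
      using prob_dens_prob_space[OF trans_kernel_in_K] by (rule prob_space_imp_subprob_space)
    fix F assume "F \<in> sets lam"
    then have F[measurable]: "F \<in> sets borel" by (simp add: sets_lam)
    show "(\<lambda>s. emeasure (Tk s) F) \<in> borel_measurable lam"
      unfolding emeasure_trans_kernel[OF F] by measurable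
  qed (simp add: trans_kernel_def)
qed

sublocale S: markov_kernel lam Tk
  by unfold_locales (rule trans_kernel_measurable)

text \<open>
  Summing the unnormalised filters over all observations forgets the observation and leaves one step
  of the hidden chain.
\<close>

lemma integral_upd_emeasure:
  assumes x: "x \<in> FD" and F: "F \<in> sets borel"
  shows "(\<integral>\<^sup>+a. emeasure (upd x a) F \<partial>\<tau>) = (\<integral>\<^sup>+s. emeasure (Tk s) F \<partial>x)"
proof -
  interpret x: sigma_finite_measure x by (rule FD_sigma_finite[OF x])
  interpret l: sigma_finite_measure lam by (rule sigma_finite_lam)
  interpret t: sigma_finite_measure \<tau> by (rule sigma_finite_tau)
  interpret P: pair_sigma_finite lam x ..
  interpret Q: pair_sigma_finite lam \<tau> ..
  interpret R: pair_sigma_finite x \<tau> ..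
  note [measurable_cong] = FD_sets[OF x]
  note [measurable] = F
  have [measurable]: "(\<lambda>(t, a). upd_density x a t) \<in> borel_measurable (lam \<Otimes>\<^sub>M \<tau>)"
    unfolding case_prod_unfold by (rule upd_density_measurable_comp[OF x]) measurable
  have "(\<integral>\<^sup>+a. emeasure (upd x a) F \<partial>\<tau>) = (\<integral>\<^sup>+a. (\<integral>\<^sup>+t. upd_density x a t * indicator F t \<partial>lam) \<partial>\<tau>)"
    using F upd_density_measurable[OF x] by (intro nn_integral_cong) (simp add: upd_eq_density[OF x] emeasure_density sets_lam)
  also have "\<dots> = (\<integral>\<^sup>+t. (\<integral>\<^sup>+a. upd_density x a t * indicator F t \<partial>\<tau>) \<partial>lam)"
    by (rule Q.Fubini') measurable
  also have "\<dots> = (\<integral>\<^sup>+t. (\<integral>\<^sup>+a. upd_density x a t \<partial>\<tau>) * indicator F t \<partial>lam)"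
    by (intro nn_integral_cong nn_integral_multc upd_density_measurable_comp[OF x]) measurable
  also have "\<dots> = (\<integral>\<^sup>+t. (\<integral>\<^sup>+s. trans_density \<tau> m s t \<partial>x) * indicator F t \<partial>lam)"
  proof (intro nn_integral_cong arg_cong2[where f="(*)"] refl)
    fix t
    show "(\<integral>\<^sup>+a. upd_density x a t \<partial>\<tau>) = (\<integral>\<^sup>+s. trans_density \<tau> m s t \<partial>x)"
      unfolding upd_density_def trans_density_def by (rule R.Fubini') measurable
  qed
  also have "\<dots> = (\<integral>\<^sup>+t. (\<integral>\<^sup>+s. trans_density \<tau> m s t * indicator F t \<partial>x) \<partial>lam)"
    by (intro nn_integral_cong nn_integral_multc[symmetric]) measurable
  also have "\<dots> = (\<integral>\<^sup>+s. (\<integral>\<^sup>+t. trans_density \<tau> m s t * indicator F t \<partial>lam) \<partial>x)"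
    by (rule P.Fubini'[symmetric]) measurable
  finally show ?thesis by (simp add: emeasure_trans_kernel[OF F])
qed

text \<open>
  With real densities \<open>f\<close> and \<open>g\<close> of \<open>x\<close> and \<open>y\<close>, the densities after the observation \<open>a\<close> differ at \<open>t\<close> by
  at most \<open>\<integral> |f s - g s| m(s, t, a) lam(ds)\<close>. Since \<open>m(s, \<cdot>, \<cdot>)\<close> has total mass 1, integrating over \<open>t\<close> and
  \<open>a\<close> leaves \<open>\<integral> |f - g|\<close>. The bound \<open>e\<close> serves as a measurable substitute for the distance as a function
  of \<open>a\<close>.
\<close>

lemma tv_upd_contract:
  assumes x: "x \<in> FD" and y: "y \<in> FD" and fin: "\<And>a. upd x a \<in> FD" "\<And>a. upd y a \<in> FD"
  obtains e where "e \<in> borel_measurable \<tau>" "\<And>a. ennreal (tv_dist (upd x a) (upd y a)) \<le> e a"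
    "(\<integral>\<^sup>+a. e a \<partial>\<tau>) = ennreal (tv_dist x y)"
proof -
  interpret l: sigma_finite_measure lam by (rule sigma_finite_lam)
  interpret t: sigma_finite_measure \<tau> by (rule sigma_finite_tau)
  interpret P: pair_sigma_finite lam lam ..
  interpret Q: pair_sigma_finite lam \<tau> ..
  obtain f where f: "integrable lam f" "\<And>s. 0 \<le> f s" "x = density lam (\<lambda>s. ennreal (f s))"
    using fin_densE[OF x] by blast
  obtain g where g: "integrable lam g" "\<And>s. 0 \<le> g s" "y = density lam (\<lambda>s. ennreal (g s))"
    using fin_densE[OF y] by blast
  have [measurable]: "f \<in> borel_measurable borel" "g \<in> borel_measurable borel"
    using borel_measurable_integrable[OF f(1)] borel_measurable_integrable[OF g(1)]
    by (simp_all add: measurable_lam_iff)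
  let ?d = "\<lambda>s. ennreal \<bar>f s - g s\<bar>"
  let ?e = "\<lambda>t a. \<integral>\<^sup>+s. ?d s * ennreal (m s t a) \<partial>lam"
  have pf: "upd_density x a t = (\<integral>\<^sup>+s. ennreal (f s) * ennreal (m s t a) \<partial>lam)"
    and pg: "upd_density y a t = (\<integral>\<^sup>+s. ennreal (g s) * ennreal (m s t a) \<partial>lam)" for a t
    unfolding upd_density_def f(3) g(3) by (subst nn_integral_density; simp)+
  have le: "(\<integral>\<^sup>+s. ennreal (h s) * ennreal (m s t a) \<partial>lam) \<le> (\<integral>\<^sup>+s. ennreal (k s) * ennreal (m s t a) \<partial>lam) + ?e t a"
    if hk: "(h = f \<and> k = g) \<or> (h = g \<and> k = f)" for h k a t
  proof -
    have [measurable]: "h \<in> borel_measurable borel" "k \<in> borel_measurable borel" using hk by auto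
    have "ennreal (h s) \<le> ennreal (k s) + ?d s" for s
      using hk f(2)[of s] g(2)[of s] by (auto simp flip: ennreal_plus intro!: ennreal_leI)
    then have "(\<integral>\<^sup>+s. ennreal (h s) * ennreal (m s t a) \<partial>lam) \<le> (\<integral>\<^sup>+s. ennreal (k s) * ennreal (m s t a) + ?d s * ennreal (m s t a) \<partial>lam)"
      by (intro nn_integral_mono) (simp add: mult_right_mono flip: distrib_right)
    also have "\<dots> = (\<integral>\<^sup>+s. ennreal (k s) * ennreal (m s t a) \<partial>lam) + ?e t a"
      by (rule nn_integral_add) measurable
    finally show ?thesis .
  qed
  have bound: "ennreal (tv_dist (upd x a) (upd y a)) \<le> (\<integral>\<^sup>+t. ?e t a \<partial>lam)" for a
  proof -
    have fin': "(\<integral>\<^sup>+t. upd_density z a t \<partial>lam) \<noteq> \<infinity>" and pm: "upd_density z a \<in> borel_measurable lam"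
      if "z \<in> FD" "upd z a \<in> FD" for z
    proof -
      show pm: "upd_density z a \<in> borel_measurable lam" by (rule upd_density_measurable[OF that(1)])
      have "emeasure (upd z a) UNIV = (\<integral>\<^sup>+t. upd_density z a t \<partial>lam)"
        using pm by (simp add: upd_eq_density[OF that(1)] emeasure_density)
      then show "(\<integral>\<^sup>+t. upd_density z a t \<partial>lam) \<noteq> \<infinity>"
        using finite_measure.emeasure_finite[OF fin_dens_finite[OF that(2)], of UNIV] by simp
    qed
    have "ennreal (tv_dist (upd x a) (upd y a)) = (\<integral>\<^sup>+t. absdiff (upd_density x a t) (upd_density y a t) \<partial>lam)"
      unfolding upd_eq_density[OF x] upd_eq_density[OF y]
      using x y fin by (intro tv_dist_density_nn fin' pm) auto
    also have "\<dots> \<le> (\<integral>\<^sup>+t. ?e t a \<partial>lam)"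
    proof (rule nn_integral_mono_AE)
      show "AE t in lam. absdiff (upd_density x a t) (upd_density y a t) \<le> ?e t a"
        using nn_integral_noteq_infinite[OF pm[OF x fin(1)] fin'[OF x fin(1)]]
      proof eventually_elim
        case (elim t)
        show ?case
          using le[of f g t a] le[of g f t a] elim by (intro absdiff_le) (auto simp flip: pf pg)
      qed
    qed
    finally show ?thesis .
  qed
  have "(\<integral>\<^sup>+a. (\<integral>\<^sup>+t. ?e t a \<partial>lam) \<partial>\<tau>) = (\<integral>\<^sup>+t. (\<integral>\<^sup>+a. ?e t a \<partial>\<tau>) \<partial>lam)"
    by (rule Q.Fubini') measurable
  also have "\<dots> = (\<integral>\<^sup>+t. (\<integral>\<^sup>+s. (\<integral>\<^sup>+a. ?d s * ennreal (m s t a) \<partial>\<tau>) \<partial>lam) \<partial>lam)"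
    by (intro nn_integral_cong Q.Fubini') measurable
  also have "\<dots> = (\<integral>\<^sup>+s. (\<integral>\<^sup>+t. (\<integral>\<^sup>+a. ?d s * ennreal (m s t a) \<partial>\<tau>) \<partial>lam) \<partial>lam)"
    by (rule P.Fubini') measurable
  also have "\<dots> = (\<integral>\<^sup>+s. ?d s * (\<integral>\<^sup>+t. trans_density \<tau> m s t \<partial>lam) \<partial>lam)"
    unfolding trans_density_def
    by (intro nn_integral_cong) (simp add: nn_integral_cmult)
  also have "\<dots> = ennreal (\<integral>s. \<bar>f s - g s\<bar> \<partial>lam)"
    using f g by (simp add: trans_density_integral nn_integral_eq_integral)
  also have "\<dots> = ennreal (tv_dist x y)"
    using f g by (simp add: tv_dist_density)
  finally show ?thesis
    by (intro that[of "\<lambda>a. \<integral>\<^sup>+t. ?e t a \<partial>lam"] bound) measurable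
qed

end

locale regular_model = hmm lam \<tau> m
  for lam :: "'s::polish_space measure" and \<tau> :: "'a::polish_space measure" and m +
  assumes regular: "regular_hmm lam m"
begin

sublocale FDm: Metric_space "fin_dens lam" tv_dist by (rule Metric_space_fin_dens)
sublocale Km: Metric_space "prob_dens lam" tv_dist by (rule Metric_space_prob_dens)

lemma continuous_upd:
  "continuous_map (prod_topology FDm.mtopology euclidean) FDm.mtopology (\<lambda>(x, a). upd x a)"
  using regular by (simp add: regular_hmm_def)

text \<open>
  Regularity says in particular that \<open>x M\<^sub>a\<close> is finite for every \<open>a\<close>; by itself the integrability of \<open>m\<close>
  would give this only for almost every \<open>a\<close>.
\<close>

lemma upd_FD: "x \<in> FD \<Longrightarrow> upd x a \<in> FD"
  using continuous_map_image_subset_topspace[OF continuous_upd] by auto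

lemma Km_topology: "Km.mtopology = subtopology FDm.mtopology K"
  using Submetric.mtopology_submetric[of FD tv_dist K] Metric_space_fin_dens[of lam] prob_dens_subset[of lam]
  by (simp add: Submetric_def Submetric_axioms_def)

lemma continuous_upd_K:
  "continuous_map (prod_topology Km.mtopology euclidean) FDm.mtopology (\<lambda>(x, a). upd x a)"
proof -
  have "prod_topology Km.mtopology (euclidean :: 'a topology) = subtopology (prod_topology FDm.mtopology euclidean) (K \<times> UNIV)"
    unfolding Km_topology subtopology_Times by simp
  then show ?thesis using continuous_map_from_subtopology[OF continuous_upd] by simp
qed

lemma homlip_continuous: "homlip lam c U \<Longrightarrow> continuous_map FDm.mtopology euclideanreal U"
  by (rule FDm.lipschitz_continuous_map[of c]) (simp add: homlip_def)

lemma homlip_upd_measurable_pair: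
  assumes "homlip lam c U" shows "(\<lambda>(x, a). U (upd x a)) \<in> borel_measurable (FS \<Otimes>\<^sub>M borel)"
  using Km.continuous_map_borel_measurable_pair[OF continuous_map_compose[OF continuous_upd_K homlip_continuous[OF assms]]]
  by (simp add: comp_def case_prod_unfold)

lemma homlip_upd_measurable:
  assumes U: "homlip lam c U" and x: "x \<in> FD" shows "(\<lambda>a. U (upd x a)) \<in> borel_measurable \<tau>"
proof -
  have "continuous_map euclidean (prod_topology FDm.mtopology (euclidean :: 'a topology)) (\<lambda>a. (x, a))"
    using x by (intro continuous_map_pairedI) auto
  from continuous_map_compose[OF this continuous_map_compose[OF continuous_upd homlip_continuous[OF U]]]
  have "continuous_on UNIV (\<lambda>a. U (upd x a))" by (simp add: comp_def)
  then have "(\<lambda>a. U (upd x a)) \<in> borel_measurable borel" by (rule borel_measurable_continuous_onI)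
  then show ?thesis using measurable_cong_sets[OF sets_tau refl] by blast
qed

lemma mass_upd_integral:
  assumes x: "x \<in> FD" shows "(\<integral>\<^sup>+a. ennreal (mass (upd x a)) \<partial>\<tau>) = ennreal (mass x)"
proof -
  have "ennreal (mass (upd x a)) = emeasure (upd x a) UNIV" for a
    using total_mass_eq[OF upd_FD[OF x]] fin_dens_space[OF upd_FD[OF x]] by (simp add: total_mass_def)
  moreover have "emeasure (Tk s) UNIV = 1" for s
    using emeasure_trans_kernel[of UNIV s] trans_density_integral by simp
  moreover have "ennreal (mass x) = emeasure x UNIV"
    using total_mass_eq[OF x] fin_dens_space[OF x] by (simp add: total_mass_def)
  ultimately show ?thesis using integral_upd_emeasure[OF x, of UNIV] fin_dens_space[OF x] by simp
qed

lemma mass_upd_integrable: "x \<in> FD \<Longrightarrow> integrable \<tau> (\<lambda>a. mass (upd x a))"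
  using mass_upd_integral[of x] homlip_upd_measurable[OF homlip_mass]
  by (intro integrableI_nonneg) (auto simp: mass_nonneg)

lemma homlip_upd_integrable:
  assumes U: "homlip lam c U" and x: "x \<in> FD" shows "integrable \<tau> (\<lambda>a. U (upd x a))"
proof (rule Bochner_Integration.integrable_bound)
  show "integrable \<tau> (\<lambda>a. c * mass (upd x a))" using mass_upd_integrable[OF x] by simp
  show "AE a in \<tau>. norm (U (upd x a)) \<le> norm (c * mass (upd x a))"
    using homlip_bound[OF U upd_FD[OF x]] by (auto intro: order_trans[OF _ abs_ge_self])
qed (rule homlip_upd_measurable[OF U x])

text \<open>
  On homogeneous functions, \<open>lift\<close> is the filter kernel acting by integration
  (\<open>integral_filter_kernel\<close>).
\<close>

definition lift :: "('s measure \<Rightarrow> real) \<Rightarrow> 's measure \<Rightarrow> real" where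
  "lift U x = (\<integral>a. U (upd x a) \<partial>\<tau>)"

lemma upd_scale:
  assumes x: "x \<in> FD" and r: "0 \<le> r"
  shows "upd (scale_measure (ennreal r) x) a = scale_measure (ennreal r) (upd x a)"
proof -
  note [measurable_cong] = FD_sets[OF x]
  have "upd_density (scale_measure (ennreal r) x) a = (\<lambda>t. ennreal r * upd_density x a t)"
    unfolding upd_density_def by (intro ext nn_integral_scale_measure) measurable
  then show ?thesis
    using upd_density_measurable[OF x] x
    by (simp add: upd_eq_density[OF scale_in_fin_dens[OF x r]] upd_eq_density[OF x] scale_density)
qed

lemma homlip_lift:
  assumes U: "homlip lam c U" and c: "0 \<le> c" shows "homlip lam c (lift U)"
  unfolding homlip_def lipschitz_def
proof (intro conjI ballI allI impI)
  fix x y assume x: "x \<in> FD" and y: "y \<in> FD"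
  obtain e where e: "e \<in> borel_measurable \<tau>" "\<And>a. ennreal (tv_dist (upd x a) (upd y a)) \<le> e a"
    "(\<integral>\<^sup>+a. e a \<partial>\<tau>) = ennreal (tv_dist x y)"
    using tv_upd_contract[OF x y upd_FD[OF x] upd_FD[OF y]] by blast
  have "ennreal \<bar>lift U x - lift U y\<bar> = ennreal (norm (\<integral>a. U (upd x a) - U (upd y a) \<partial>\<tau>))"
    unfolding lift_def using homlip_upd_integrable[OF U] x y by simp
  also have "\<dots> \<le> (\<integral>\<^sup>+a. ennreal (norm (U (upd x a) - U (upd y a))) \<partial>\<tau>)"
    by (rule integral_norm_bound_ennreal) (use homlip_upd_integrable[OF U] x y in auto)
  also have "\<dots> \<le> (\<integral>\<^sup>+a. ennreal c * e a \<partial>\<tau>)"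
  proof (rule nn_integral_mono)
    fix a
    have "ennreal (norm (U (upd x a) - U (upd y a))) \<le> ennreal (c * tv_dist (upd x a) (upd y a))"
      using U upd_FD[OF x] upd_FD[OF y] by (intro ennreal_leI) (simp add: homlip_def lipschitz_def)
    also have "\<dots> \<le> ennreal c * e a"
      using e(2)[of a] c by (simp add: ennreal_mult tv_dist_nonneg mult_left_mono)
    finally show "ennreal (norm (U (upd x a) - U (upd y a))) \<le> ennreal c * e a" .
  qed
  also have "\<dots> = ennreal c * ennreal (tv_dist x y)"
    using e(1,3) by (simp add: nn_integral_cmult)
  also have "\<dots> = ennreal (c * tv_dist x y)" using c by (simp add: ennreal_mult tv_dist_nonneg)
  finally show "\<bar>lift U x - lift U y\<bar> \<le> c * tv_dist x y" using c by (simp add: tv_dist_nonneg)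
next
  fix x and r :: real assume x: "x \<in> FD" and r: "0 \<le> r"
  then have "U (upd (scale_measure (ennreal r) x) a) = r * U (upd x a)" for a
    using U upd_FD[OF x] by (simp add: upd_scale homlip_def)
  then show "lift U (scale_measure (ennreal r) x) = r * lift U x" by (simp add: lift_def)
qed

end

section \<open>The filter kernel\<close>

context regular_model
begin

abbreviation "fk \<equiv> filter_kernel lam \<tau> m"

text \<open>
  If the observation \<open>a\<close> has density 0, then the filter stays where it is. This event has
  probability 0 under the filter kernel; a value in \<open>K\<close> keeps the map total and measurable.
\<close>

definition filt :: "'s measure \<Rightarrow> 'a \<Rightarrow> 's measure" where
  "filt x a = (if 0 < mass (upd x a) then normalized (upd x a) else x)"

lemma filt_in_K: "x \<in> K \<Longrightarrow> filt x a \<in> K"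
  using normalized_in_prob_dens[OF upd_FD[OF prob_dens_fin_dens]] by (simp add: filt_def)

lemma mass_mult_filt:
  assumes U: "homlip lam c U" and x: "x \<in> K" shows "mass (upd x a) * U (filt x a) = U (upd x a)"
proof -
  have f: "upd x a \<in> FD" by (rule upd_FD[OF prob_dens_fin_dens[OF x]])
  show ?thesis
    using homlip_normalized[OF U f] homlip_mass_zero[OF U f] mass_nonneg[of "upd x a"]
    by (cases "mass (upd x a) = 0") (auto simp: filt_def)
qed

text \<open>
  By \<open>measurable_metric_borelI\<close> only \<open>u (filt x a)\<close> for Lipschitz \<open>u\<close> has to be measurable in
  \<open>(x, a)\<close>. Where the mass is positive, this is the quotient of two functions that are continuous by
  regularity: the homogeneous extension of \<open>u\<close> at \<open>x M\<^sub>a\<close>, and the mass.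
\<close>

lemma measurable_filt_pair: "(\<lambda>(x, a). filt x a) \<in> FS \<Otimes>\<^sub>M borel \<rightarrow>\<^sub>M FS"
proof (rule Km.measurable_metric_borelI)
  show "(\<lambda>(x, a). filt x a) \<in> space (FS \<Otimes>\<^sub>M borel) \<rightarrow> K"
    using filt_in_K by (auto simp: space_pair_measure)
  fix u assume u: "lipschitz K tv_dist 1 u" "\<And>x. x \<in> K \<Longrightarrow> 0 \<le> u x \<and> u x \<le> 1"
  have H: "homlip lam 4 (hom_ext u)"
    using u(2) by (intro homlip_hom_ext u(1)) fastforce
  have [measurable]: "(\<lambda>(x, a). hom_ext u (upd x a)) \<in> borel_measurable (FS \<Otimes>\<^sub>M borel)"
    "(\<lambda>(x, a). mass (upd x a)) \<in> borel_measurable (FS \<Otimes>\<^sub>M borel)"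
    using homlip_upd_measurable_pair[OF H] homlip_upd_measurable_pair[OF homlip_mass] by auto
  have [measurable]: "u \<in> borel_measurable FS" by (rule Km.lipschitz_borel_measurable[OF u(1)])
  let ?r = "\<lambda>z. if 0 < (case z of (x, a) \<Rightarrow> mass (upd x a))
      then (case z of (x, a) \<Rightarrow> hom_ext u (upd x a)) / (case z of (x, a) \<Rightarrow> mass (upd x a)) else u (fst z)"
  have "?r \<in> borel_measurable (FS \<Otimes>\<^sub>M borel)" by measurable
  moreover have "(\<lambda>z. u (case z of (x, a) \<Rightarrow> filt x a)) = ?r"
    by (auto simp: fun_eq_iff filt_def hom_ext_def)
  ultimately show "(\<lambda>z. u (case z of (x, a) \<Rightarrow> filt x a)) \<in> borel_measurable (FS \<Otimes>\<^sub>M borel)" by simp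
qed

lemma measurable_filt: "x \<in> K \<Longrightarrow> filt x \<in> \<tau> \<rightarrow>\<^sub>M FS"
  using measurable_compose[OF measurable_Pair1' measurable_filt_pair, of x]
  by (simp add: measurable_cong_sets[OF sets_tau refl])

lemma mass_upd_measurable: "x \<in> FD \<Longrightarrow> (\<lambda>a. mass (upd x a)) \<in> borel_measurable \<tau>"
  by (rule homlip_upd_measurable[OF homlip_mass])

text \<open>
  The measure defined by the set function in \<open>filter_kernel\<close> is the law of the next filter, where
  the observation has density \<open>\<parallel>x M\<^sub>a\<parallel>\<close>. In particular that set function is a measure.
\<close>

lemma filter_kernel_eq:
  assumes x: "x \<in> K"
  shows "fk x = distr (density \<tau> (\<lambda>a. ennreal (mass (upd x a)))) FS (filt x)"
proof -
  have xF: "x \<in> FD" by (rule prob_dens_fin_dens[OF x])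
  note [measurable] = measurable_filt[OF x] mass_upd_measurable[OF xF]
  let ?R = "distr (density \<tau> (\<lambda>a. ennreal (mass (upd x a)))) FS (filt x)"
  have tm: "total_mass (upd x a) = ennreal (mass (upd x a))" for a
    by (rule total_mass_eq[OF upd_FD[OF xF]])
  have eq: "(\<integral>\<^sup>+a\<in>{a \<in> space \<tau>. total_mass (upd x a) > 0}.
              (indicator E (scale_measure (1 / total_mass (upd x a)) (upd x a))
               * total_mass (upd x a)) \<partial>\<tau>) = emeasure ?R E" if E[measurable]: "E \<in> sets FS" for E
  proof -
    have "emeasure ?R E = (\<integral>\<^sup>+z. indicator E z \<partial>?R)" by simp
    also have "\<dots> = (\<integral>\<^sup>+a. ennreal (mass (upd x a)) * indicator E (filt x a) \<partial>\<tau>)"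
      by (simp add: nn_integral_distr nn_integral_density del: nn_integral_indicator)
    also have "\<dots> = (\<integral>\<^sup>+a\<in>{a \<in> space \<tau>. total_mass (upd x a) > 0}.
              (indicator E (scale_measure (1 / total_mass (upd x a)) (upd x a))
               * total_mass (upd x a)) \<partial>\<tau>)"
    proof (rule nn_integral_cong)
      fix a
      show "ennreal (mass (upd x a)) * indicator E (filt x a)
        = (indicator E (scale_measure (1 / total_mass (upd x a)) (upd x a)) * total_mass (upd x a))
          * indicator {a \<in> space \<tau>. total_mass (upd x a) > 0} a"
        using mass_nonneg[of "upd x a"]
        by (cases "mass (upd x a) = 0") (simp_all add: tm filt_def normalized_def indicator_def)
    qed
    finally show ?thesis ..
  qed
  have "fk x = measure_of K (sets FS) (emeasure ?R)"
    unfolding filter_kernel_def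
    using sets.space_closed[of FS] eq by (intro measure_of_eq) (auto simp: sets.sigma_sets_eq[of FS, simplified])
  also have "\<dots> = ?R" using measure_of_of_measure[of ?R] by simp
  finally show ?thesis .
qed

lemma nn_integral_filter_kernel:
  assumes x: "x \<in> K" and g[measurable]: "g \<in> borel_measurable FS"
  shows "(\<integral>\<^sup>+z. g z \<partial>fk x) = (\<integral>\<^sup>+a. ennreal (mass (upd x a)) * g (filt x a) \<partial>\<tau>)"
proof -
  note [measurable] = measurable_filt[OF x] mass_upd_measurable[OF prob_dens_fin_dens[OF x]]
  show ?thesis
    unfolding filter_kernel_eq[OF x] by (simp add: nn_integral_distr nn_integral_density)
qed

lemma sets_filter_kernel: "x \<in> K \<Longrightarrow> sets (fk x) = sets FS"
  by (simp add: filter_kernel_eq)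

lemma space_filter_kernel: "x \<in> K \<Longrightarrow> space (fk x) = K"
  by (simp add: filter_kernel_eq)

lemma emeasure_filter_kernel:
  assumes x: "x \<in> K" and E: "E \<in> sets FS"
  shows "emeasure (fk x) E = (\<integral>\<^sup>+a. ennreal (mass (upd x a)) * indicator E (filt x a) \<partial>\<tau>)"
  using nn_integral_filter_kernel[OF x, of "indicator E"] E by (simp add: sets_filter_kernel[OF x])

lemma prob_space_filter_kernel:
  assumes x: "x \<in> K" shows "prob_space (fk x)"
proof (rule prob_spaceI)
  have "emeasure (fk x) (space (fk x)) = (\<integral>\<^sup>+a. ennreal (mass (upd x a)) \<partial>\<tau>)"
    using nn_integral_filter_kernel[OF x, of "\<lambda>_. 1"] by (simp add: nn_integral_const)
  then show "emeasure (fk x) (space (fk x)) = 1"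
    using mass_upd_integral[OF prob_dens_fin_dens[OF x]] mass_prob[OF x] by simp
qed

lemma filter_kernel_measurable: "fk \<in> FS \<rightarrow>\<^sub>M prob_algebra FS"
proof (rule measurable_prob_algebraI)
  interpret t: sigma_finite_measure \<tau> by (rule sigma_finite_tau)
  show "prob_space (fk x)" if "x \<in> space FS" for x using that by (simp add: prob_space_filter_kernel)
  show "fk \<in> FS \<rightarrow>\<^sub>M subprob_algebra FS"
  proof (rule measurable_subprob_algebra)
    fix E assume E[measurable]: "E \<in> sets FS"
    have s: "sets (FS \<Otimes>\<^sub>M \<tau>) = sets (FS \<Otimes>\<^sub>M borel)" by (intro sets_pair_measure_cong sets_tau refl)
    have [measurable]: "(\<lambda>(x, a). filt x a) \<in> FS \<Otimes>\<^sub>M \<tau> \<rightarrow>\<^sub>M FS"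
      "(\<lambda>(x, a). mass (upd x a)) \<in> borel_measurable (FS \<Otimes>\<^sub>M \<tau>)"
      using measurable_filt_pair homlip_upd_measurable_pair[OF homlip_mass] measurable_cong_sets[OF s refl] by blast+
    have "(\<lambda>x. \<integral>\<^sup>+a. ennreal (mass (upd x a)) * indicator E (filt x a) \<partial>\<tau>) \<in> borel_measurable FS"
      by measurable
    then show "(\<lambda>x. emeasure (fk x) E) \<in> borel_measurable FS"
      by (rule measurable_cong[THEN iffD2, rotated]) (simp add: emeasure_filter_kernel E)
  qed (auto simp: sets_filter_kernel prob_space_imp_subprob_space[OF prob_space_filter_kernel])
qed

sublocale P: markov_kernel FS fk
  by unfold_locales (rule filter_kernel_measurable)

lemma homlip_measurable_FS: "homlip lam c U \<Longrightarrow> U \<in> borel_measurable FS"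
  using prob_dens_fin_dens[of _ lam]
  by (intro Km.lipschitz_borel_measurable[of c]) (simp add: homlip_def lipschitz_def)

lemma integral_filter_kernel:
  assumes U: "homlip lam c U" and x: "x \<in> K"
  shows "(\<integral>z. U z \<partial>fk x) = lift U x"
proof -
  note [measurable] = measurable_filt[OF x] mass_upd_measurable[OF prob_dens_fin_dens[OF x]] homlip_measurable_FS[OF U]
  have "(\<integral>z. U z \<partial>fk x) = (\<integral>a. mass (upd x a) * U (filt x a) \<partial>\<tau>)"
    unfolding filter_kernel_eq[OF x] by (simp add: integral_distr integral_density mass_nonneg)
  then show ?thesis by (simp add: mass_mult_filt[OF U x] lift_def)
qed

lemma homlip_lift_funpow: "homlip lam c U \<Longrightarrow> 0 \<le> c \<Longrightarrow> homlip lam c ((lift ^^ n) U)"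
  by (induction n) (auto intro: homlip_lift)

lemma integral_kernel_power_homlip:
  assumes U: "homlip lam c U" and c: "0 \<le> c" and x: "x \<in> K"
  shows "(\<integral>z. U z \<partial>P.Qn n x) = (lift ^^ n) U x"
  using x
proof (induction n arbitrary: x)
  case 0
  then show ?case using integral_return[of x FS U] homlip_measurable_FS[OF U] by simp
next
  case (Suc n)
  have "\<bar>U z\<bar> \<le> c" if "z \<in> K" for z
    using homlip_bound[OF U prob_dens_fin_dens[OF that]] mass_prob[OF that] by simp
  then have "(\<integral>z. U z \<partial>P.Qn (Suc n) x) = (\<integral>y. (\<integral>z. U z \<partial>P.Qn n y) \<partial>fk x)"
    using P.integral_bind_kernel_power[of "fk x" U c n] Suc.prems homlip_measurable_FS[OF U]
      prob_space_filter_kernel[OF Suc.prems] sets_filter_kernel[OF Suc.prems]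
    by (simp add: P.kernel_power_Suc space_prob_algebra)
  also have "\<dots> = (\<integral>y. (lift ^^ n) U y \<partial>fk x)"
    using Suc by (intro Bochner_Integration.integral_cong) (auto simp: space_filter_kernel)
  also have "\<dots> = (lift ^^ Suc n) U x"
    using integral_filter_kernel[OF homlip_lift_funpow[OF U c] Suc.prems] by simp
  finally show ?case .
qed

lemma prob_kernel_power: "x \<in> K \<Longrightarrow> P.Qn n x \<in> space (prob_algebra FS)"
  using P.kernel_power_in_space[of x n] by simp

lemma Lip1_K_bounded:
  assumes "lipschitz K tv_dist 1 u" "x0 \<in> K" "x \<in> K" shows "\<bar>u x - u x0\<bar> \<le> 2"
  using assms tv_dist_prob_le_2[of x x0] prob_dens_prob_space unfolding lipschitz_def by fastforce

text \<open>
  On \<open>K\<close>, which has diameter at most 2, a 1-Lipschitz function minus its value at one point is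
  bounded by 2. Its homogeneous extension is 4-Lipschitz, and \<open>lift\<close> preserves the constant.
\<close>

lemma kernel_power_lipschitz:
  assumes u: "lipschitz K tv_dist 1 u"
  shows "lipschitz K tv_dist 4 (\<lambda>x. \<integral>z. u z \<partial>P.Qn n x)"
proof (cases "K = {}")
  case False
  then obtain x0 where x0: "x0 \<in> K" by blast
  let ?v = "\<lambda>x. u x - u x0"
  have v: "lipschitz K tv_dist 1 ?v" using u by (simp add: lipschitz_def)
  have vb: "\<bar>?v x\<bar> \<le> 2" if "x \<in> K" for x by (rule Lip1_K_bounded[OF u x0 that])
  have H: "homlip lam 4 (hom_ext ?v)" by (rule homlip_hom_ext[OF v vb])
  have H': "homlip lam 4 ((lift ^^ n) (hom_ext ?v))" by (rule homlip_lift_funpow[OF H]) simp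
  have eq: "(\<integral>z. u z \<partial>P.Qn n x) = (lift ^^ n) (hom_ext ?v) x + u x0" if x: "x \<in> K" for x
  proof -
    note \<mu> = prob_algebraD[OF prob_kernel_power[OF x, of n]]
    interpret prob_space "P.Qn n x" by (rule \<mu>)
    have "integrable (P.Qn n x) ?v"
      using prob_integrable_bounded[OF prob_kernel_power[OF x] Km.lipschitz_borel_measurable[OF v], of 2] vb by simp
    then have "(\<integral>z. ?v z + u x0 \<partial>P.Qn n x) = (\<integral>z. ?v z \<partial>P.Qn n x) + u x0"
      by (subst Bochner_Integration.integral_add) (auto simp: prob_space)
    moreover have "(\<integral>z. ?v z \<partial>P.Qn n x) = (\<integral>z. hom_ext ?v z \<partial>P.Qn n x)"
      by (rule Bochner_Integration.integral_cong) (auto simp: \<mu> hom_ext_prob)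
    ultimately show ?thesis using integral_kernel_power_homlip[OF H _ x] by simp
  qed
  show ?thesis unfolding lipschitz_def
  proof (intro ballI)
    fix x y assume "x \<in> K" "y \<in> K"
    then show "\<bar>(\<integral>z. u z \<partial>P.Qn n x) - (\<integral>z. u z \<partial>P.Qn n y)\<bar> \<le> 4 * tv_dist x y"
      using H' prob_dens_fin_dens[of _ lam] by (simp add: eq homlip_def lipschitz_def)
  qed
qed (simp add: lipschitz_def)

section \<open>Barycentres\<close>

lemma id_measurable: "(\<lambda>x. x) \<in> FS \<rightarrow>\<^sub>M prob_algebra lam"
proof (rule measurable_prob_algebraI)
  show "(\<lambda>x. x) \<in> FS \<rightarrow>\<^sub>M subprob_algebra lam"
  proof (rule measurable_subprob_algebra)
    fix F assume F: "F \<in> sets lam"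
    have "lipschitz K tv_dist 1 (\<lambda>x. measure x F)"
      unfolding lipschitz_def
    proof (intro ballI)
      fix x y assume "x \<in> K" "y \<in> K"
      then show "\<bar>measure x F - measure y F\<bar> \<le> 1 * tv_dist x y"
        using measure_diff_le_tv_dist[of x y F] F prob_dens_fin_dens[of x lam] prob_dens_fin_dens[of y lam]
          fin_dens_finite[of _ lam] fin_dens_sets[of _ lam] by simp
    qed
    then have "(\<lambda>x. ennreal (measure x F)) \<in> borel_measurable FS"
      using Km.lipschitz_borel_measurable by measurable
    then show "(\<lambda>x. emeasure x F) \<in> borel_measurable FS"
      by (rule measurable_cong[THEN iffD2, rotated])
        (simp add: finite_measure.emeasure_eq_measure[OF fin_dens_finite[OF prob_dens_fin_dens[where lam=lam]]])
  qed (simp_all add: prob_space_imp_subprob_space[OF prob_dens_prob_space[where lam=lam]]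
      fin_dens_sets[OF prob_dens_fin_dens[where lam=lam]])
qed (simp add: prob_dens_prob_space)

lemma id_measurable_subprob: "(\<lambda>x. x) \<in> FS \<rightarrow>\<^sub>M subprob_algebra lam"
  by (rule measurable_prob_algebraD[OF id_measurable])

definition bary :: "'s measure measure \<Rightarrow> 's measure" where "bary \<mu> = \<mu> \<bind> (\<lambda>x. x)"

lemma measurable_from_prob: "\<mu> \<in> space (prob_algebra X) \<Longrightarrow> f \<in> measurable \<mu> N \<longleftrightarrow> f \<in> measurable X N"
  using measurable_cong_sets[OF prob_algebraD(2) refl] by blast

lemma K_nonempty: "K \<noteq> {}" using trans_kernel_in_K by blast

lemma emeasure_bary:
  assumes "\<mu> \<in> space (prob_algebra FS)" "F \<in> sets lam"
  shows "emeasure (bary \<mu>) F = (\<integral>\<^sup>+x. emeasure x F \<partial>\<mu>)"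
  unfolding bary_def using id_measurable_subprob prob_algebraD(3)[OF assms(1)] K_nonempty
  by (intro emeasure_bind[OF _ _ assms(2)]) (simp_all add: measurable_from_prob[OF assms(1)])

lemma nn_integral_bary:
  assumes "\<mu> \<in> space (prob_algebra FS)" "h \<in> borel_measurable lam"
  shows "(\<integral>\<^sup>+s. h s \<partial>bary \<mu>) = (\<integral>\<^sup>+x. (\<integral>\<^sup>+s. h s \<partial>x) \<partial>\<mu>)"
  unfolding bary_def using id_measurable_subprob
  by (intro nn_integral_bind[OF assms(2)]) (simp add: measurable_from_prob[OF assms(1)])

lemma bary_prob: "\<mu> \<in> space (prob_algebra FS) \<Longrightarrow> bary \<mu> \<in> space (prob_algebra lam)"
  unfolding bary_def
  by (rule measurable_space[OF measurable_bind_prob_space[OF measurable_ident_sets[OF refl] id_measurable]])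

lemma barycenter_eq:
  assumes "\<mu> \<in> space (prob_algebra FS)" shows "barycenter lam \<mu> = bary \<mu>"
proof -
  note b = prob_algebraD[OF bary_prob[OF assms]]
  have "barycenter lam \<mu> = measure_of (space lam) (sets lam) (emeasure (bary \<mu>))"
    unfolding barycenter_def
    by (rule measure_of_eq) (use sets.space_closed in \<open>auto simp: emeasure_bary[OF assms] sets.sigma_sets_eq simp del: space_lam\<close>)
  also have "\<dots> = bary \<mu>" using measure_of_of_measure[of "bary \<mu>"] b by simp
  finally show ?thesis .
qed

lemma bary_in_K:
  assumes "\<mu> \<in> space (prob_algebra FS)" shows "bary \<mu> \<in> K"
proof -
  note b = prob_algebraD[OF bary_prob[OF assms]]
  interpret b: prob_space "bary \<mu>" by (rule b)
  have "absolutely_continuous lam (bary \<mu>)"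
    unfolding absolutely_continuous_def
  proof
    fix N assume N: "N \<in> null_sets lam"
    have z: "emeasure x N = 0" if "x \<in> K" for x
    proof -
      obtain f where "f \<in> borel_measurable lam" "x = density lam f" using \<open>x \<in> K\<close> by (auto simp: prob_dens_def)
      then have "absolutely_continuous lam x" using absolutely_continuousI_density by blast
      then show ?thesis using N unfolding absolutely_continuous_def by auto
    qed
    have "emeasure (bary \<mu>) N = (\<integral>\<^sup>+x. 0 \<partial>\<mu>)"
      unfolding emeasure_bary[OF assms null_setsD2[OF N]]
      by (rule nn_integral_cong) (simp add: z prob_algebraD(3)[OF assms])
    then show "N \<in> null_sets (bary \<mu>)" using N b by (auto simp: null_sets_def)
  qed
  then show ?thesis
    unfolding prob_dens_iff
    using Radon_Nikodym_fin_dens[OF sigma_finite_lam b.finite_measure_axioms b(2)] b by blast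
qed

text \<open>
  The filter after an observation of density \<open>\<parallel>x M\<^sub>a\<parallel>\<close> is \<open>x M\<^sub>a\<close> divided by its mass, so the mean
  filter is the sum of the \<open>x M\<^sub>a\<close> over \<open>a\<close>.
\<close>

lemma filter_kernel_bind_id:
  assumes x: "x \<in> K" shows "bary (fk x) = x \<bind> Tk"
proof (rule measure_eqI)
  have fkp: "fk x \<in> space (prob_algebra FS)"
    using x by (simp add: space_prob_algebra prob_space_filter_kernel sets_filter_kernel)
  have xp: "x \<in> space (prob_algebra lam)" by (rule prob_dens_prob_algebra[OF x])
  show s: "sets (bary (fk x)) = sets (x \<bind> Tk)"
    using prob_algebraD(2)[OF bary_prob[OF fkp]] sets_bind'[OF xp trans_kernel_measurable] by simp
  fix F assume "F \<in> sets (bary (fk x))"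
  then have F: "F \<in> sets lam" "F \<in> sets borel" using prob_algebraD(2)[OF bary_prob[OF fkp]] by (auto simp: sets_lam)
  have mF: "(\<lambda>z. emeasure z F) \<in> borel_measurable FS"
    using measurable_compose[OF id_measurable_subprob measurable_emeasure_subprob_algebra[OF F(1)]] .
  have "emeasure (bary (fk x)) F = (\<integral>\<^sup>+a. ennreal (mass (upd x a)) * emeasure (filt x a) F \<partial>\<tau>)"
    by (simp add: emeasure_bary[OF fkp F(1)] nn_integral_filter_kernel[OF x mF])
  also have "\<dots> = (\<integral>\<^sup>+a. emeasure (upd x a) F \<partial>\<tau>)"
  proof (rule nn_integral_cong)
    fix a
    have f: "upd x a \<in> FD" by (rule upd_FD[OF prob_dens_fin_dens[OF x]])
    show "ennreal (mass (upd x a)) * emeasure (filt x a) F = emeasure (upd x a) F"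
    proof (cases "mass (upd x a) = 0")
      case True
      then have "emeasure (upd x a) F = 0"
        using total_mass_eq[OF f] emeasure_space[of "upd x a" F] by (simp add: total_mass_def)
      then show ?thesis using True by simp
    next
      case False
      then have "0 < mass (upd x a)" using mass_nonneg[of "upd x a"] by simp
      then show ?thesis
        by (simp add: filt_def normalized_eq[OF f] mult.assoc[symmetric] ennreal_mult[symmetric])
    qed
  qed
  also have "\<dots> = (\<integral>\<^sup>+s. emeasure (Tk s) F \<partial>x)"
    by (rule integral_upd_emeasure[OF prob_dens_fin_dens[OF x] F(2)])
  also have "\<dots> = emeasure (x \<bind> Tk) F"
    using emeasure_bind_prob_algebra[OF xp trans_kernel_measurable F(1)] by simp
  finally show "emeasure (bary (fk x)) F = emeasure (x \<bind> Tk) F" .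
qed

lemma bary_bind_filter_kernel:
  assumes \<mu>: "\<mu> \<in> space (prob_algebra FS)" shows "bary (\<mu> \<bind> fk) = bary \<mu> \<bind> Tk"
proof -
  have "bary (\<mu> \<bind> fk) = \<mu> \<bind> (\<lambda>x. fk x \<bind> (\<lambda>x. x))"
    unfolding bary_def
    by (rule bind_assoc[where N=FS and R=lam]) (simp_all add: measurable_from_prob[OF \<mu>] id_measurable_subprob)
  also have "\<dots> = \<mu> \<bind> (\<lambda>x. x \<bind> Tk)"
    using filter_kernel_bind_id prob_algebraD(3)[OF \<mu>] by (intro bind_cong) (auto simp: bary_def)
  also have "\<dots> = bary \<mu> \<bind> Tk"
    unfolding bary_def
    by (rule bind_assoc[symmetric, where N=lam and R=lam])
      (simp_all add: measurable_from_prob[OF \<mu>] id_measurable_subprob)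
  finally show ?thesis .
qed

lemma bary_bind_kernel_power:
  assumes \<mu>: "\<mu> \<in> space (prob_algebra FS)" shows "bary (\<mu> \<bind> P.Qn n) = bary \<mu> \<bind> S.Qn n"
proof (induction n)
  case 0
  have "\<mu> \<bind> P.Qn 0 = \<mu>" "bary \<mu> \<bind> S.Qn 0 = bary \<mu>"
    using prob_algebraD(2)[OF \<mu>] prob_algebraD(2)[OF bary_prob[OF \<mu>]]
    by (simp_all add: kernel_power.simps(1)[abs_def] bind_return'')
  then show ?case by (simp only:)
next
  case (Suc n)
  have 1: "\<nu> \<bind> P.Qn (Suc n) = (\<nu> \<bind> P.Qn n) \<bind> fk" if "\<nu> \<in> space (prob_algebra FS)" for \<nu>
    using P.bind_kernel_power_add[OF that, of n "Suc 0"] by (simp add: kernel_power.simps(2)[abs_def])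
  have 2: "\<nu> \<bind> S.Qn (Suc n) = (\<nu> \<bind> S.Qn n) \<bind> Tk" if "\<nu> \<in> space (prob_algebra lam)" for \<nu>
    using S.bind_kernel_power_add[OF that, of n "Suc 0"] by (simp add: kernel_power.simps(2)[abs_def])
  show ?case
    using Suc bary_bind_filter_kernel[OF P.bind_kernel_power_in_space[OF \<mu>]] 1[OF \<mu>] 2[OF bary_prob[OF \<mu>]] by simp
qed

end

section \<open>The hidden chain and the transport of barycentres\<close>

context hmm
begin

lemma kernel_power_density:
  "\<exists>pk. (\<lambda>(s, t). pk s t) \<in> borel_measurable (borel \<Otimes>\<^sub>M borel) \<and> (\<forall>s. S.Qn (Suc k) s = density lam (pk s))"
proof (induction k)
  case 0
  show ?case
    using trans_density_measurable2 by (intro exI[of _ "trans_density \<tau> m"]) (simp add: trans_kernel_def)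
next
  case (Suc k)
  then obtain pk where pk: "(\<lambda>(s, t). pk s t) \<in> borel_measurable (borel \<Otimes>\<^sub>M borel)"
    "\<And>s. S.Qn (Suc k) s = density lam (pk s)" by blast
  interpret l: sigma_finite_measure lam by (rule sigma_finite_lam)
  interpret L: pair_sigma_finite lam lam ..
  have pk_comp [measurable (raw)]: "(\<lambda>z. pk (f z) (g z)) \<in> borel_measurable N"
    if "f \<in> N \<rightarrow>\<^sub>M borel" "g \<in> N \<rightarrow>\<^sub>M borel" for f :: "'z \<Rightarrow> 's" and g and N :: "'z measure"
    using measurable_compose[OF measurable_Pair[OF that] pk(1)] by simp
  define pn where "pn s t = (\<integral>\<^sup>+r. trans_density \<tau> m s r * pk r t \<partial>lam)" for s t
  have pn: "(\<lambda>(s, t). pn s t) \<in> borel_measurable (borel \<Otimes>\<^sub>M borel)"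
    unfolding pn_def by measurable
  have pns: "pn s \<in> borel_measurable lam" for s
    unfolding pn_def by measurable
  have "S.Qn (Suc (Suc k)) s = density lam (pn s)" for s
  proof (rule measure_eqI)
    have Ts: "Tk s \<in> space (prob_algebra lam)" by (rule prob_dens_prob_algebra[OF trans_kernel_in_K])
    have eq: "S.Qn (Suc (Suc k)) s = Tk s \<bind> S.Qn (Suc k)" by simp
    show "sets (S.Qn (Suc (Suc k)) s) = sets (density lam (pn s))"
      unfolding eq using sets_bind'[OF Ts S.measurable_kernel_power[of "Suc k"]] by (simp del: kernel_power.simps)
    fix F assume "F \<in> sets (S.Qn (Suc (Suc k)) s)"
    then have F: "F \<in> sets lam" unfolding eq sets_bind'[OF Ts S.measurable_kernel_power] .
    then have [measurable]: "F \<in> sets borel" by (simp add: sets_lam)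
    have "emeasure (S.Qn (Suc (Suc k)) s) F = (\<integral>\<^sup>+r. emeasure (S.Qn (Suc k) r) F \<partial>Tk s)"
      unfolding eq by (rule emeasure_bind_prob_algebra[OF Ts S.measurable_kernel_power F])
    also have "\<dots> = (\<integral>\<^sup>+r. trans_density \<tau> m s r * (\<integral>\<^sup>+t. pk r t * indicator F t \<partial>lam) \<partial>lam)"
      unfolding pk(2) trans_kernel_def by (subst nn_integral_density; simp add: emeasure_density sets_lam)
    also have "\<dots> = (\<integral>\<^sup>+r. (\<integral>\<^sup>+t. trans_density \<tau> m s r * (pk r t * indicator F t) \<partial>lam) \<partial>lam)"
      by (intro nn_integral_cong nn_integral_cmult[symmetric]) measurable
    also have "\<dots> = (\<integral>\<^sup>+t. (\<integral>\<^sup>+r. trans_density \<tau> m s r * (pk r t * indicator F t) \<partial>lam) \<partial>lam)"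
      by (rule L.Fubini') measurable
    also have "\<dots> = (\<integral>\<^sup>+t. pn s t * indicator F t \<partial>lam)"
      unfolding pn_def mult.assoc[symmetric] by (intro nn_integral_cong nn_integral_multc) measurable
    also have "\<dots> = emeasure (density lam (pn s)) F" using pns F by (simp add: emeasure_density)
    finally show "emeasure (S.Qn (Suc (Suc k)) s) F = emeasure (density lam (pn s)) F" .
  qed
  with pn show ?case by blast
qed

lemma kernel_power_in_K: "S.Qn (Suc k) s \<in> K"
proof -
  obtain pk where pk: "(\<lambda>(s, t). pk s t) \<in> borel_measurable (borel \<Otimes>\<^sub>M borel)"
    "\<And>s. S.Qn (Suc k) s = density lam (pk s)" using kernel_power_density by blast
  have "(\<lambda>t. (s, t)) \<in> lam \<rightarrow>\<^sub>M borel \<Otimes>\<^sub>M borel" by measurable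
  from measurable_compose[OF this pk(1)] have "pk s \<in> borel_measurable lam" by simp
  moreover have "prob_space (S.Qn (Suc k) s)"
    using prob_algebraD(1)[OF S.kernel_power_in_space] by simp
  ultimately show ?thesis using pk(2)[of s] by (auto simp: prob_dens_def)
qed

text \<open>
  The zeroth power is left out, as \<open>S.Qn 0 s\<close> is a point mass and need not have a density.
  A jointly measurable density of the powers makes the distance to \<open>\<pi>\<close> a measurable function of the starting
  point and allows the exchange of the two integrals.
\<close>

lemma tv_bind_kernel_power_le:
  assumes q: "q \<in> space (prob_algebra lam)" and \<pi>: "\<pi> \<in> K"
  shows "(\<lambda>s. tv_dist (S.Qn (Suc k) s) \<pi>) \<in> borel_measurable lam"
    and "ennreal (tv_dist (q \<bind> S.Qn (Suc k)) \<pi>) \<le> (\<integral>\<^sup>+s. ennreal (tv_dist (S.Qn (Suc k) s) \<pi>) \<partial>q)"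
proof -
  obtain pk where pk: "(\<lambda>(s, t). pk s t) \<in> borel_measurable (borel \<Otimes>\<^sub>M borel)"
    "\<And>s. S.Qn (Suc k) s = density lam (pk s)" using kernel_power_density by blast
  interpret l: sigma_finite_measure lam by (rule sigma_finite_lam)
  interpret q: prob_space q by (rule prob_algebraD(1)[OF q])
  interpret L: pair_sigma_finite lam q ..
  have [measurable_cong]: "sets q = sets borel" using prob_algebraD(2)[OF q] sets_lam by simp
  have pk_comp [measurable (raw)]: "(\<lambda>z. pk (f z) (g z)) \<in> borel_measurable N"
    if "f \<in> N \<rightarrow>\<^sub>M borel" "g \<in> N \<rightarrow>\<^sub>M borel" for f :: "'z \<Rightarrow> 's" and g and N :: "'z measure"
    using measurable_compose[OF measurable_Pair[OF that] pk(1)] by simp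
  obtain g where g: "integrable lam g" "\<And>s. 0 \<le> g s" "\<pi> = density lam (\<lambda>s. ennreal (g s))"
    using fin_densE[OF prob_dens_fin_dens[OF \<pi>]] by blast
  have [measurable]: "g \<in> borel_measurable borel"
    using borel_measurable_integrable[OF g(1)] by (simp add: measurable_lam_iff)
  have gfin: "(\<integral>\<^sup>+t. ennreal (g t) \<partial>lam) \<noteq> \<infinity>" using g by (simp add: nn_integral_eq_integral)
  have pkm: "pk s \<in> borel_measurable lam" for s by measurable
  have pk1: "(\<integral>\<^sup>+t. pk s t \<partial>lam) = 1" for s
    using prob_space.emeasure_space_1[OF prob_dens_prob_space[OF kernel_power_in_K[of k s]]] pkm[of s]
    unfolding pk(2) by (simp add: emeasure_density)
  let ?e = "\<lambda>s t. absdiff (pk s t) (ennreal (g t))"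
  have tvs: "ennreal (tv_dist (S.Qn (Suc k) s) \<pi>) = (\<integral>\<^sup>+t. ?e s t \<partial>lam)" for s
    unfolding pk(2) g(3) using pkm pk1 gfin by (intro tv_dist_density_nn) auto
  have "(\<lambda>s. enn2real (\<integral>\<^sup>+t. ?e s t \<partial>lam)) \<in> borel_measurable lam" by measurable
  then show "(\<lambda>s. tv_dist (S.Qn (Suc k) s) \<pi>) \<in> borel_measurable lam"
    unfolding tvs[symmetric] by (simp add: tv_dist_nonneg)
  let ?p = "\<lambda>t. \<integral>\<^sup>+s. pk s t \<partial>q"
  have pm: "?p \<in> borel_measurable lam" by measurable
  have qk: "q \<bind> S.Qn (Suc k) = density lam ?p"
  proof (rule measure_eqI)
    show "sets (q \<bind> S.Qn (Suc k)) = sets (density lam ?p)"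
      using sets_bind'[OF q S.measurable_kernel_power[of "Suc k"]] by (simp del: kernel_power.simps)
    fix F assume "F \<in> sets (q \<bind> S.Qn (Suc k))"
    then have F: "F \<in> sets lam" unfolding sets_bind'[OF q S.measurable_kernel_power] .
    then have [measurable]: "F \<in> sets borel" by (simp add: sets_lam)
    have "emeasure (q \<bind> S.Qn (Suc k)) F = (\<integral>\<^sup>+s. emeasure (S.Qn (Suc k) s) F \<partial>q)"
      by (rule emeasure_bind_prob_algebra[OF q S.measurable_kernel_power F])
    also have "\<dots> = (\<integral>\<^sup>+s. (\<integral>\<^sup>+t. pk s t * indicator F t \<partial>lam) \<partial>q)"
      unfolding pk(2) using F pkm by (simp add: emeasure_density)
    also have "\<dots> = (\<integral>\<^sup>+t. (\<integral>\<^sup>+s. pk s t * indicator F t \<partial>q) \<partial>lam)"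
      by (rule L.Fubini') measurable
    also have "\<dots> = (\<integral>\<^sup>+t. ?p t * indicator F t \<partial>lam)"
      by (intro nn_integral_cong nn_integral_multc) measurable
    finally show "emeasure (q \<bind> S.Qn (Suc k)) F = emeasure (density lam ?p) F"
      using pm F by (simp add: emeasure_density)
  qed
  have "(\<integral>\<^sup>+t. ?p t \<partial>lam) = (\<integral>\<^sup>+s. (\<integral>\<^sup>+t. pk s t \<partial>lam) \<partial>q)"
    by (rule L.Fubini'[symmetric]) measurable
  also have "\<dots> = 1" by (simp add: pk1 q.emeasure_space_1)
  finally have p1: "(\<integral>\<^sup>+t. ?p t \<partial>lam) = 1" .
  have "ennreal (tv_dist (q \<bind> S.Qn (Suc k)) \<pi>) = (\<integral>\<^sup>+t. absdiff (?p t) (ennreal (g t)) \<partial>lam)"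
    unfolding qk g(3) using pm p1 gfin by (intro tv_dist_density_nn) auto
  also have "\<dots> \<le> (\<integral>\<^sup>+t. (\<integral>\<^sup>+s. ?e s t \<partial>q) \<partial>lam)"
  proof (rule nn_integral_mono_AE)
    have "AE t in lam. ?p t \<noteq> \<infinity>" using p1 by (intro nn_integral_noteq_infinite[OF pm]) simp
    then show "AE t in lam. absdiff (?p t) (ennreal (g t)) \<le> (\<integral>\<^sup>+s. ?e s t \<partial>q)"
    proof eventually_elim
      case (elim t)
      have c: "(\<integral>\<^sup>+s. ennreal (g t) \<partial>q) = ennreal (g t)" by (simp add: q.emeasure_space_1)
      have "?p t \<le> (\<integral>\<^sup>+s. ennreal (g t) + ?e s t \<partial>q)"
        by (intro nn_integral_mono le_absdiff)
      also have "\<dots> = (\<integral>\<^sup>+s. ennreal (g t) \<partial>q) + (\<integral>\<^sup>+s. ?e s t \<partial>q)"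
        by (rule nn_integral_add) measurable
      finally have 1: "?p t \<le> ennreal (g t) + (\<integral>\<^sup>+s. ?e s t \<partial>q)" unfolding c .
      have "(\<integral>\<^sup>+s. ennreal (g t) \<partial>q) \<le> (\<integral>\<^sup>+s. pk s t + ?e s t \<partial>q)"
        by (intro nn_integral_mono le_absdiff)
      also have "\<dots> = ?p t + (\<integral>\<^sup>+s. ?e s t \<partial>q)"
        by (subst nn_integral_add) simp_all
      finally have 2: "ennreal (g t) \<le> ?p t + (\<integral>\<^sup>+s. ?e s t \<partial>q)" unfolding c .
      show ?case using 1 2 elim by (intro absdiff_le) auto
    qed
  qed
  also have "\<dots> = (\<integral>\<^sup>+s. (\<integral>\<^sup>+t. ?e s t \<partial>lam) \<partial>q)"
    by (rule L.Fubini'[symmetric]) measurable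
  finally show "ennreal (tv_dist (q \<bind> S.Qn (Suc k)) \<pi>) \<le> (\<integral>\<^sup>+s. ennreal (tv_dist (S.Qn (Suc k) s) \<pi>) \<partial>q)"
    unfolding tvs .
qed

lemma integral_diff_le_tv_dist:
  assumes x: "x \<in> FD" and y: "y \<in> FD" and h: "h \<in> borel_measurable lam" "\<And>s. 0 \<le> h s" "\<And>s. h s \<le> 1"
  shows "\<bar>(\<integral>s. h s \<partial>x) - (\<integral>s. h s \<partial>y)\<bar> \<le> tv_dist x y"
proof -
  obtain f where f: "integrable lam f" "\<And>s. 0 \<le> f s" "x = density lam (\<lambda>s. ennreal (f s))"
    using fin_densE[OF x] by blast
  obtain g where g: "integrable lam g" "\<And>s. 0 \<le> g s" "y = density lam (\<lambda>s. ennreal (g s))"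
    using fin_densE[OF y] by blast
  have int: "integrable lam (\<lambda>s. k s * h s)" if "integrable lam k" for k :: "'s \<Rightarrow> real"
  proof (rule Bochner_Integration.integrable_bound[OF that])
    show "AE s in lam. norm (k s * h s) \<le> norm (k s)"
      using h by (simp add: abs_mult mult_left_le)
  qed (use that h in auto)
  have "(\<integral>s. h s \<partial>x) - (\<integral>s. h s \<partial>y) = (\<integral>s. f s * h s \<partial>lam) - (\<integral>s. g s * h s \<partial>lam)"
    using f g h by (simp add: integral_density)
  also have "\<dots> = (\<integral>s. (f s - g s) * h s \<partial>lam)"
    using int f g by (simp add: left_diff_distrib)
  finally have "\<bar>(\<integral>s. h s \<partial>x) - (\<integral>s. h s \<partial>y)\<bar> \<le> (\<integral>s. \<bar>(f s - g s) * h s\<bar> \<partial>lam)"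
    by simp
  also have "\<dots> \<le> (\<integral>s. \<bar>f s - g s\<bar> \<partial>lam)"
    using f g h int[of "\<lambda>s. f s - g s"] int[of "\<lambda>s. \<bar>f s - g s\<bar>"]
    by (intro integral_mono) (auto simp: abs_mult mult_left_le)
  also have "\<dots> = tv_dist x y" using f g by (simp add: tv_dist_density)
  finally show ?thesis .
qed

text \<open>
  Let \<open>f\<close> and \<open>g\<close> be the densities of \<open>q\<close> and \<open>\<pi>\<close>. The map \<open>\<Phi>\<close> keeps a fraction \<open>h = min(f, g) / f\<close> of the
  mass at each state and spreads the rest \<open>c z = \<integral> (1 - h) dz\<close> according to the normalised excess \<open>r\<close> of \<open>g\<close>
  over \<open>f\<close>. It is affine, and on average over a law on \<open>K\<close> with barycentre \<open>q\<close> it turns the density \<open>f\<close> into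
  \<open>min(f, g) + max(0, g - f) = g\<close>; this is the last property, with \<open>hF\<close> the function that integrates to the
  new mass of \<open>F\<close>. A point moves by at most \<open>2 c z = \<integral> D dz\<close>, on average \<open>2 \<integral> (1 - h) dq\<close>, which is the
  distance of \<open>q\<close> and \<open>\<pi>\<close>.
\<close>

lemma recentring_exists:
  assumes \<pi>: "\<pi> \<in> K" and q: "q \<in> K"
  obtains \<Phi> D where "\<And>z. z \<in> K \<Longrightarrow> \<Phi> z \<in> K"
    "\<And>z z'. z \<in> K \<Longrightarrow> z' \<in> K \<Longrightarrow> tv_dist (\<Phi> z) (\<Phi> z') \<le> 2 * tv_dist z z'"
    "D \<in> borel_measurable lam"
    "\<And>z. z \<in> K \<Longrightarrow> ennreal (tv_dist z (\<Phi> z)) \<le> (\<integral>\<^sup>+s. D s \<partial>z)"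
    "(\<integral>\<^sup>+s. D s \<partial>q) = ennreal (tv_dist q \<pi>)"
    "\<And>F. F \<in> sets lam \<Longrightarrow> \<exists>hF. hF \<in> borel_measurable lam \<and> (\<forall>z\<in>K. emeasure (\<Phi> z) F = (\<integral>\<^sup>+s. hF s \<partial>z)) \<and>
       (\<integral>\<^sup>+s. hF s \<partial>q) = emeasure \<pi> F"
proof -
  obtain f where f: "integrable lam f" "\<And>s. 0 \<le> f s" "q = density lam (\<lambda>s. ennreal (f s))"
    using fin_densE[OF prob_dens_fin_dens[OF q]] by blast
  obtain g where g: "integrable lam g" "\<And>s. 0 \<le> g s" "\<pi> = density lam (\<lambda>s. ennreal (g s))"
    using fin_densE[OF prob_dens_fin_dens[OF \<pi>]] by blast
  have fg1: "(\<integral>s. f s \<partial>lam) = 1" "(\<integral>s. g s \<partial>lam) = 1"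
    using mass_density_real[OF f(1,2)] mass_density_real[OF g(1,2)] mass_prob[OF q] mass_prob[OF \<pi>] f(3) g(3) by auto
  have [measurable]: "f \<in> borel_measurable lam" "g \<in> borel_measurable lam" using f g by auto
  define \<theta> where "\<theta> = (\<integral>s. max 0 (g s - f s) \<partial>lam)"
  have intm: "integrable lam (\<lambda>s. max 0 (g s - f s))" "integrable lam (\<lambda>s. max 0 (f s - g s))"
    using f g by (auto intro!: integrable_max)
  have \<theta>': "(\<integral>s. max 0 (f s - g s) \<partial>lam) = \<theta>"
  proof -
    have "(\<integral>s. max 0 (f s - g s) \<partial>lam) - \<theta> = (\<integral>s. max 0 (f s - g s) - max 0 (g s - f s) \<partial>lam)"
      unfolding \<theta>_def using intm by simp
    also have "\<dots> = (\<integral>s. f s - g s \<partial>lam)" by (rule Bochner_Integration.integral_cong) auto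
    also have "\<dots> = 0" using f g fg1 by simp
    finally show ?thesis by simp
  qed
  have tv\<theta>: "tv_dist q \<pi> = 2 * \<theta>"
  proof -
    have "tv_dist q \<pi> = (\<integral>s. \<bar>f s - g s\<bar> \<partial>lam)" unfolding f(3) g(3) by (rule tv_dist_density[OF f(1,2) g(1,2)])
    also have "\<dots> = (\<integral>s. max 0 (f s - g s) + max 0 (g s - f s) \<partial>lam)" by (rule Bochner_Integration.integral_cong) auto
    also have "\<dots> = 2 * \<theta>" using intm \<theta>' by (simp add: \<theta>_def)
    finally show ?thesis .
  qed
  have \<theta>0: "0 \<le> \<theta>" unfolding \<theta>_def by (rule integral_nonneg_AE) simp
  define h where "h s = (if f s \<le> g s then 1 else g s / f s)" for s
  have h01: "0 \<le> h s" "h s \<le> 1" for s using f(2)[of s] g(2)[of s] by (auto simp: h_def divide_le_eq_1)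
  have [measurable]: "h \<in> borel_measurable lam" unfolding h_def by measurable
  have fh: "f s * h s = min (f s) (g s)" "f s * (1 - h s) = max 0 (f s - g s)" for s
    using f(2)[of s] g(2)[of s] by (auto simp: h_def min_def max_def right_diff_distrib)
  \<comment> \<open>If \<open>\<theta> = 0\<close>, there is no excess and nothing is spread; any probability density serves.\<close>
  define r where "r s = (if \<theta> = 0 then g s else max 0 (g s - f s) / \<theta>)" for s
  have r0: "0 \<le> r s" for s using g(2) \<theta>0 by (simp add: r_def)
  have rint: "integrable lam r" and r1: "(\<integral>s. r s \<partial>lam) = 1"
  proof -
    have "integrable lam r \<and> (\<integral>s. r s \<partial>lam) = 1"
    proof (cases "\<theta> = 0")
      case True
      then have "r = g" by (auto simp: r_def)
      then show ?thesis using g(1) fg1(2) by simp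
    next
      case False
      then have "r = (\<lambda>s. max 0 (g s - f s) / \<theta>)" by (auto simp: r_def)
      then show ?thesis using intm(1) False by (simp add: \<theta>_def)
    qed
    then show "integrable lam r" "(\<integral>s. r s \<partial>lam) = 1" by auto
  qed
  have [measurable]: "r \<in> borel_measurable lam" using rint by auto
  have r1': "(\<integral>\<^sup>+s. ennreal (r s) \<partial>lam) = 1" using nn_integral_eq_integral[OF rint] r0 r1 by simp
  define dn where "dn z = (SOME \<phi>. integrable lam \<phi> \<and> (\<forall>s. 0 \<le> \<phi> s) \<and> z = density lam (\<lambda>s. ennreal (\<phi> s)))" for z
  have dn: "integrable lam (dn z)" "\<And>s. 0 \<le> dn z s" "z = density lam (\<lambda>s. ennreal (dn z s))" if z: "z \<in> K" for z
  proof -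
    have "\<exists>\<phi>. integrable lam \<phi> \<and> (\<forall>s. 0 \<le> \<phi> s) \<and> z = density lam (\<lambda>s. ennreal (\<phi> s))"
      using fin_densE[OF prob_dens_fin_dens[OF z]] by metis
    from someI_ex[OF this, folded dn_def] show "integrable lam (dn z)" "\<And>s. 0 \<le> dn z s" "z = density lam (\<lambda>s. ennreal (dn z s))" by auto
  qed
  have dn1: "(\<integral>s. dn z s \<partial>lam) = 1" if z: "z \<in> K" for z
    using mass_density_real[OF dn(1,2)[OF z]] mass_prob[OF z] dn(3)[OF z] by simp
  have inth: "integrable lam (\<lambda>s. dn z s * h s)" if z: "z \<in> K" for z
  proof (rule Bochner_Integration.integrable_bound[OF dn(1)[OF z]])
    show "AE s in lam. norm (dn z s * h s) \<le> norm (dn z s)"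
      using h01 by (simp add: abs_mult mult_left_le)
  qed (use dn(1)[OF z] in auto)
  define c where "c z = 1 - (\<integral>s. dn z s * h s \<partial>lam)" for z
  have c_alt: "c z = (\<integral>s. dn z s * (1 - h s) \<partial>lam)" if z: "z \<in> K" for z
    using dn1[OF z] dn(1)[OF z] inth[OF z] by (simp add: c_def right_diff_distrib)
  have c0: "0 \<le> c z" if z: "z \<in> K" for z
    unfolding c_alt[OF z] using dn(2)[OF z] h01 by (intro integral_nonneg_AE) simp
  have c_nn: "ennreal (c z) = (\<integral>\<^sup>+s. ennreal (1 - h s) \<partial>z)" if z: "z \<in> K" for z
  proof -
    have "integrable lam (\<lambda>s. dn z s * (1 - h s))"
      using dn(1)[OF z] inth[OF z] by (simp add: right_diff_distrib)
    then have "ennreal (c z) = (\<integral>\<^sup>+s. ennreal (dn z s * (1 - h s)) \<partial>lam)"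
      unfolding c_alt[OF z] using dn(2)[OF z] h01 by (intro nn_integral_eq_integral[symmetric]) auto
    also have "\<dots> = (\<integral>\<^sup>+s. ennreal (dn z s) * ennreal (1 - h s) \<partial>lam)"
      using dn(2)[OF z] h01 by (simp add: ennreal_mult)
    also have "\<dots> = (\<integral>\<^sup>+s. ennreal (1 - h s) \<partial>density lam (\<lambda>s. ennreal (dn z s)))"
      using dn(1)[OF z] by (subst nn_integral_density) auto
    finally show ?thesis using dn(3)[OF z] by simp
  qed
  define ph where "ph z s = dn z s * h s + c z * r s" for z s
  have ph: "integrable lam (ph z)" "\<And>s. 0 \<le> ph z s" "(\<integral>s. ph z s \<partial>lam) = 1" if z: "z \<in> K" for z
    using inth[OF z] rint dn(2)[OF z] h01 c0[OF z] r0 r1 unfolding ph_def by (auto simp: c_def)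
  define \<Phi> where "\<Phi> z = density lam (\<lambda>s. ennreal (ph z s))" for z
  show ?thesis
  proof (rule that[of \<Phi> "\<lambda>s. ennreal (2 * (1 - h s))"])
    show "\<Phi> z \<in> K" if z: "z \<in> K" for z
      unfolding \<Phi>_def using ph[OF z] by (intro density_in_prob_dens) (auto simp: nn_integral_eq_integral)
    show "tv_dist (\<Phi> z) (\<Phi> z') \<le> 2 * tv_dist z z'" if z: "z \<in> K" and z': "z' \<in> K" for z z'
    proof -
      let ?d = "\<lambda>s. \<bar>dn z s - dn z' s\<bar>"
      have tvz: "tv_dist z z' = (\<integral>s. ?d s \<partial>lam)"
        using tv_dist_density[OF dn(1,2)[OF z] dn(1,2)[OF z']] dn(3)[OF z] dn(3)[OF z'] by simp
      have intd: "integrable lam ?d" using dn(1)[OF z] dn(1)[OF z'] by auto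
      have cc: "\<bar>c z - c z'\<bar> \<le> tv_dist z z'"
      proof -
        have "\<bar>c z - c z'\<bar> = \<bar>\<integral>s. dn z' s * h s - dn z s * h s \<partial>lam\<bar>"
          using inth[OF z] inth[OF z'] by (simp add: c_def)
        also have "\<dots> \<le> (\<integral>s. \<bar>dn z' s * h s - dn z s * h s\<bar> \<partial>lam)" by (rule integral_abs_bound)
        also have "\<dots> \<le> (\<integral>s. ?d s \<partial>lam)"
        proof (rule integral_mono)
          show "integrable lam (\<lambda>s. \<bar>dn z' s * h s - dn z s * h s\<bar>)"
            using inth[OF z] inth[OF z'] by (intro integrable_abs Bochner_Integration.integrable_diff)
          show "\<bar>dn z' s * h s - dn z s * h s\<bar> \<le> ?d s" for s
            using h01 by (simp add: left_diff_distrib[symmetric] abs_mult mult_left_le abs_minus_commute)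
        qed (rule intd)
        finally show ?thesis by (simp add: tvz)
      qed
      have "tv_dist (\<Phi> z) (\<Phi> z') = (\<integral>s. \<bar>ph z s - ph z' s\<bar> \<partial>lam)"
        unfolding \<Phi>_def by (rule tv_dist_density[OF ph(1,2)[OF z] ph(1,2)[OF z']])
      also have "\<dots> \<le> (\<integral>s. ?d s + tv_dist z z' * r s \<partial>lam)"
      proof (rule integral_mono)
        fix s
        have "ph z s - ph z' s = (dn z s - dn z' s) * h s + (c z - c z') * r s" by (simp add: ph_def algebra_simps)
        then have "\<bar>ph z s - ph z' s\<bar> \<le> ?d s * h s + \<bar>c z - c z'\<bar> * r s"
          using abs_triangle_ineq[of "(dn z s - dn z' s) * h s" "(c z - c z') * r s"] h01 r0 by (simp add: abs_mult)
        also have "\<dots> \<le> ?d s + tv_dist z z' * r s"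
          using h01 r0 cc by (intro add_mono mult_left_le mult_right_mono) auto
        finally show "\<bar>ph z s - ph z' s\<bar> \<le> ?d s + tv_dist z z' * r s" .
      qed (use ph(1)[OF z] ph(1)[OF z'] intd rint in auto)
      also have "\<dots> = 2 * tv_dist z z'" using intd rint r1 by (simp add: tvz)
      finally show ?thesis .
    qed
    show "(\<lambda>s. ennreal (2 * (1 - h s))) \<in> borel_measurable lam" by measurable
    show "ennreal (tv_dist z (\<Phi> z)) \<le> (\<integral>\<^sup>+s. ennreal (2 * (1 - h s)) \<partial>z)" if z: "z \<in> K" for z
    proof -
      have i1: "integrable lam (\<lambda>s. dn z s * (1 - h s))"
        using dn(1)[OF z] inth[OF z] by (simp add: right_diff_distrib)
      have "tv_dist z (\<Phi> z) = (\<integral>s. \<bar>dn z s - ph z s\<bar> \<partial>lam)"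
        using tv_dist_density[OF dn(1,2)[OF z] ph(1,2)[OF z]] dn(3)[OF z] by (simp add: \<Phi>_def)
      also have "\<dots> \<le> (\<integral>s. dn z s * (1 - h s) + c z * r s \<partial>lam)"
      proof (rule integral_mono)
        fix s
        have "dn z s - ph z s = dn z s * (1 - h s) - c z * r s" by (simp add: ph_def algebra_simps)
        moreover have "0 \<le> dn z s * (1 - h s)" "0 \<le> c z * r s" using dn(2)[OF z] h01 c0[OF z] r0 by auto
        ultimately show "\<bar>dn z s - ph z s\<bar> \<le> dn z s * (1 - h s) + c z * r s" by simp
      qed (use dn(1)[OF z] ph(1)[OF z] i1 rint in auto)
      also have "\<dots> = 2 * c z" using i1 rint r1 by (simp add: c_alt[OF z])
      finally have "ennreal (tv_dist z (\<Phi> z)) \<le> 2 * ennreal (c z)"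
        using c0[OF z] by (metis ennreal_leI ennreal_mult ennreal_numeral zero_le_numeral)
      also have "\<dots> = (\<integral>\<^sup>+s. 2 * ennreal (1 - h s) \<partial>z)"
        unfolding c_nn[OF z] using fin_dens_sets[OF prob_dens_fin_dens[OF z]]
        by (intro nn_integral_cmult[symmetric]) (simp add: measurable_cong_sets[OF fin_dens_sets[OF prob_dens_fin_dens[OF z]] refl])
      also have "\<dots> = (\<integral>\<^sup>+s. ennreal (2 * (1 - h s)) \<partial>z)"
        by (simp only: ennreal_mult[OF zero_le_numeral diff_ge_0_iff_ge[THEN iffD2, OF h01(2)]] ennreal_numeral)
      finally show ?thesis .
    qed
    have qq: "(\<integral>\<^sup>+s. ennreal (k s) \<partial>q) = ennreal (\<integral>s. f s * k s \<partial>lam)"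
      if "k \<in> borel_measurable lam" "\<And>s. 0 \<le> k s" "integrable lam (\<lambda>s. f s * k s)" for k
    proof -
      have "(\<integral>\<^sup>+s. ennreal (k s) \<partial>q) = (\<integral>\<^sup>+s. ennreal (f s * k s) \<partial>lam)"
        unfolding f(3) using that f(2) by (subst nn_integral_density) (auto simp: ennreal_mult)
      also have "\<dots> = ennreal (\<integral>s. f s * k s \<partial>lam)"
        using that f(2) by (intro nn_integral_eq_integral) auto
      finally show ?thesis .
    qed
    have fk2: "f s * (2 * (1 - h s)) = 2 * max 0 (f s - g s)" for s
      using fh(2)[of s] by (simp add: algebra_simps)
    show "(\<integral>\<^sup>+s. ennreal (2 * (1 - h s)) \<partial>q) = ennreal (tv_dist q \<pi>)"
    proof -
      have "(\<integral>\<^sup>+s. ennreal (2 * (1 - h s)) \<partial>q) = ennreal (\<integral>s. f s * (2 * (1 - h s)) \<partial>lam)"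
      proof (rule qq)
        show "integrable lam (\<lambda>s. f s * (2 * (1 - h s)))" unfolding fk2 using intm by simp
      qed (use h01 in auto)
      then show ?thesis unfolding fk2 by (simp add: \<theta>' tv\<theta>)
    qed
    fix F assume F[measurable]: "F \<in> sets lam"
    define R where "R = (\<integral>s. indicator F s * r s \<partial>lam)"
    have iF: "integrable lam (\<lambda>s. indicator F s * k s)" if "integrable lam k" for k :: "'s \<Rightarrow> real"
      using integrable_mult_indicator[OF F that] by simp
    have R0: "0 \<le> R" unfolding R_def using r0 by (intro integral_nonneg_AE) simp
    let ?hF = "\<lambda>s. indicator F s * h s + R * (1 - h s)"
    have hF0: "0 \<le> ?hF s" for s using h01 R0 by simp
    have "emeasure (\<Phi> z) F = (\<integral>\<^sup>+s. ennreal (?hF s) \<partial>z)" if z: "z \<in> K" for z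
    proof -
      have i1: "integrable lam (\<lambda>s. dn z s * (1 - h s))"
        using dn(1)[OF z] inth[OF z] by (simp add: right_diff_distrib)
      have i2: "integrable lam (\<lambda>s. indicator F s * (dn z s * h s))" by (rule iF[OF inth[OF z]])
      have i3: "integrable lam (\<lambda>s. dn z s * ?hF s)"
      proof -
        have "integrable lam (\<lambda>s. indicator F s * (dn z s * h s) + R * (dn z s * (1 - h s)))" using i1 i2 by simp
        then show ?thesis by (rule Bochner_Integration.integrable_cong[THEN iffD1, rotated -1]) (auto simp: algebra_simps)
      qed
      have "measure (\<Phi> z) F = (\<integral>s. indicator F s * ph z s \<partial>lam)"
        unfolding \<Phi>_def by (rule measure_density_real[OF ph(1,2)[OF z] F])
      also have "\<dots> = (\<integral>s. indicator F s * (dn z s * h s) + c z * (indicator F s * r s) \<partial>lam)"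
        by (rule Bochner_Integration.integral_cong) (auto simp: ph_def algebra_simps)
      also have "\<dots> = (\<integral>s. indicator F s * (dn z s * h s) \<partial>lam) + c z * R"
        using i2 iF[OF rint] by (simp add: R_def)
      also have "\<dots> = (\<integral>s. indicator F s * (dn z s * h s) + R * (dn z s * (1 - h s)) \<partial>lam)"
        using i1 i2 by (simp add: c_alt[OF z])
      also have "\<dots> = (\<integral>s. dn z s * ?hF s \<partial>lam)"
        by (rule Bochner_Integration.integral_cong) (auto simp: algebra_simps)
      finally have mF: "measure (\<Phi> z) F = (\<integral>s. dn z s * ?hF s \<partial>lam)" .
      have "\<Phi> z \<in> K" by (rule \<open>\<And>z. z \<in> K \<Longrightarrow> \<Phi> z \<in> K\<close>[OF z])
      then have "emeasure (\<Phi> z) F = ennreal (\<integral>s. dn z s * ?hF s \<partial>lam)"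
        using mF finite_measure.emeasure_eq_measure[OF fin_dens_finite[OF prob_dens_fin_dens]] by metis
      also have "\<dots> = (\<integral>\<^sup>+s. ennreal (dn z s * ?hF s) \<partial>lam)"
        using i3 dn(2)[OF z] hF0 by (intro nn_integral_eq_integral[symmetric]) auto
      also have "\<dots> = (\<integral>\<^sup>+s. ennreal (dn z s) * ennreal (?hF s) \<partial>lam)"
        using dn(2)[OF z] hF0 by (intro nn_integral_cong ennreal_mult) auto
      also have "\<dots> = (\<integral>\<^sup>+s. ennreal (?hF s) \<partial>density lam (\<lambda>s. ennreal (dn z s)))"
        using dn(1)[OF z] by (subst nn_integral_density) auto
      finally show ?thesis using dn(3)[OF z] by simp
    qed
    moreover have "(\<integral>\<^sup>+s. ennreal (?hF s) \<partial>q) = emeasure \<pi> F"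
    proof -
      have eq: "f s * ?hF s = indicator F s * min (f s) (g s) + R * max 0 (f s - g s)" for s
      proof -
        have "f s * ?hF s = indicator F s * (f s * h s) + R * (f s * (1 - h s))" by (simp add: algebra_simps)
        then show ?thesis by (simp only: fh)
      qed
      have imin: "integrable lam (\<lambda>s. min (f s) (g s))" using f g by (intro integrable_min) auto
      have i: "integrable lam (\<lambda>s. f s * ?hF s)" unfolding eq using iF[OF imin] intm by simp
      have R\<theta>: "R * \<theta> = (\<integral>s. indicator F s * max 0 (g s - f s) \<partial>lam)"
      proof (cases "\<theta> = 0")
        case True
        have "(\<integral>s. indicator F s * max 0 (g s - f s) \<partial>lam) \<le> (\<integral>s. max 0 (g s - f s) \<partial>lam)"
          using iF[OF intm(1)] intm by (intro integral_mono) (auto simp: indicator_def)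
        moreover have "0 \<le> (\<integral>s. indicator F s * max 0 (g s - f s) \<partial>lam)" by (intro integral_nonneg_AE) simp
        ultimately have "(\<integral>s. indicator F s * max 0 (g s - f s) \<partial>lam) = 0"
          using True unfolding \<theta>_def by linarith
        then show ?thesis using True by simp
      next
        case False
        have "R = (\<integral>s. (indicator F s * max 0 (g s - f s)) / \<theta> \<partial>lam)"
          unfolding R_def using False by (intro Bochner_Integration.integral_cong) (auto simp: r_def)
        then show ?thesis using False by simp
      qed
      have "(\<integral>\<^sup>+s. ennreal (?hF s) \<partial>q) = ennreal (\<integral>s. f s * ?hF s \<partial>lam)"
        using hF0 i by (intro qq) auto
      also have "(\<integral>s. f s * ?hF s \<partial>lam) = (\<integral>s. indicator F s * min (f s) (g s) \<partial>lam) + R * \<theta>"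
        unfolding eq using iF[OF imin] intm by (simp add: \<theta>')
      also have "\<dots> = (\<integral>s. indicator F s * min (f s) (g s) + indicator F s * max 0 (g s - f s) \<partial>lam)"
        unfolding R\<theta> using iF[OF imin] iF[OF intm(1)] by simp
      also have "\<dots> = (\<integral>s. indicator F s * g s \<partial>lam)"
        by (rule Bochner_Integration.integral_cong) (auto simp: indicator_def)
      also have "\<dots> = measure \<pi> F" unfolding g(3) by (rule measure_density_real[OF g(1,2) F, symmetric])
      finally show ?thesis
        using finite_measure.emeasure_eq_measure[OF fin_dens_finite[OF prob_dens_fin_dens[OF \<pi>]]] by simp
    qed
    ultimately show "\<exists>hF. hF \<in> borel_measurable lam \<and> (\<forall>z\<in>K. emeasure (\<Phi> z) F = (\<integral>\<^sup>+s. hF s \<partial>z)) \<and>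
       (\<integral>\<^sup>+s. hF s \<partial>q) = emeasure \<pi> F"
      by (intro exI[of _ "\<lambda>s. ennreal (?hF s)"]) auto
  qed
qed

end

section \<open>Contraction between measures with the stationary barycentre\<close>

locale ergodic_model = regular_model lam \<tau> m
  for lam :: "'s::polish_space measure" and \<tau> :: "'a::polish_space measure" and m +
  fixes \<pi> :: "'s measure"
  assumes ergodic: "strongly_ergodic_hmm lam \<tau> m \<pi>"
begin

lemma pi_prob: "\<pi> \<in> space (prob_algebra lam)"
  using ergodic by (simp add: strongly_ergodic_hmm_def)

lemma tv_kernel_power_tendsto: "(\<lambda>n. tv_dist (S.Qn n s) \<pi>) \<longlonglongrightarrow> 0"
  using ergodic by (simp add: strongly_ergodic_hmm_def)

lemma measure_kernel_power_tendsto: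
  assumes F: "F \<in> sets lam" shows "(\<lambda>n. measure (S.Qn n s) F) \<longlonglongrightarrow> measure \<pi> F"
proof -
  have "\<bar>measure (S.Qn n s) F - measure \<pi> F\<bar> \<le> tv_dist (S.Qn n s) \<pi>" for n
    using measure_diff_le_tv_dist[of "S.Qn n s" \<pi> F] F prob_algebraD[OF S.kernel_power_in_space[of s n]]
      prob_algebraD[OF pi_prob] by (simp add: prob_space_def)
  then have "(\<lambda>n. measure (S.Qn n s) F - measure \<pi> F) \<longlonglongrightarrow> 0"
    by (intro Lim_null_comparison[OF always_eventually tv_kernel_power_tendsto]) auto
  then show ?thesis by (simp add: LIM_zero_iff)
qed

lemma pi_in_K: "\<pi> \<in> K"
  by (rule tv_limit_in_prob_dens[where x="\<lambda>n. S.Qn (Suc n) undefined", OF sigma_finite_lam kernel_power_in_K])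
    (use prob_algebraD[OF pi_prob] LIMSEQ_Suc[OF measure_kernel_power_tendsto] in auto)

lemma measure_bind_trans_kernel:
  assumes q: "q \<in> space (prob_algebra lam)" and F: "F \<in> sets lam"
  shows "measure (q \<bind> Tk) F = (\<integral>s. measure (Tk s) F \<partial>q)"
proof -
  interpret q: prob_space q by (rule prob_algebraD(1)[OF q])
  show ?thesis
    using F by (intro q.measure_bind) (simp_all add: measurable_from_prob[OF q])
qed

lemma pi_invariant: "\<pi> \<bind> Tk = \<pi>"
proof (rule measure_eqI)
  show s: "sets (\<pi> \<bind> Tk) = sets \<pi>"
    using sets_bind'[OF pi_prob trans_kernel_measurable] prob_algebraD(2)[OF pi_prob] by simp
  interpret p: prob_space \<pi> by (rule prob_algebraD(1)[OF pi_prob])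
  interpret b: prob_space "\<pi> \<bind> Tk" by (rule prob_space_bind'[OF pi_prob trans_kernel_measurable])
  fix F assume "F \<in> sets (\<pi> \<bind> Tk)"
  then have F: "F \<in> sets lam" using sets_bind'[OF pi_prob trans_kernel_measurable] by simp
  let ?s = undefined and ?h = "\<lambda>s. measure (Tk s) F"
  have h: "?h \<in> borel_measurable lam"
    by (rule measurable_compose[OF S.kernel_subprob measurable_measure_subprob_algebra[OF F]])
  have "\<bar>measure (S.Qn (Suc n) ?s \<bind> Tk) F - measure (\<pi> \<bind> Tk) F\<bar> \<le> tv_dist (S.Qn (Suc n) ?s) \<pi>" for n
    unfolding measure_bind_trans_kernel[OF prob_dens_prob_algebra[OF kernel_power_in_K] F] measure_bind_trans_kernel[OF pi_prob F]
    using prob_space.prob_le_1[OF prob_dens_prob_space[OF trans_kernel_in_K]]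
    by (intro integral_diff_le_tv_dist prob_dens_fin_dens kernel_power_in_K pi_in_K h) auto
  then have "(\<lambda>n. measure (S.Qn (Suc n) ?s \<bind> Tk) F - measure (\<pi> \<bind> Tk) F) \<longlonglongrightarrow> 0"
    by (intro Lim_null_comparison[OF always_eventually LIMSEQ_Suc[OF tv_kernel_power_tendsto]]) auto
  moreover have "S.Qn (Suc n) ?s \<bind> Tk = S.Qn (Suc (Suc n)) ?s" for n
    using S.kernel_power_add[of ?s "Suc n" "Suc 0"] by (simp add: kernel_power.simps(2)[abs_def] del: kernel_power.simps)
  ultimately have "(\<lambda>n. measure (S.Qn (Suc (Suc n)) ?s) F) \<longlonglongrightarrow> measure (\<pi> \<bind> Tk) F"
    by (simp add: LIM_zero_iff del: kernel_power.simps)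
  moreover have "(\<lambda>n. measure (S.Qn (Suc (Suc n)) ?s) F) \<longlonglongrightarrow> measure \<pi> F"
    by (rule LIMSEQ_Suc[OF LIMSEQ_Suc[OF measure_kernel_power_tendsto[OF F]]])
  ultimately have "measure (\<pi> \<bind> Tk) F = measure \<pi> F" by (rule LIMSEQ_unique)
  then show "emeasure (\<pi> \<bind> Tk) F = emeasure \<pi> F" by (simp add: p.emeasure_eq_measure b.emeasure_eq_measure)
qed

lemma pi_bind_kernel_power: "\<pi> \<bind> S.Qn n = \<pi>"
proof (induction n)
  case 0
  then show ?case using prob_algebraD(2)[OF pi_prob] by (simp add: kernel_power.simps(1)[abs_def] bind_return'')
next
  case (Suc n)
  then show ?case
    using S.bind_kernel_power_add[OF pi_prob, of n "Suc 0"] pi_invariant by (simp add: kernel_power.simps(2)[abs_def])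
qed

text \<open>
  The index is shifted to start with the first power of the kernel.
\<close>

definition err :: "nat \<Rightarrow> 's measure \<Rightarrow> real" where
  "err k q = (\<integral>s. tv_dist (S.Qn (Suc k) s) \<pi> \<partial>q)"

lemma tv_kernel_le_2: "tv_dist (S.Qn n s) \<pi> \<le> 2"
  using prob_algebraD(1)[OF S.kernel_power_in_space[of s n]] prob_algebraD(1)[OF pi_prob]
  by (intro tv_dist_prob_le_2) simp_all

lemma tv_kernel_measurable: "(\<lambda>s. tv_dist (S.Qn (Suc k) s) \<pi>) \<in> borel_measurable lam"
  by (rule tv_bind_kernel_power_le(1)[OF pi_prob pi_in_K])

lemma err_nn:
  assumes "q \<in> space (prob_algebra lam)"
  shows "(\<integral>\<^sup>+s. ennreal (tv_dist (S.Qn (Suc k) s) \<pi>) \<partial>q) = ennreal (err k q)"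
  unfolding err_def
  using prob_integrable_bounded[OF assms tv_kernel_measurable[of k], of 2] tv_kernel_le_2
  by (intro nn_integral_eq_integral) (auto simp: tv_dist_nonneg)

lemma err_nonneg: "0 \<le> err k q"
  unfolding err_def by (intro integral_nonneg_AE) (simp add: tv_dist_nonneg)

lemma tv_bind_le_err:
  assumes "q \<in> space (prob_algebra lam)" shows "tv_dist (q \<bind> S.Qn (Suc k)) \<pi> \<le> err k q"
  using tv_bind_kernel_power_le(2)[OF assms pi_in_K, of k] err_nn[OF assms] err_nonneg by simp

lemma err_tendsto_0:
  assumes q: "q \<in> space (prob_algebra lam)" shows "(\<lambda>k. err k q) \<longlonglongrightarrow> 0"
proof -
  interpret q: prob_space q by (rule prob_algebraD(1)[OF q])
  have "(\<lambda>k. \<integral>s. tv_dist (S.Qn (Suc k) s) \<pi> \<partial>q) \<longlonglongrightarrow> (\<integral>s. 0 \<partial>q)"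
  proof (rule integral_dominated_convergence[where w="\<lambda>_. 2"])
    show "AE s in q. (\<lambda>k. tv_dist (S.Qn (Suc k) s) \<pi>) \<longlonglongrightarrow> 0"
      using LIMSEQ_Suc[OF tv_kernel_power_tendsto] by simp
    show "AE s in q. norm (tv_dist (S.Qn (Suc k) s) \<pi>) \<le> 2" for k
      using tv_kernel_le_2 by (simp add: tv_dist_nonneg del: kernel_power.simps)
    show "(\<lambda>s. tv_dist (S.Qn (Suc k) s) \<pi>) \<in> borel_measurable q" for k
      using tv_kernel_measurable measurable_from_prob[OF q] by blast
  qed auto
  then show ?thesis by (simp add: err_def)
qed

abbreviation "PB \<equiv> prob_with_barycenter lam \<pi>"

lemma PB_iff: "\<mu> \<in> PB \<longleftrightarrow> \<mu> \<in> space (prob_algebra FS) \<and> bary \<mu> = \<pi>"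
  using barycenter_eq by (auto simp: prob_with_barycenter_def)

text \<open>
  The image of \<open>\<mu>\<close> under the map \<open>\<Phi>\<close> of \<open>recentring_exists\<close> has barycentre \<open>\<pi>\<close>, and the map moves
  points by at most the distance of the barycentre of \<open>\<mu>\<close> and \<open>\<pi>\<close> on average.
\<close>

lemma recentre:
  assumes \<mu>: "\<mu> \<in> space (prob_algebra FS)"
  obtains \<mu>' where "\<mu>' \<in> PB"
    "\<And>v c B. lipschitz K tv_dist c v \<Longrightarrow> 0 \<le> c \<Longrightarrow> (\<And>x. x \<in> K \<Longrightarrow> \<bar>v x\<bar> \<le> B) \<Longrightarrow>
      \<bar>(\<integral>z. v z \<partial>\<mu>) - (\<integral>z. v z \<partial>\<mu>')\<bar> \<le> c * tv_dist (bary \<mu>) \<pi>"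
proof -
  note bK = bary_in_K[OF \<mu>]
  from recentring_exists[OF pi_in_K bK] obtain \<Phi> D where
    \<Phi>K: "\<And>z. z \<in> K \<Longrightarrow> \<Phi> z \<in> K"
    and \<Phi>L: "\<And>z z'. z \<in> K \<Longrightarrow> z' \<in> K \<Longrightarrow> tv_dist (\<Phi> z) (\<Phi> z') \<le> 2 * tv_dist z z'"
    and D: "D \<in> borel_measurable lam"
    and \<Phi>D: "\<And>z. z \<in> K \<Longrightarrow> ennreal (tv_dist z (\<Phi> z)) \<le> (\<integral>\<^sup>+s. D s \<partial>z)"
    and Dq: "(\<integral>\<^sup>+s. D s \<partial>bary \<mu>) = ennreal (tv_dist (bary \<mu>) \<pi>)"
    and \<Phi>b: "\<And>F. F \<in> sets lam \<Longrightarrow> \<exists>hF. hF \<in> borel_measurable lam \<and>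
       (\<forall>z\<in>K. emeasure (\<Phi> z) F = (\<integral>\<^sup>+s. hF s \<partial>z)) \<and> (\<integral>\<^sup>+s. hF s \<partial>bary \<mu>) = emeasure \<pi> F"
    by blast
  have vPhi: "lipschitz K tv_dist (c * 2) (\<lambda>x. v (\<Phi> x))" if "lipschitz K tv_dist c v" "0 \<le> c" for v c
    unfolding lipschitz_def
  proof (intro ballI)
    fix x y assume xy: "x \<in> K" "y \<in> K"
    have "\<bar>v (\<Phi> x) - v (\<Phi> y)\<bar> \<le> c * tv_dist (\<Phi> x) (\<Phi> y)" using that \<Phi>K xy by (simp add: lipschitz_def)
    also have "\<dots> \<le> c * (2 * tv_dist x y)" using \<Phi>L xy that by (intro mult_left_mono) auto
    finally show "\<bar>v (\<Phi> x) - v (\<Phi> y)\<bar> \<le> c * 2 * tv_dist x y" by simp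
  qed
  have \<Phi>m: "\<Phi> \<in> FS \<rightarrow>\<^sub>M FS"
    using \<Phi>K Km.lipschitz_borel_measurable[OF vPhi] by (intro Km.measurable_metric_borelI) auto
  have \<Phi>m': "\<Phi> \<in> \<mu> \<rightarrow>\<^sub>M FS" using \<Phi>m measurable_from_prob[OF \<mu>] by blast
  interpret \<mu>: prob_space \<mu> by (rule prob_algebraD(1)[OF \<mu>])
  let ?\<mu>' = "distr \<mu> FS \<Phi>"
  have \<mu>': "?\<mu>' \<in> space (prob_algebra FS)"
    using \<mu>.prob_space_distr[OF \<Phi>m'] by (simp add: space_prob_algebra)
  show ?thesis
  proof
    have "bary ?\<mu>' = \<pi>"
    proof (rule measure_eqI)
      show s: "sets (bary ?\<mu>') = sets \<pi>"
        using prob_algebraD(2)[OF bary_prob[OF \<mu>']] prob_algebraD(2)[OF pi_prob] by simp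
      fix F assume "F \<in> sets (bary ?\<mu>')"
      then have F: "F \<in> sets lam" using s prob_algebraD(2)[OF pi_prob] by simp
      then obtain hF where hF: "hF \<in> borel_measurable lam" "\<And>z. z \<in> K \<Longrightarrow> emeasure (\<Phi> z) F = (\<integral>\<^sup>+s. hF s \<partial>z)"
        "(\<integral>\<^sup>+s. hF s \<partial>bary \<mu>) = emeasure \<pi> F" using \<Phi>b by blast
      have "emeasure (bary ?\<mu>') F = (\<integral>\<^sup>+z. emeasure (\<Phi> z) F \<partial>\<mu>)"
        unfolding emeasure_bary[OF \<mu>' F]
        using measurable_compose[OF id_measurable_subprob measurable_emeasure_subprob_algebra[OF F]]
        by (intro nn_integral_distr[OF \<Phi>m']) simp
      also have "\<dots> = (\<integral>\<^sup>+z. (\<integral>\<^sup>+s. hF s \<partial>z) \<partial>\<mu>)"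
        using prob_algebraD(3)[OF \<mu>] hF(2) by (intro nn_integral_cong) simp
      also have "\<dots> = emeasure \<pi> F" using nn_integral_bary[OF \<mu> hF(1)] hF(3) by simp
      finally show "emeasure (bary ?\<mu>') F = emeasure \<pi> F" .
    qed
    then show "?\<mu>' \<in> PB" using \<mu>' by (simp add: PB_iff)
    fix v c B assume v: "lipschitz K tv_dist c v" "0 \<le> c" "\<And>x. x \<in> K \<Longrightarrow> \<bar>v x\<bar> \<le> B"
    have vm: "v \<in> borel_measurable FS" by (rule Km.lipschitz_borel_measurable[OF v(1)])
    have i1: "integrable \<mu> v" using prob_integrable_bounded[OF \<mu> vm, of B] v(3) by simp
    have i2: "integrable \<mu> (\<lambda>z. v (\<Phi> z))"
      using prob_integrable_bounded[OF \<mu> measurable_compose[OF \<Phi>m vm], of B] v(3) \<Phi>K by simp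
    have "ennreal \<bar>(\<integral>z. v z \<partial>\<mu>) - (\<integral>z. v z \<partial>?\<mu>')\<bar> = ennreal (norm (\<integral>z. v z - v (\<Phi> z) \<partial>\<mu>))"
      using i1 i2 integral_distr[OF \<Phi>m' vm] by simp
    also have "\<dots> \<le> (\<integral>\<^sup>+z. ennreal (norm (v z - v (\<Phi> z))) \<partial>\<mu>)"
      using i1 i2 by (intro integral_norm_bound_ennreal) simp
    also have "\<dots> \<le> (\<integral>\<^sup>+z. ennreal c * (\<integral>\<^sup>+s. D s \<partial>z) \<partial>\<mu>)"
    proof (rule nn_integral_mono)
      fix z assume "z \<in> space \<mu>"
      then have z: "z \<in> K" using prob_algebraD(3)[OF \<mu>] by simp
      have "ennreal (norm (v z - v (\<Phi> z))) \<le> ennreal (c * tv_dist z (\<Phi> z))"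
        using v z \<Phi>K[OF z] by (intro ennreal_leI) (simp add: lipschitz_def)
      also have "\<dots> = ennreal c * ennreal (tv_dist z (\<Phi> z))" using v by (simp add: ennreal_mult tv_dist_nonneg)
      also have "\<dots> \<le> ennreal c * (\<integral>\<^sup>+s. D s \<partial>z)" using \<Phi>D[OF z] by (rule mult_left_mono) simp
      finally show "ennreal (norm (v z - v (\<Phi> z))) \<le> ennreal c * (\<integral>\<^sup>+s. D s \<partial>z)" .
    qed
    also have "\<dots> = ennreal c * ennreal (tv_dist (bary \<mu>) \<pi>)"
      unfolding Dq[symmetric] nn_integral_bary[OF \<mu> D]
      using measurable_compose[OF id_measurable_subprob nn_integral_measurable_subprob_algebra[OF D]]
      by (intro nn_integral_cmult) (simp add: measurable_from_prob[OF \<mu>])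
    finally show "\<bar>(\<integral>z. v z \<partial>\<mu>) - (\<integral>z. v z \<partial>?\<mu>')\<bar> \<le> c * tv_dist (bary \<mu>) \<pi>"
      using v(2) by (simp add: ennreal_mult[symmetric] tv_dist_nonneg)
  qed
qed

definition mean_after :: "nat \<Rightarrow> ('s measure \<Rightarrow> real) \<Rightarrow> 's measure \<Rightarrow> real" where
  "mean_after n u x = (\<integral>z. u z \<partial>P.Qn n x)"

lemma Lip1_bound:
  assumes "u \<in> Lip1 K tv_dist" obtains B where "\<And>x. x \<in> K \<Longrightarrow> \<bar>u x\<bar> \<le> B"
  using assms bounded_imageE unfolding Lip1_iff by metis

lemma Lip1_measurable: "u \<in> Lip1 K tv_dist \<Longrightarrow> u \<in> borel_measurable FS"
  by (rule Km.lipschitz_borel_measurable[of 1]) (simp add: Lip1_iff)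

lemma mean_after_lipschitz: "u \<in> Lip1 K tv_dist \<Longrightarrow> lipschitz K tv_dist 4 (mean_after n u)"
  using kernel_power_lipschitz[of u n] by (simp add: mean_after_def[abs_def] Lip1_iff)

lemma mean_after_measurable: "u \<in> Lip1 K tv_dist \<Longrightarrow> mean_after n u \<in> borel_measurable FS"
  by (rule Km.lipschitz_borel_measurable[OF mean_after_lipschitz])

lemma prob_integral_bound:
  assumes "\<mu> \<in> space (prob_algebra X)" "u \<in> borel_measurable X" "\<And>x. x \<in> space X \<Longrightarrow> \<bar>u x\<bar> \<le> (B::real)"
  shows "\<bar>\<integral>x. u x \<partial>\<mu>\<bar> \<le> B"
proof -
  interpret prob_space \<mu> by (rule prob_algebraD(1)[OF assms(1)])
  have "\<bar>\<integral>x. u x \<partial>\<mu>\<bar> \<le> (\<integral>x. \<bar>u x\<bar> \<partial>\<mu>)" by (rule integral_abs_bound)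
  also have "\<dots> \<le> (\<integral>x. B \<partial>\<mu>)"
    using prob_integrable_bounded[OF assms] assms(3) prob_algebraD(3)[OF assms(1)] by (intro integral_mono) auto
  finally show ?thesis by (simp add: prob_space)
qed

lemma mean_after_bound:
  assumes "u \<in> Lip1 K tv_dist" "\<And>x. x \<in> K \<Longrightarrow> \<bar>u x\<bar> \<le> B" "x \<in> K" shows "\<bar>mean_after n u x\<bar> \<le> B"
  unfolding mean_after_def using assms by (intro prob_integral_bound[OF prob_kernel_power Lip1_measurable]) auto

lemma integral_mean_after:
  assumes \<mu>: "\<mu> \<in> space (prob_algebra FS)" and u: "u \<in> Lip1 K tv_dist"
  shows "(\<integral>z. u z \<partial>(\<mu> \<bind> P.Qn n)) = (\<integral>x. mean_after n u x \<partial>\<mu>)"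
proof -
  obtain B where B: "\<And>x. x \<in> K \<Longrightarrow> \<bar>u x\<bar> \<le> B" using Lip1_bound[OF u] by blast
  show ?thesis unfolding mean_after_def using P.integral_bind_kernel_power[OF \<mu> Lip1_measurable[OF u], of B n] B by simp
qed

lemma integral_mean_after_add:
  assumes \<mu>: "\<mu> \<in> space (prob_algebra FS)" and u: "u \<in> Lip1 K tv_dist"
  shows "(\<integral>x. mean_after (k + l) u x \<partial>\<mu>) = (\<integral>x. mean_after l u x \<partial>(\<mu> \<bind> P.Qn k))"
  using integral_mean_after[OF \<mu> u, of "k + l"] integral_mean_after[OF P.bind_kernel_power_in_space[OF \<mu>, of k] u, of l]
    P.bind_kernel_power_add[OF \<mu>, of k l] by simp

lemma recentre_after:
  assumes \<mu>: "\<mu> \<in> space (prob_algebra FS)"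
  obtains \<mu>' where "\<mu>' \<in> PB"
    "\<And>u l. u \<in> Lip1 K tv_dist \<Longrightarrow> \<bar>(\<integral>x. mean_after (Suc k + l) u x \<partial>\<mu>) - (\<integral>x. mean_after l u x \<partial>\<mu>')\<bar> \<le> 4 * err k (bary \<mu>)"
proof -
  have \<mu>k: "\<mu> \<bind> P.Qn (Suc k) \<in> space (prob_algebra FS)" by (rule P.bind_kernel_power_in_space[OF \<mu>])
  obtain \<mu>' where \<mu>': "\<mu>' \<in> PB"
    "\<And>v c B. lipschitz K tv_dist c v \<Longrightarrow> 0 \<le> c \<Longrightarrow> (\<And>x. x \<in> K \<Longrightarrow> \<bar>v x\<bar> \<le> B) \<Longrightarrow>
      \<bar>(\<integral>z. v z \<partial>(\<mu> \<bind> P.Qn (Suc k))) - (\<integral>z. v z \<partial>\<mu>')\<bar> \<le> c * tv_dist (bary (\<mu> \<bind> P.Qn (Suc k))) \<pi>"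
    using recentre[OF \<mu>k] by blast
  have le: "tv_dist (bary (\<mu> \<bind> P.Qn (Suc k))) \<pi> \<le> err k (bary \<mu>)"
    unfolding bary_bind_kernel_power[OF \<mu>] by (rule tv_bind_le_err[OF bary_prob[OF \<mu>]])
  show ?thesis
  proof (rule that[OF \<mu>'(1)])
    fix u l assume u: "u \<in> Lip1 K tv_dist"
    obtain B where B: "\<And>x. x \<in> K \<Longrightarrow> \<bar>u x\<bar> \<le> B" using Lip1_bound[OF u] by blast
    have "\<bar>(\<integral>z. mean_after l u z \<partial>(\<mu> \<bind> P.Qn (Suc k))) - (\<integral>z. mean_after l u z \<partial>\<mu>')\<bar> \<le> 4 * tv_dist (bary (\<mu> \<bind> P.Qn (Suc k))) \<pi>"
      by (rule \<mu>'(2)[OF mean_after_lipschitz[OF u] _ mean_after_bound[OF u B]]) auto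
    then show "\<bar>(\<integral>x. mean_after (Suc k + l) u x \<partial>\<mu>) - (\<integral>x. mean_after l u x \<partial>\<mu>')\<bar> \<le> 4 * err k (bary \<mu>)"
      unfolding integral_mean_after_add[OF \<mu> u] using le by linarith
  qed
qed

text \<open>
  A bound, after \<open>l\<close> steps of the filter, on how well 1-Lipschitz functions can tell two initial
  laws with barycentre \<open>\<pi>\<close> apart.
\<close>

definition oscillation_le :: "nat \<Rightarrow> real \<Rightarrow> bool" where
  "oscillation_le l c \<longleftrightarrow> (\<forall>u\<in>Lip1 K tv_dist. \<forall>\<mu>\<in>PB. \<forall>\<nu>\<in>PB. (\<integral>x. mean_after l u x \<partial>\<mu>) - (\<integral>x. mean_after l u x \<partial>\<nu>) \<le> c)"

text \<open>
  A 4-Lipschitz function deviates by at most 8 from its value at a given point, as \<open>K\<close> has diameter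
  at most 2.
\<close>

lemma oscillation_le_16: "oscillation_le l 16"
  unfolding oscillation_le_def
proof (intro ballI)
  fix u \<mu> \<nu> assume u: "u \<in> Lip1 K tv_dist" and \<mu>: "\<mu> \<in> PB" and \<nu>: "\<nu> \<in> PB"
  obtain x0 where x0: "x0 \<in> K" using K_nonempty by blast
  let ?w = "\<lambda>x. mean_after l u x - mean_after l u x0"
  have wb: "\<bar>?w x\<bar> \<le> 8" if "x \<in> K" for x
    using mean_after_lipschitz[OF u, of l] that x0 tv_dist_prob_le_2[of x x0] prob_dens_prob_space
    unfolding lipschitz_def by fastforce
  have "\<bar>(\<integral>x. mean_after l u x \<partial>\<mu>) - mean_after l u x0\<bar> \<le> 8" if "\<mu> \<in> PB" for \<mu>
  proof -
    have \<mu>: "\<mu> \<in> space (prob_algebra FS)" using that by (simp add: PB_iff)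
    interpret prob_space \<mu> by (rule prob_algebraD(1)[OF \<mu>])
    obtain B where B: "\<And>x. x \<in> K \<Longrightarrow> \<bar>u x\<bar> \<le> B" using Lip1_bound[OF u] by blast
    have "integrable \<mu> (mean_after l u)"
      using prob_integrable_bounded[OF \<mu> mean_after_measurable[OF u], where B=B] mean_after_bound[OF u B] by simp
    then have "(\<integral>x. mean_after l u x \<partial>\<mu>) - mean_after l u x0 = (\<integral>x. ?w x \<partial>\<mu>)" by (simp add: prob_space)
    then show ?thesis using prob_integral_bound[OF \<mu>, of ?w 8] mean_after_measurable[OF u] wb by simp
  qed
  from this[OF \<mu>] this[OF \<nu>] show "(\<integral>x. mean_after l u x \<partial>\<mu>) - (\<integral>x. mean_after l u x \<partial>\<nu>) \<le> 16" by linarith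
qed

text \<open>
  Let \<open>G\<close> be the event that the coupled filters are closer than \<open>\<rho>\<close>, and \<open>\<beta> \<le> 1 - \<alpha>\<close> the probability of
  its complement. On \<open>G\<close> the difference is at most \<open>4\<rho>\<close>. The marginals conditioned on the complement have
  densities at most \<open>1 / \<beta>\<close> with respect to \<open>\<mu> P\<^sup>N\<close> and \<open>\<nu> P\<^sup>N\<close>, whose barycentre is \<open>\<pi>\<close>; hence recentring them after
  \<open>k + 1\<close> steps costs at most \<open>4 err k \<pi> / \<beta>\<close> each, and the factor \<open>\<beta>\<close> of the event cancels the
  denominator. Altogether this gives \<open>4\<rho>(1 - \<beta>) + \<beta> c + 8 err k \<pi>\<close>.
\<close>

lemma oscillation_le_step:
  assumes c: "oscillation_le l c" "4 * \<rho> \<le> c" and \<rho>: "0 < \<rho>" and \<alpha>: "0 < \<alpha>"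
    and E: "\<forall>\<mu>\<in>PB. \<forall>\<nu>\<in>PB. \<exists>\<kappa>. coupling (\<mu> \<bind> P.Qn N) (\<nu> \<bind> P.Qn N) \<kappa> \<and>
              measure \<kappa> {(x, y) \<in> K \<times> K. tv_dist x y < \<rho>} \<ge> \<alpha>"
  shows "oscillation_le (N + (Suc k + l)) (4 * \<rho> + (1 - \<alpha>) * (c - 4 * \<rho>) + 8 * err k \<pi>)"
  unfolding oscillation_le_def
proof (intro ballI)
  fix u \<mu> \<nu> assume u: "u \<in> Lip1 K tv_dist" and \<mu>: "\<mu> \<in> PB" and \<nu>: "\<nu> \<in> PB"
  let ?\<mu>1 = "\<mu> \<bind> P.Qn N" and ?\<nu>1 = "\<nu> \<bind> P.Qn N"
  define g where "g = mean_after (Suc k + l) u"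
  have \<mu>p: "\<mu> \<in> space (prob_algebra FS)" and \<nu>p: "\<nu> \<in> space (prob_algebra FS)" using \<mu> \<nu> by (auto simp: PB_iff)
  have 1: "?\<mu>1 \<in> space (prob_algebra FS)" "?\<nu>1 \<in> space (prob_algebra FS)"
    using P.bind_kernel_power_in_space \<mu>p \<nu>p by auto
  have b1: "bary ?\<mu>1 = \<pi>" "bary ?\<nu>1 = \<pi>"
    using bary_bind_kernel_power[OF \<mu>p] bary_bind_kernel_power[OF \<nu>p] \<mu> \<nu> pi_bind_kernel_power by (auto simp: PB_iff)
  obtain \<kappa> where \<kappa>: "coupling ?\<mu>1 ?\<nu>1 \<kappa>" "measure \<kappa> {(x, y) \<in> K \<times> K. tv_dist x y < \<rho>} \<ge> \<alpha>"
    using E \<mu> \<nu> by blast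
  define G where "G = {(x, y) \<in> K \<times> K. tv_dist x y < \<rho>}"
  have "prob_space \<kappa>" and sk: "sets \<kappa> = sets (?\<mu>1 \<Otimes>\<^sub>M ?\<nu>1)"
    and d1: "distr \<kappa> ?\<mu>1 fst = ?\<mu>1" and d2: "distr \<kappa> ?\<nu>1 snd = ?\<nu>1"
    using \<kappa>(1) by (auto simp: coupling_def space_prob_algebra)
  have sk': "sets \<kappa> = sets (FS \<Otimes>\<^sub>M FS)"
    unfolding sk by (intro sets_pair_measure_cong prob_algebraD(2) 1)
  interpret \<kappa>: prob_space \<kappa> by fact
  have spk: "space \<kappa> = K \<times> K" using sets_eq_imp_space_eq[OF sk'] by (simp add: space_pair_measure)
  have fst_m: "fst \<in> \<kappa> \<rightarrow>\<^sub>M FS" and snd_m: "snd \<in> \<kappa> \<rightarrow>\<^sub>M FS"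
    using measurable_cong_sets[OF sk' refl] measurable_fst measurable_snd by blast+
  have d1': "distr \<kappa> FS fst = ?\<mu>1" and d2': "distr \<kappa> FS snd = ?\<nu>1"
    using d1 d2 distr_cong[OF refl prob_algebraD(2)[OF 1(1)], of \<kappa> fst fst] distr_cong[OF refl prob_algebraD(2)[OF 1(2)], of \<kappa> snd snd] by auto
  \<comment> \<open>A set outside the \<open>\<sigma>\<close>-algebra has measure 0 by convention, but here the measure is at least \<open>\<alpha>\<close>.\<close>
  have G: "G \<in> sets \<kappa>"
    using \<kappa>(2) \<alpha> measure_notin_sets[of G \<kappa>] unfolding G_def[symmetric] by force
  define \<beta> where "\<beta> = measure \<kappa> (space \<kappa> - G)"
  have \<beta>: "\<beta> = 1 - measure \<kappa> G" "0 \<le> \<beta>" "\<beta> \<le> 1 - \<alpha>"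
    using \<kappa>.prob_compl[OF G] \<kappa>(2) unfolding \<beta>_def G_def[symmetric] by auto
  obtain B where B: "\<And>x. x \<in> K \<Longrightarrow> \<bar>u x\<bar> \<le> B" using Lip1_bound[OF u] by blast
  have gm: "g \<in> borel_measurable FS" unfolding g_def by (rule mean_after_measurable[OF u])
  have gb: "\<bar>g x\<bar> \<le> B" if "x \<in> K" for x unfolding g_def by (rule mean_after_bound[OF u B that])
  have gl: "\<bar>g x - g y\<bar> \<le> 4 * tv_dist x y" if "x \<in> K" "y \<in> K" for x y
    using mean_after_lipschitz[OF u, of "Suc k + l"] that by (simp add: g_def lipschitz_def)
  have gfm: "(\<lambda>z. g (fst z)) \<in> borel_measurable \<kappa>" "(\<lambda>z. g (snd z)) \<in> borel_measurable \<kappa>"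
    using measurable_compose[OF fst_m gm] measurable_compose[OF snd_m gm] by auto
  have gi: "integrable \<kappa> (\<lambda>z. g (fst z))" "integrable \<kappa> (\<lambda>z. g (snd z))"
    using gfm gb spk by (auto intro!: \<kappa>.integrable_const_bound[where B=B])
  have intI: "integrable \<kappa> (\<lambda>z. indicator A z * f z)" if "A \<in> sets \<kappa>" "integrable \<kappa> f" for A and f :: "_ \<Rightarrow> real"
    using integrable_mult_indicator[OF that] by simp
  have Gc: "space \<kappa> - G \<in> sets \<kappa>" using G by auto
  have total: "(\<integral>x. g x \<partial>?\<mu>1) - (\<integral>x. g x \<partial>?\<nu>1)
      = (\<integral>z. indicator G z * (g (fst z) - g (snd z)) \<partial>\<kappa>)
        + ((\<integral>z. indicator (space \<kappa> - G) z * g (fst z) \<partial>\<kappa>) - (\<integral>z. indicator (space \<kappa> - G) z * g (snd z) \<partial>\<kappa>))"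
  proof -
    have "(\<integral>x. g x \<partial>?\<mu>1) = (\<integral>z. g (fst z) \<partial>\<kappa>)" "(\<integral>x. g x \<partial>?\<nu>1) = (\<integral>z. g (snd z) \<partial>\<kappa>)"
      using integral_distr[OF fst_m gm] integral_distr[OF snd_m gm] d1' d2' by auto
    then have "(\<integral>x. g x \<partial>?\<mu>1) - (\<integral>x. g x \<partial>?\<nu>1) = (\<integral>z. g (fst z) - g (snd z) \<partial>\<kappa>)" using gi by simp
    also have "\<dots> = (\<integral>z. indicator G z * (g (fst z) - g (snd z))
        + (indicator (space \<kappa> - G) z * g (fst z) - indicator (space \<kappa> - G) z * g (snd z)) \<partial>\<kappa>)"
      by (rule Bochner_Integration.integral_cong) (auto simp: indicator_def)
    also have "\<dots> = (\<integral>z. indicator G z * (g (fst z) - g (snd z)) \<partial>\<kappa>)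
        + (\<integral>z. indicator (space \<kappa> - G) z * g (fst z) - indicator (space \<kappa> - G) z * g (snd z) \<partial>\<kappa>)"
      using gi by (intro Bochner_Integration.integral_add intI G Bochner_Integration.integrable_diff Gc) auto
    also have "(\<integral>z. indicator (space \<kappa> - G) z * g (fst z) - indicator (space \<kappa> - G) z * g (snd z) \<partial>\<kappa>)
       = (\<integral>z. indicator (space \<kappa> - G) z * g (fst z) \<partial>\<kappa>) - (\<integral>z. indicator (space \<kappa> - G) z * g (snd z) \<partial>\<kappa>)"
      by (intro Bochner_Integration.integral_diff intI Gc gi)
    finally show ?thesis .
  qed
  have onG: "(\<integral>z. indicator G z * (g (fst z) - g (snd z)) \<partial>\<kappa>) \<le> 4 * \<rho> * (1 - \<beta>)"
  proof -
    have "(\<integral>z. indicator G z * (g (fst z) - g (snd z)) \<partial>\<kappa>) \<le> (\<integral>z. 4 * \<rho> * indicator G z \<partial>\<kappa>)"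
    proof (rule integral_mono)
      show "integrable \<kappa> (\<lambda>z. indicator G z * (g (fst z) - g (snd z)))" using gi by (intro intI G) auto
      show "integrable \<kappa> (\<lambda>z. 4 * \<rho> * indicator G z)" using G \<kappa>.emeasure_finite[of G] by (simp add: less_top[symmetric])
      fix z assume "z \<in> space \<kappa>"
      show "indicator G z * (g (fst z) - g (snd z)) \<le> 4 * \<rho> * indicator G z"
        using gl[of "fst z" "snd z"] by (auto simp: G_def indicator_def)
    qed
    then show ?thesis using G \<beta>(1) by simp
  qed
  have offG: "(\<integral>z. indicator (space \<kappa> - G) z * g (fst z) \<partial>\<kappa>) - (\<integral>z. indicator (space \<kappa> - G) z * g (snd z) \<partial>\<kappa>)
      \<le> \<beta> * c + 8 * err k \<pi>"
  proof (cases "\<beta> = 0")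
    case True
    have "AE z in \<kappa>. z \<notin> space \<kappa> - G"
      using True Gc unfolding \<beta>_def by (intro AE_not_in) (simp add: null_sets_def \<kappa>.emeasure_eq_measure)
    then have "(\<integral>z. indicator (space \<kappa> - G) z * f z \<partial>\<kappa>) = 0" for f :: "_ \<Rightarrow> real"
      by (intro integral_eq_zero_AE) (auto elim!: eventually_mono)
    then show ?thesis using True err_nonneg by simp
  next
    case False
    then have \<beta>p: "0 < \<beta>" using \<beta>(2) by linarith
    define w where "w z = indicator (space \<kappa> - G) z / \<beta>" for z
    have w: "w \<in> borel_measurable \<kappa>" "\<And>z. 0 \<le> w z" "\<And>z. w z \<le> 1 / \<beta>"
    proof -
      show "w \<in> borel_measurable \<kappa>"
        unfolding w_def[abs_def] by (intro borel_measurable_divide borel_measurable_indicator Gc borel_measurable_const)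
    qed (use \<beta>p in \<open>auto simp: w_def indicator_def divide_right_mono\<close>)
    define \<kappa>' where "\<kappa>' = density \<kappa> (\<lambda>z. ennreal (w z))"
    have "emeasure \<kappa>' (space \<kappa>') = (\<integral>\<^sup>+z. ennreal (w z) \<partial>\<kappa>)"
      using w(1) by (simp add: \<kappa>'_def emeasure_density cong: nn_integral_cong)
    also have "\<dots> = (\<integral>\<^sup>+z. ennreal (1 / \<beta>) * indicator (space \<kappa> - G) z \<partial>\<kappa>)"
      using \<beta>p by (intro nn_integral_cong) (auto simp: w_def indicator_def)
    also have "\<dots> = ennreal (1 / \<beta>) * ennreal \<beta>"
      using Gc by (simp add: nn_integral_cmult_indicator \<kappa>.emeasure_eq_measure \<beta>_def)
    also have "\<dots> = 1" using \<beta>p by (simp add: ennreal_mult[symmetric])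
    finally have ps': "prob_space \<kappa>'" by (rule prob_spaceI)
    have side: "\<exists>\<mu>'\<in>PB. \<bar>(\<integral>z. indicator (space \<kappa> - G) z * g (p z) \<partial>\<kappa>) - \<beta> * (\<integral>x. mean_after l u x \<partial>\<mu>')\<bar> \<le> 4 * err k \<pi>"
      if p: "p \<in> \<kappa> \<rightarrow>\<^sub>M FS" and dp: "distr \<kappa> FS p = \<eta>" and \<eta>: "\<eta> \<in> space (prob_algebra FS)" "bary \<eta> = \<pi>" for p \<eta>
    proof -
      have p': "p \<in> \<kappa>' \<rightarrow>\<^sub>M FS" using p by (simp add: \<kappa>'_def)
      let ?m = "distr \<kappa>' FS p"
      have mp: "?m \<in> space (prob_algebra FS)"
        using prob_space.prob_space_distr[OF ps' p'] by (simp add: space_prob_algebra)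
      obtain \<mu>' where \<mu>': "\<mu>' \<in> PB"
        "\<bar>(\<integral>x. g x \<partial>?m) - (\<integral>x. mean_after l u x \<partial>\<mu>')\<bar> \<le> 4 * err k (bary ?m)"
        using recentre_after[OF mp, of k] u unfolding g_def by metis
      have mint: "\<beta> * (\<integral>x. g x \<partial>?m) = (\<integral>z. indicator (space \<kappa> - G) z * g (p z) \<partial>\<kappa>)"
      proof -
        have gp: "(\<lambda>z. g (p z)) \<in> borel_measurable \<kappa>" by (rule measurable_compose[OF p gm])
        have "(\<integral>x. g x \<partial>?m) = (\<integral>z. w z * g (p z) \<partial>\<kappa>)"
          using integral_distr[OF p' gm] w gp by (simp add: \<kappa>'_def integral_density)
        also have "\<dots> = (\<integral>z. (indicator (space \<kappa> - G) z * g (p z)) / \<beta> \<partial>\<kappa>)" by (simp add: w_def)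
        finally show ?thesis using \<beta>p by simp
      qed
      have dm: "(\<lambda>x. \<integral>\<^sup>+s. ennreal (tv_dist (S.Qn (Suc k) s) \<pi>) \<partial>x) \<in> borel_measurable FS"
        using measurable_compose[OF id_measurable_subprob nn_integral_measurable_subprob_algebra]
          tv_kernel_measurable[of k] by (simp del: kernel_power.simps)
      have "ennreal (err k (bary ?m)) = (\<integral>\<^sup>+x. (\<integral>\<^sup>+s. ennreal (tv_dist (S.Qn (Suc k) s) \<pi>) \<partial>x) \<partial>?m)"
        unfolding err_nn[OF bary_prob[OF mp], symmetric] using tv_kernel_measurable[of k]
        by (intro nn_integral_bary[OF mp]) (simp del: kernel_power.simps)
      also have "\<dots> = (\<integral>\<^sup>+z. ennreal (w z) * (\<integral>\<^sup>+s. ennreal (tv_dist (S.Qn (Suc k) s) \<pi>) \<partial>p z) \<partial>\<kappa>)"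
        using w(1) p' dm measurable_compose[OF p dm] unfolding \<kappa>'_def
        by (subst nn_integral_distr) (simp_all add: nn_integral_density del: kernel_power.simps)
      also have "\<dots> \<le> (\<integral>\<^sup>+z. ennreal (1 / \<beta>) * (\<integral>\<^sup>+s. ennreal (tv_dist (S.Qn (Suc k) s) \<pi>) \<partial>p z) \<partial>\<kappa>)"
        using w(3) by (intro nn_integral_mono mult_right_mono ennreal_leI) auto
      also have "\<dots> = ennreal (1 / \<beta>) * (\<integral>\<^sup>+z. (\<integral>\<^sup>+s. ennreal (tv_dist (S.Qn (Suc k) s) \<pi>) \<partial>p z) \<partial>\<kappa>)"
        by (rule nn_integral_cmult[OF measurable_compose[OF p dm]])
      also have "(\<integral>\<^sup>+z. (\<integral>\<^sup>+s. ennreal (tv_dist (S.Qn (Suc k) s) \<pi>) \<partial>p z) \<partial>\<kappa>) = (\<integral>\<^sup>+x. (\<integral>\<^sup>+s. ennreal (tv_dist (S.Qn (Suc k) s) \<pi>) \<partial>x) \<partial>\<eta>)"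
        unfolding dp[symmetric] using dm by (intro nn_integral_distr[OF p, symmetric]) simp
      also have "\<dots> = (\<integral>\<^sup>+s. ennreal (tv_dist (S.Qn (Suc k) s) \<pi>) \<partial>bary \<eta>)"
        using tv_kernel_measurable[of k]
        by (intro nn_integral_bary[OF \<eta>(1), symmetric]) (simp del: kernel_power.simps)
      also have "\<dots> = ennreal (err k \<pi>)" unfolding \<eta>(2) by (rule err_nn[OF pi_prob])
      finally have "err k (bary ?m) \<le> 1 / \<beta> * err k \<pi>"
        using \<beta>p err_nonneg[of k \<pi>] by (simp add: ennreal_mult[symmetric] del: times_divide_eq_left)
      then have "\<beta> * err k (bary ?m) \<le> err k \<pi>" using \<beta>p by (simp add: field_simps)
      moreover have "\<bar>\<beta> * (\<integral>x. g x \<partial>?m) - \<beta> * (\<integral>x. mean_after l u x \<partial>\<mu>')\<bar> \<le> \<beta> * (4 * err k (bary ?m))"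
        using mult_left_mono[OF \<mu>'(2), of \<beta>] \<beta>p by (simp add: abs_mult flip: right_diff_distrib)
      ultimately show ?thesis using \<mu>'(1) unfolding mint by (intro bexI[of _ \<mu>']) auto
    qed
    obtain \<mu>' where \<mu>': "\<mu>' \<in> PB" "\<bar>(\<integral>z. indicator (space \<kappa> - G) z * g (fst z) \<partial>\<kappa>) - \<beta> * (\<integral>x. mean_after l u x \<partial>\<mu>')\<bar> \<le> 4 * err k \<pi>"
      using side[OF fst_m d1' 1(1) b1(1)] by blast
    obtain \<nu>' where \<nu>': "\<nu>' \<in> PB" "\<bar>(\<integral>z. indicator (space \<kappa> - G) z * g (snd z) \<partial>\<kappa>) - \<beta> * (\<integral>x. mean_after l u x \<partial>\<nu>')\<bar> \<le> 4 * err k \<pi>"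
      using side[OF snd_m d2' 1(2) b1(2)] by blast
    have "(\<integral>x. mean_after l u x \<partial>\<mu>') - (\<integral>x. mean_after l u x \<partial>\<nu>') \<le> c" using c(1) u \<mu>'(1) \<nu>'(1) by (simp add: oscillation_le_def)
    then have "\<beta> * (\<integral>x. mean_after l u x \<partial>\<mu>') - \<beta> * (\<integral>x. mean_after l u x \<partial>\<nu>') \<le> \<beta> * c"
      using \<beta>p by (simp flip: right_diff_distrib)
    then show ?thesis using \<mu>'(2) \<nu>'(2) by linarith
  qed
  have "(\<integral>x. mean_after (N + (Suc k + l)) u x \<partial>\<mu>) - (\<integral>x. mean_after (N + (Suc k + l)) u x \<partial>\<nu>) = (\<integral>x. g x \<partial>?\<mu>1) - (\<integral>x. g x \<partial>?\<nu>1)"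
    unfolding g_def integral_mean_after_add[OF \<mu>p u] integral_mean_after_add[OF \<nu>p u] ..
  also have "\<dots> \<le> 4 * \<rho> * (1 - \<beta>) + (\<beta> * c + 8 * err k \<pi>)" unfolding total using onG offG by linarith
  also have "\<dots> = 4 * \<rho> + \<beta> * (c - 4 * \<rho>) + 8 * err k \<pi>" by (simp add: algebra_simps)
  also have "\<beta> * (c - 4 * \<rho>) \<le> (1 - \<alpha>) * (c - 4 * \<rho>)" using \<beta>(3) c(2) by (intro mult_right_mono) auto
  finally show "(\<integral>x. mean_after (N + (Suc k + l)) u x \<partial>\<mu>) - (\<integral>x. mean_after (N + (Suc k + l)) u x \<partial>\<nu>)
      \<le> 4 * \<rho> + (1 - \<alpha>) * (c - 4 * \<rho>) + 8 * err k \<pi>" by simp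
qed

section \<open>Weak contraction and weak ergodicity\<close>


text \<open>
  The map \<open>c \<mapsto> 4\<rho> + (1 - \<alpha>)(c - 4\<rho>) + 4\<alpha>\<rho>\<close> has the fixed point \<open>8\<rho>\<close>, and iterating it reduces the
  distance to the fixed point by the factor \<open>1 - \<alpha>\<close>.
\<close>

lemma oscillation_le_eventually:
  assumes E: "condition_E lam \<tau> m \<pi>" and \<eta>: "0 < \<eta>"
  shows "\<exists>L. \<forall>l\<ge>L. oscillation_le l \<eta>"
proof -
  \<comment> \<open>The iteration ends at \<open>8\<rho> + 16\<rho>\<close>.\<close>
  define \<rho> where "\<rho> = \<eta> / 24"
  have \<rho>: "0 < \<rho>" using \<eta> by (simp add: \<rho>_def)
  from E[unfolded condition_E_def, rule_format, OF \<rho>] obtain N \<alpha>0 where N: "0 < \<alpha>0"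
    "\<forall>\<mu>\<in>PB. \<forall>\<nu>\<in>PB. \<exists>\<kappa>. coupling (\<mu> \<bind> P.Qn N) (\<nu> \<bind> P.Qn N) \<kappa> \<and>
       measure \<kappa> {(x, y) \<in> K \<times> K. tv_dist x y < \<rho>} \<ge> \<alpha>0" by blast
  \<comment> \<open>The truncation keeps the powers of \<open>1 - \<alpha>\<close> nonnegative.\<close>
  define \<alpha> where "\<alpha> = min \<alpha>0 1"
  have \<alpha>: "0 < \<alpha>" "\<alpha> \<le> 1" using N by (auto simp: \<alpha>_def)
  have E': "\<forall>\<mu>\<in>PB. \<forall>\<nu>\<in>PB. \<exists>\<kappa>. coupling (\<mu> \<bind> P.Qn N) (\<nu> \<bind> P.Qn N) \<kappa> \<and>
       measure \<kappa> {(x, y) \<in> K \<times> K. tv_dist x y < \<rho>} \<ge> \<alpha>"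
    using N(2) unfolding \<alpha>_def by (meson min.coboundedI1)
  have "\<forall>\<^sub>F k in sequentially. err k \<pi> < \<alpha> * \<rho> / 2"
    by (rule order_tendstoD(2)[OF err_tendsto_0[OF pi_prob]]) (use \<alpha> \<rho> in simp)
  then obtain k where "err k \<pi> < \<alpha> * \<rho> / 2" using eventually_happens'[OF sequentially_bot] by blast
  then have k: "8 * err k \<pi> \<le> \<alpha> * (4 * \<rho>)" by simp
  have mono: "oscillation_le l c \<Longrightarrow> c \<le> c' \<Longrightarrow> oscillation_le l c'" for l c c'
    unfolding oscillation_le_def by force
  have iter: "\<exists>L. \<forall>l\<ge>L. oscillation_le l (8 * \<rho> + (1 - \<alpha>) ^ j * 16)" for j
  proof (induction j)
    case 0
    then show ?case using mono[OF oscillation_le_16] \<rho> by auto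
  next
    case (Suc j)
    then obtain L where L: "\<And>l. l \<ge> L \<Longrightarrow> oscillation_le l (8 * \<rho> + (1 - \<alpha>) ^ j * 16)" by blast
    let ?c = "8 * \<rho> + (1 - \<alpha>) ^ j * 16"
    have "oscillation_le l (8 * \<rho> + (1 - \<alpha>) ^ Suc j * 16)" if l: "l \<ge> N + (Suc k + L)" for l
    proof -
      define i where "i = l - (N + Suc k)"
      have i: "l = N + (Suc k + i)" "i \<ge> L" using l by (auto simp: i_def)
      have "0 \<le> (1 - \<alpha>) ^ j" using \<alpha> by simp
      then have "4 * \<rho> \<le> ?c" using \<rho> by simp
      from oscillation_le_step[OF L[OF i(2)] this \<rho> \<alpha>(1) E', of k]
      have "oscillation_le l (4 * \<rho> + (1 - \<alpha>) * (?c - 4 * \<rho>) + 8 * err k \<pi>)" unfolding i(1) .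
      moreover have "4 * \<rho> + (1 - \<alpha>) * (?c - 4 * \<rho>) + 8 * err k \<pi> \<le> 8 * \<rho> + (1 - \<alpha>) ^ Suc j * 16"
        using k by (simp add: algebra_simps)
      ultimately show ?thesis by (rule mono)
    qed
    then show ?case by blast
  qed
  have "(\<lambda>j. (1 - \<alpha>) ^ j) \<longlonglongrightarrow> 0" using \<alpha> by (intro LIMSEQ_power_zero) simp
  then have "\<forall>\<^sub>F j in sequentially. (1 - \<alpha>) ^ j < \<rho>" by (rule order_tendstoD(2)) (rule \<rho>)
  then obtain j where "(1 - \<alpha>) ^ j < \<rho>" using eventually_happens'[OF sequentially_bot] by blast
  then have "8 * \<rho> + (1 - \<alpha>) ^ j * 16 \<le> \<eta>" by (simp add: \<rho>_def)
  then show ?thesis using iter[of j] mono by blast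
qed

lemma return_prob: "x \<in> K \<Longrightarrow> return FS x \<in> space (prob_algebra FS)"
  using measurable_space[OF measurable_return_prob_space[of FS], of x] by simp

lemma return_bind_kernel_power: "x \<in> K \<Longrightarrow> return FS x \<bind> P.Qn n = P.Qn n x"
  by (rule bind_return[OF P.measurable_kernel_power_subprob]) simp

lemma integral_return_mean_after:
  assumes "x \<in> K" "u \<in> Lip1 K tv_dist" shows "(\<integral>z. mean_after n u z \<partial>return FS x) = mean_after n u x"
  by (rule integral_return) (simp_all add: assms mean_after_measurable)

text \<open>
  Two point masses are first moved, in \<open>k + 1\<close> steps and at a small cost, to laws with barycentre
  \<open>\<pi>\<close>; these are then forgotten.
\<close>

lemma mean_after_contracts:
  assumes E: "condition_E lam \<tau> m \<pi>" and x: "x \<in> K" and y: "y \<in> K" and \<eta>: "0 < \<eta>"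
  shows "\<exists>L. \<forall>n\<ge>L. \<forall>u\<in>Lip1 K tv_dist. mean_after n u x - mean_after n u y \<le> \<eta>"
proof -
  let ?bx = "bary (return FS x)" and ?by = "bary (return FS y)"
  have small: "\<forall>\<^sub>F k in sequentially. err k (bary (return FS z)) < \<eta> / 12" if "z \<in> K" for z
    by (rule order_tendstoD(2)[OF err_tendsto_0[OF bary_prob[OF return_prob[OF that]]]]) (use \<eta> in simp)
  from small[OF x] small[OF y] have "\<forall>\<^sub>F k in sequentially. err k ?bx < \<eta> / 12 \<and> err k ?by < \<eta> / 12" by (rule eventually_conj)
  then obtain k where k: "err k ?bx < \<eta> / 12" "err k ?by < \<eta> / 12"
    using eventually_happens'[OF sequentially_bot] by blast
  obtain \<mu> where \<mu>: "\<mu> \<in> PB" "\<And>u l. u \<in> Lip1 K tv_dist \<Longrightarrow>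
      \<bar>(\<integral>z. mean_after (Suc k + l) u z \<partial>return FS x) - (\<integral>z. mean_after l u z \<partial>\<mu>)\<bar> \<le> 4 * err k ?bx"
    using recentre_after[OF return_prob[OF x], of k] by blast
  obtain \<nu> where \<nu>: "\<nu> \<in> PB" "\<And>u l. u \<in> Lip1 K tv_dist \<Longrightarrow>
      \<bar>(\<integral>z. mean_after (Suc k + l) u z \<partial>return FS y) - (\<integral>z. mean_after l u z \<partial>\<nu>)\<bar> \<le> 4 * err k ?by"
    using recentre_after[OF return_prob[OF y], of k] by blast
  obtain L where L: "\<And>l. l \<ge> L \<Longrightarrow> oscillation_le l (\<eta> / 3)" using oscillation_le_eventually[OF E, of "\<eta>/3"] \<eta> by auto
  have "mean_after n u x - mean_after n u y \<le> \<eta>" if n: "n \<ge> Suc k + L" and u: "u \<in> Lip1 K tv_dist" for n u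
  proof -
    define l where "l = n - Suc k"
    have l: "n = Suc k + l" "l \<ge> L" using n by (auto simp: l_def)
    have "(\<integral>z. mean_after l u z \<partial>\<mu>) - (\<integral>z. mean_after l u z \<partial>\<nu>) \<le> \<eta> / 3"
      using L[OF l(2)] \<mu>(1) \<nu>(1) u by (simp add: oscillation_le_def)
    moreover have "\<bar>mean_after n u x - (\<integral>z. mean_after l u z \<partial>\<mu>)\<bar> \<le> 4 * err k ?bx"
      using \<mu>(2)[OF u, of l] integral_return_mean_after[OF x u] by (simp add: l(1))
    moreover have "\<bar>mean_after n u y - (\<integral>z. mean_after l u z \<partial>\<nu>)\<bar> \<le> 4 * err k ?by"
      using \<nu>(2)[OF u, of l] integral_return_mean_after[OF y u] by (simp add: l(1))
    ultimately show ?thesis using k by linarith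
  qed
  then show ?thesis by blast
qed

lemma zero_Lip1: "(\<lambda>_. 0) \<in> Lip1 K tv_dist"
  by (auto simp: Lip1_def tv_dist_nonneg intro!: boundedI[where B=0])

lemma weakly_contracting_filter_kernel:
  assumes E: "condition_E lam \<tau> m \<pi>" shows "weakly_contracting K tv_dist fk"
  unfolding weakly_contracting_def
proof (intro ballI)
  fix x y assume xy: "x \<in> K" "y \<in> K"
  let ?S = "\<lambda>n. SUP u\<in>Lip1 K tv_dist. ereal (mean_after n u x - mean_after n u y)"
  have ge: "0 \<le> ?S n" for n
    by (rule SUP_upper2[OF zero_Lip1]) (simp add: mean_after_def)
  have "?S \<longlonglongrightarrow> 0"
  proof (rule order_tendstoI)
    fix a :: ereal assume "a < 0"
    then show "\<forall>\<^sub>F n in sequentially. a < ?S n" by (intro always_eventually allI less_le_trans[OF _ ge])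
  next
    fix a :: ereal assume "0 < a"
    then obtain \<eta> :: real where \<eta>: "0 < \<eta>" "ereal \<eta> < a"
      using ereal_dense2[of 0 a] by (auto simp: zero_ereal_def)
    obtain L where L: "\<And>n u. n \<ge> L \<Longrightarrow> u \<in> Lip1 K tv_dist \<Longrightarrow> mean_after n u x - mean_after n u y \<le> \<eta>"
      using mean_after_contracts[OF E xy \<eta>(1)] by blast
    have "?S n \<le> ereal \<eta>" if "n \<ge> L" for n
      using L[OF that] by (intro SUP_least) simp
    then show "\<forall>\<^sub>F n in sequentially. ?S n < a"
      using \<eta>(2) by (auto simp: eventually_sequentially intro!: exI[of _ L] intro: le_less_trans)
  qed
  then show "(\<lambda>n. SUP u\<in>Lip1 K tv_dist. ereal ((\<integral>z. u z \<partial>P.Qn n x) - (\<integral>z. u z \<partial>P.Qn n y))) \<longlonglongrightarrow> 0"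
    by (simp add: mean_after_def)
qed

definition adherent :: "'s measure set \<Rightarrow> 's measure set" where
  "adherent Q = {x \<in> K. \<forall>e>0. \<exists>q\<in>Q. tv_dist x q < e}"

lemma adherent_sets:
  assumes "Q \<subseteq> K" shows "adherent Q \<in> sets FS"
proof -
  have "adherent Q = Km.mtopology closure_of Q"
    using assms by (auto simp: adherent_def Km.metric_closure_of Km.mball_def) (meson subsetD)
  then have "closedin Km.mtopology (adherent Q)" by simp
  then have "openin Km.mtopology (K - adherent Q)" by (simp add: closedin_def)
  then have "K - adherent Q \<in> sets FS" by (rule Km.openin_in_sets)
  then have "space FS - (K - adherent Q) \<in> sets FS" by (rule sets.compl_sets)
  moreover have "space FS - (K - adherent Q) = adherent Q" by (auto simp: adherent_def)
  ultimately show ?thesis by simp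
qed

text \<open>
  Near \<open>(x, a)\<close> the filter is continuous, because its mass is positive there. The open condition
  \<open>hom_ext u (upd x a) < \<delta> mass (upd x a)\<close> expresses that the filter is within \<open>\<delta>\<close> of its value at \<open>(x, a)\<close>
  in terms of functions that are continuous everywhere.
\<close>

lemma adherent_filter:
  assumes D: "\<And>V :: 'a set. open V \<Longrightarrow> V \<noteq> {} \<Longrightarrow> \<exists>d\<in>D. d \<in> V" and Q: "Q \<subseteq> K"
    and x: "x \<in> adherent Q" and a: "0 < mass (upd x a)"
  shows "filt x a \<in> adherent ((\<lambda>(q, d). filt q d) ` (Q \<times> D))"
proof -
  have xK: "x \<in> K" using x by (simp add: adherent_def)
  let ?z = "filt x a"
  have zK: "?z \<in> K" by (rule filt_in_K[OF xK])
  show ?thesis unfolding adherent_def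
  proof (intro CollectI conjI zK allI impI)
    fix e :: real assume e: "0 < e"
    define u where "u z = min 1 (tv_dist ?z z)" for z
    have ul: "lipschitz K tv_dist 1 u"
      unfolding lipschitz_def
    proof (intro ballI)
      fix y y' assume "y \<in> K" "y' \<in> K"
      then have "\<bar>tv_dist ?z y - tv_dist ?z y'\<bar> \<le> tv_dist y y'"
        using Km.mdist_reverse_triangle[of y ?z y'] zK by (simp add: tv_dist_commute)
      then show "\<bar>u y - u y'\<bar> \<le> 1 * tv_dist y y'" by (auto simp: u_def min_def)
    qed
    have u01: "0 \<le> u z" "u z \<le> 1" for z by (auto simp: u_def tv_dist_nonneg)
    have H: "homlip lam 4 (hom_ext u)"
      using u01 by (intro homlip_hom_ext ul) (auto intro: order_trans[of _ 1])
    define \<delta> where "\<delta> = min e 1"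
    have \<delta>: "0 < \<delta>" "\<delta> \<le> e" "\<delta> \<le> 1" using e by (auto simp: \<delta>_def)
    let ?f = "\<lambda>(x, a). \<delta> * mass (upd x a) - hom_ext u (upd x a)"
    have contH: "continuous_map (prod_topology Km.mtopology euclidean) euclideanreal (\<lambda>(x, a). U (upd x a))"
      if "homlip lam c U" for c U
      using continuous_map_compose[OF continuous_upd_K homlip_continuous[OF that]] by (simp add: comp_def case_prod_unfold)
    have contf: "continuous_map (prod_topology Km.mtopology euclidean) euclideanreal ?f"
      using contH[OF homlip_mass] contH[OF H] unfolding case_prod_unfold
      by (intro continuous_map_diff continuous_map_real_mult_left) auto
    define G where "G = {z \<in> topspace (prod_topology Km.mtopology (euclidean :: 'a topology)). ?f z \<in> {0<..}}"
    have oG: "openin (prod_topology Km.mtopology euclidean) G"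
      unfolding G_def by (rule openin_continuous_map_preimage[OF contf]) (simp add: open_openin[symmetric])
    have "hom_ext u (upd x a) = mass (upd x a) * u ?z"
      using mass_mult_filt[OF H xK, of a] hom_ext_prob[OF zK] by simp
    also have "u ?z = 0" using zK by (simp add: u_def)
    finally have "(x, a) \<in> G" using a \<delta> xK by (simp add: G_def)
    then obtain U V where UV: "openin Km.mtopology U" "open V" "x \<in> U" "a \<in> V" "U \<times> V \<subseteq> G"
      using oG unfolding openin_prod_topology_alt by (metis open_openin)
    obtain r where r: "0 < r" "Km.mball x r \<subseteq> U" using UV(1,3) unfolding Km.openin_mtopology by blast
    obtain q where q: "q \<in> Q" "tv_dist x q < r" using x r(1) by (auto simp: adherent_def)
    have qK: "q \<in> K" using q Q by auto
    obtain d where d: "d \<in> D" "d \<in> V" using D[OF UV(2)] UV(4) by blast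
    have "(q, d) \<in> G" using UV(5) r(2) q d qK xK by auto
    then have pos: "hom_ext u (upd q d) < \<delta> * mass (upd q d)" by (simp add: G_def)
    have he: "hom_ext u (upd q d) = mass (upd q d) * u (filt q d)"
      using mass_mult_filt[OF H qK, of d] hom_ext_prob[OF filt_in_K[OF qK], of u d] by simp
    have "mass (upd q d) \<noteq> 0" using pos he by auto
    then have "0 < mass (upd q d)" using mass_nonneg[of "upd q d"] by simp
    then have "u (filt q d) < \<delta>" using pos unfolding he by (simp add: mult.commute)
    then have "tv_dist ?z (filt q d) < e" using \<delta> by (auto simp: u_def min_def split: if_splits)
    then show "\<exists>q\<in>(\<lambda>(q, d). filt q d) ` (Q \<times> D). tv_dist ?z q < e" using q d by auto
  qed
qed

lemma AE_filter_kernel_adherent: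
  assumes D: "\<And>V :: 'a set. open V \<Longrightarrow> V \<noteq> {} \<Longrightarrow> \<exists>d\<in>D. d \<in> V" and Q: "Q \<subseteq> K" and x: "x \<in> adherent Q"
  shows "AE z in fk x. z \<in> adherent ((\<lambda>(q, d). filt q d) ` (Q \<times> D))"
proof -
  let ?N = "adherent ((\<lambda>(q, d). filt q d) ` (Q \<times> D))"
  have xK: "x \<in> K" using x by (simp add: adherent_def)
  have N: "?N \<in> sets FS" using Q filt_in_K by (intro adherent_sets) auto
  note [measurable] = N measurable_filt[OF xK] mass_upd_measurable[OF prob_dens_fin_dens[OF xK]]
  have "AE a in density \<tau> (\<lambda>a. ennreal (mass (upd x a))). filt x a \<in> ?N"
    by (subst AE_density) (use adherent_filter[OF D Q x] in auto)
  moreover have "{z \<in> space FS. z \<in> ?N} \<in> sets FS"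
  proof -
    have "{z \<in> space FS. z \<in> ?N} = ?N" by (auto simp: adherent_def)
    then show ?thesis using N by (simp only:)
  qed
  ultimately show ?thesis
    unfolding filter_kernel_eq[OF xK] by (subst AE_distr_iff) auto
qed

text \<open>
  Observations come from a separable space. If a law is carried by the closure of a countable set \<open>Q\<close>,
  the next law is carried by the closure of the filters that start in \<open>Q\<close> and see an observation in a countable
  dense set.
\<close>

lemma separable_support:
  assumes x: "x \<in> K"
  shows "\<exists>q :: nat \<Rightarrow> 's measure. (\<forall>i. q i \<in> K) \<and> (\<forall>n. AE z in P.Qn n x. \<forall>e>0. \<exists>i. tv_dist z (q i) < e)"
proof -
  obtain D :: "'a set" where D: "countable D" "\<And>V. open V \<Longrightarrow> V \<noteq> {} \<Longrightarrow> \<exists>d\<in>D. d \<in> V"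
    using countable_dense_setE by blast
  define Q where "Q = rec_nat {x} (\<lambda>_ Q. (\<lambda>(q, d). filt q d) ` (Q \<times> D))"
  have Q0: "Q 0 = {x}" and QS: "Q (Suc n) = (\<lambda>(q, d). filt q d) ` (Q n \<times> D)" for n by (simp_all add: Q_def)
  have QK: "Q n \<subseteq> K" for n using x filt_in_K by (induction n) (auto simp: Q0 QS)
  have Qc: "countable (Q n)" for n using D(1) by (induction n) (auto simp: Q0 QS)
  have AEn: "AE z in P.Qn n x. z \<in> adherent (Q n)" for n
  proof (induction n)
    case 0
    have "x \<in> adherent (Q 0)" using x by (auto simp: adherent_def Q0)
    have [measurable]: "adherent (Q 0) \<in> sets FS" by (rule adherent_sets[OF QK])
    have "Measurable.pred FS (\<lambda>z. z \<in> adherent (Q 0))" by measurable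
    then have "AE z in return FS x. z \<in> adherent (Q 0)"
      using x \<open>x \<in> adherent (Q 0)\<close> by (subst AE_return) simp_all
    then show ?case by (simp only: kernel_power.simps)
  next
    case (Suc n)
    have [measurable]: "adherent (Q k) \<in> sets FS" for k by (rule adherent_sets[OF QK])
    have eq: "P.Qn (Suc n) x = P.Qn n x \<bind> fk"
      using P.kernel_power_add[of x n "Suc 0"] x by (simp add: kernel_power.simps(2)[abs_def])
    have m: "fk \<in> P.Qn n x \<rightarrow>\<^sub>M subprob_algebra FS"
      using P.kernel_subprob measurable_from_prob[OF prob_kernel_power[OF x]] by blast
    have "AE y in P.Qn n x. AE z in fk y. z \<in> adherent (Q (Suc n))"
      using Suc
    proof eventually_elim
      case (elim y)
      show ?case unfolding QS by (rule AE_filter_kernel_adherent[OF _ QK elim]) (rule D(2))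
    qed
    then show ?case unfolding eq by (subst AE_bind[OF m]) auto
  qed
  let ?U = "\<Union>n. Q n"
  have "x \<in> Q 0" by (simp add: Q0)
  then have U: "countable ?U" "?U \<noteq> {}" "?U \<subseteq> K" using Qc QK by auto
  show ?thesis
  proof (intro exI conjI allI)
    show "from_nat_into ?U i \<in> K" for i using from_nat_into[OF U(2), of i] U(3) by blast
    fix n
    show "AE z in P.Qn n x. \<forall>e>0. \<exists>i. tv_dist z (from_nat_into ?U i) < e"
      using AEn[of n]
    proof eventually_elim
      case (elim z)
      show ?case
      proof (intro allI impI)
        fix e :: real assume "0 < e"
        then obtain q where q: "q \<in> Q n" "tv_dist z q < e" using elim by (auto simp: adherent_def)
        then have "q \<in> ?U" by blast
        then obtain i where "from_nat_into ?U i = q" using from_nat_into_surj[OF U(1)] by blast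
        then show "\<exists>i. tv_dist z (from_nat_into ?U i) < e" using q by blast
      qed
    qed
  qed
qed

lemma bary_return_pi: "bary (return FS \<pi>) = \<pi>"
  unfolding bary_def by (rule bind_return[OF id_measurable_subprob]) (simp add: pi_in_K)

lemma kernel_power_pi_PB: "P.Qn n \<pi> \<in> PB"
  using bary_bind_kernel_power[OF return_prob[OF pi_in_K], of n] bary_return_pi pi_bind_kernel_power
    return_bind_kernel_power[OF pi_in_K] prob_kernel_power[OF pi_in_K] by (simp add: PB_iff)

text \<open>
  After \<open>j + n\<close> steps from \<open>\<pi>\<close> the law is that after \<open>n\<close> steps from the initial law
  \<open>P\<^sup>j(\<pi>, \<cdot>)\<close>, which has barycentre \<open>\<pi>\<close> like the point mass at \<open>\<pi>\<close>. So the laws started at \<open>\<pi>\<close> form a Cauchy sequence.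
\<close>

lemma limit_measure_exists:
  assumes E: "condition_E lam \<tau> m \<pi>"
  obtains \<nu> where "\<nu> \<in> space (prob_algebra FS)"
    "\<And>u. u \<in> Lip1 K tv_dist \<Longrightarrow> (\<lambda>n. mean_after n u \<pi>) \<longlonglongrightarrow> (\<integral>z. u z \<partial>\<nu>)"
proof -
  from separable_support[OF pi_in_K]
  obtain q :: "nat \<Rightarrow> 's measure" where q0: "(\<forall>i. q i \<in> K) \<and> (\<forall>n. AE z in P.Qn n \<pi>. \<forall>e>0. \<exists>i. tv_dist z (q i) < e)" ..
  then have q: "\<And>i. q i \<in> K" "\<And>n. AE z in P.Qn n \<pi>. \<forall>e>0. \<exists>i. tv_dist z (q i) < e" by simp_all
  interpret lip_cauchy K tv_dist "\<lambda>n. P.Qn n \<pi>" q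
  proof unfold_locales
    show "P.Qn n \<pi> \<in> space (prob_algebra FS)" for n by (rule prob_kernel_power[OF pi_in_K])
    show "Km.mcomplete" by (rule mcomplete_prob_dens[OF sigma_finite_lam])
    fix \<epsilon> :: real assume "0 < \<epsilon>"
    then obtain L where L: "\<And>l. l \<ge> L \<Longrightarrow> oscillation_le l \<epsilon>" using oscillation_le_eventually[OF E] by blast
    have le: "mean_after n u \<pi> - mean_after k u \<pi> \<le> \<epsilon> \<and> mean_after k u \<pi> - mean_after n u \<pi> \<le> \<epsilon>"
      if "n \<ge> L" "k \<ge> n" "u \<in> Lip1 K tv_dist" for n k u
    proof -
      define j where "j = k - n"
      have k: "k = j + n" using that by (simp add: j_def)
      have evk: "mean_after k u \<pi> = (\<integral>x. mean_after n u x \<partial>P.Qn j \<pi>)"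
        using integral_mean_after_add[OF return_prob[OF pi_in_K] that(3), of j n] integral_return_mean_after[OF pi_in_K that(3)]
          return_bind_kernel_power[OF pi_in_K] by (simp add: k)
      have evn: "mean_after n u \<pi> = (\<integral>x. mean_after n u x \<partial>P.Qn 0 \<pi>)"
        using integral_return_mean_after[OF pi_in_K that(3)] by simp
      show ?thesis
        using L[OF that(1), unfolded oscillation_le_def, THEN bspec, OF that(3)] kernel_power_pi_PB[of 0] kernel_power_pi_PB[of j]
        unfolding evk evn by (simp del: kernel_power.simps)
    qed
    have "\<bar>mean_after n u \<pi> - mean_after k u \<pi>\<bar> \<le> \<epsilon>" if "n \<ge> L" "k \<ge> L" "u \<in> Lip1 K tv_dist" for n k u
      using le[of n k u] le[of k n u] that by (cases "n \<le> k") auto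
    then show "\<exists>L. \<forall>n\<ge>L. \<forall>k\<ge>L. \<forall>u\<in>Lip1 K tv_dist. \<bar>(\<integral>x. u x \<partial>P.Qn n \<pi>) - (\<integral>x. u x \<partial>P.Qn k \<pi>)\<bar> \<le> \<epsilon>"
      unfolding mean_after_def by blast
  qed (use q in auto)
  show ?thesis using limit_exists that unfolding mean_after_def by blast
qed

lemma weakly_ergodic_filter_kernel:
  assumes E: "condition_E lam \<tau> m \<pi>" shows "weakly_ergodic K tv_dist fk"
proof -
  obtain \<nu> where \<nu>: "\<nu> \<in> space (prob_algebra FS)"
    "\<And>u. u \<in> Lip1 K tv_dist \<Longrightarrow> (\<lambda>n. mean_after n u \<pi>) \<longlonglongrightarrow> (\<integral>z. u z \<partial>\<nu>)"
    using limit_measure_exists[OF E] by blast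
  have conv: "(\<lambda>n. \<integral>z. u z \<partial>P.Qn n x) \<longlonglongrightarrow> (\<integral>z. u z \<partial>\<nu>)" if u: "u \<in> Lip1 K tv_dist" and x: "x \<in> K" for u x
  proof -
    have "(\<lambda>n. mean_after n u x - mean_after n u \<pi>) \<longlonglongrightarrow> 0"
    proof (rule LIMSEQ_I)
      fix r :: real assume r: "0 < r"
      obtain L where L: "\<And>n u. n \<ge> L \<Longrightarrow> u \<in> Lip1 K tv_dist \<Longrightarrow> mean_after n u x - mean_after n u \<pi> \<le> r / 2"
        using mean_after_contracts[OF E x pi_in_K, of "r/2"] r by auto
      obtain L' where L': "\<And>n u. n \<ge> L' \<Longrightarrow> u \<in> Lip1 K tv_dist \<Longrightarrow> mean_after n u \<pi> - mean_after n u x \<le> r / 2"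
        using mean_after_contracts[OF E pi_in_K x, of "r/2"] r by auto
      have "norm (mean_after n u x - mean_after n u \<pi> - 0) < r" if "n \<ge> max L L'" for n
        using L[of n u] L'[of n u] that u r by simp
      then show "\<exists>no. \<forall>n\<ge>no. norm (mean_after n u x - mean_after n u \<pi> - 0) < r" by blast
    qed
    from tendsto_add[OF this \<nu>(2)[OF u]] show ?thesis by (simp add: mean_after_def)
  qed
  have "(\<lambda>n. \<integral>z. u z \<partial>P.Qn n x) \<longlonglongrightarrow> (\<integral>z. u z \<partial>\<nu>)" if "u \<in> bcont K tv_dist" "x \<in> K" for u x
    by (rule Km.weak_convergence_from_Lip1[OF prob_kernel_power[OF that(2)] \<nu>(1) conv[OF _ that(2)] that(1)])
  then show ?thesis
    unfolding weakly_ergodic_def using weakly_contracting_filter_kernel[OF E] \<nu>(1) by blast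
qed

end

theorem theorem4p1:
  fixes lam :: "'s::polish_space measure"
    and \<tau> :: "'a::polish_space measure"
    and m :: "'s \<Rightarrow> 's \<Rightarrow> 'a \<Rightarrow> real"
    and \<pi> :: "'s measure"
  assumes "hmm lam \<tau> m"
    and "strongly_ergodic_hmm lam \<tau> m \<pi>"
    and "regular_hmm lam m"
    and "condition_E lam \<tau> m \<pi>"
  shows "weakly_contracting (prob_dens lam) tv_dist (filter_kernel lam \<tau> m)
    \<and> ((\<exists>\<mu>\<in>space (prob_algebra (filter_space lam)). \<mu> \<bind> filter_kernel lam \<tau> m = \<mu>)
       \<or> (\<exists>x\<^sub>0\<in>prob_dens lam. tight_seq (prob_dens lam) tv_dist
            (\<lambda>n. kernel_power (filter_space lam) (filter_kernel lam \<tau> m) n x\<^sub>0))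
       \<or> uniformly_ergodic_hmm lam \<tau> m \<pi>
       \<longrightarrow> weakly_ergodic (prob_dens lam) tv_dist (filter_kernel lam \<tau> m))"
proof -
  interpret ergodic_model lam \<tau> m \<pi>
    using assms by (simp add: ergodic_model_def ergodic_model_axioms_def regular_model_def regular_model_axioms_def)
  show ?thesis
    using weakly_contracting_filter_kernel[OF assms(4)] weakly_ergodic_filter_kernel[OF assms(4)] by blast
qed

end
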